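(* Let $n,t\ge1$ and $d\ge2$ be integers, let $u=x_{i_1}x_{i_2}\cdots x_{i_d}$ and $v=x_{j_1}x_{j_2}\cdots x_{j_d}$ (indices increasing) be $t$-spread monomials of degree $d$ of $S=K[x_1,\dots,x_n]$ with $i_1=1$ and $j_1=2$, and let $I=(\mathcal{L}_t(u,v))$ be the corresponding $t$-spread lexsegment ideal of $S$. Assume $n\ge 4+(2d-3)t$. Then the following conditions are equivalent: \begin{itemize} \item[(a)] $I$ is Cohen--Macaulay; \item[(b)] $u=x_1x_{n-(d-2)t}\cdots x_{n-t}x_n$ and $v=x_2x_{2+t}\cdots x_{2+(d-1)t}$. \end{itemize}
   Context: $S=K[x_1,\dots,x_n]$ is a polynomial ring over a field $K$. For $t\ge1$, a monomial $x_{i_1}\cdots x_{i_d}$ with $i_1\le\dots\le i_d$ is $t$-spread if $i_{r+1}-i_r\ge t$ for $r=1,\dots,d-1$. $M_{n,d,t}$ is the set of $t$-spread monomials of degree $d$ of $S$. For squarefree monomials of the same degree, $x_{i_1}\cdots x_{i_d}>_{\mathrm{slex}}x_{j_1}\cdots x_{j_d}$ (indices increasing) if for some $s$ one has $i_1=j_1,\dots,i_{s-1}=j_{s-1}$ and $i_s<j_s$. For $u\ge_{\mathrm{slex}}v$ in $M_{n,d,t}$, $\mathcal{L}_t(u,v)=\{w\in M_{n,d,t}: u\ge_{\mathrm{slex}}w\ge_{\mathrm{slex}}v\}$, and $(\mathcal{L}_t(u,v))$ is the ideal of $S$ it generates, called a $t$-spread lexsegment ideal. An ideal $I$ of $S$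 is called Cohen--Macaulay if $S/I$ is a Cohen--Macaulay ring. *)

theory Defs
  imports
    "HOL-Algebra.QuotRing"
    "HOL-Algebra.Ring_Divisibility"
    "HOL-Library.Poly_Mapping"
    "HOL-Library.Extended_Nat"
begin

section \<open>Cohen--Macaulay rings\<close>

text \<open>Localization at a multiplicatively closed set \<open>T\<close>. The factor \<open>w\<close> is needed because
  \<open>R\<close> may have zero divisors.\<close>

definition frac_rel :: "('a, 'b) ring_scheme \<Rightarrow> 'a set \<Rightarrow> (('a \<times> 'a) \<times> ('a \<times> 'a)) set" where
  "frac_rel R T = {((a, s), (b, t)). a \<in> carrier R \<and> b \<in> carrier R \<and> s \<in> T \<and> t \<in> T \<and>
     (\<exists>w\<in>T. w \<otimes>\<^bsub>R\<^esub> (a \<otimes>\<^bsub>R\<^esub> t \<ominus>\<^bsub>R\<^esub> b \<otimes>\<^bsub>R\<^esub> s) = \<zero>\<^bsub>R\<^esub>)}"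

definition fraction :: "('a, 'b) ring_scheme \<Rightarrow> 'a set \<Rightarrow> 'a \<Rightarrow> 'a \<Rightarrow> ('a \<times> 'a) set" where
  "fraction R T a s = frac_rel R T `` {(a, s)}"

definition localization :: "('a, 'b) ring_scheme \<Rightarrow> 'a set \<Rightarrow> ('a \<times> 'a) set ring" where
  "localization R T =
     \<lparr>carrier = (carrier R \<times> T) // frac_rel R T,
      mult = (\<lambda>X Y. \<Union>(a, s)\<in>X. \<Union>(b, t)\<in>Y. fraction R T (a \<otimes>\<^bsub>R\<^esub> b) (s \<otimes>\<^bsub>R\<^esub> t)),
      one = fraction R T \<one>\<^bsub>R\<^esub> \<one>\<^bsub>R\<^esub>,
      zero = fraction R T \<zero>\<^bsub>R\<^esub> \<one>\<^bsub>R\<^esub>,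
      add = (\<lambda>X Y. \<Union>(a, s)\<in>X. \<Union>(b, t)\<in>Y.
               fraction R T (a \<otimes>\<^bsub>R\<^esub> t \<oplus>\<^bsub>R\<^esub> b \<otimes>\<^bsub>R\<^esub> s) (s \<otimes>\<^bsub>R\<^esub> t))\<rparr>"

text \<open>The supremum over chains of primes is \<open>0\<close> for the zero ring (there are no primes); below
  the dimension is only applied to local rings, which are nonzero.\<close>

definition krull_dim :: "('a, 'b) ring_scheme \<Rightarrow> enat" where
  "krull_dim R = Sup {enat k | k. \<exists>P :: nat \<Rightarrow> 'a set.
     (\<forall>i\<le>k. primeideal (P i) R) \<and> (\<forall>i<k. P i \<subset> P (Suc i))}"

text \<open>Each \<open>xs ! i\<close> is a nonzerodivisor on \<open>R/(xs ! 0, \<dots>, xs ! (i - 1))\<close>, and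
  \<open>R/(xs)\<close> is nonzero.\<close>

definition regular_sequence :: "('a, 'b) ring_scheme \<Rightarrow> 'a list \<Rightarrow> bool" where
  "regular_sequence R xs \<longleftrightarrow>
     set xs \<subseteq> carrier R \<and>
     (\<forall>i<length xs. \<forall>a\<in>carrier R.
        xs ! i \<otimes>\<^bsub>R\<^esub> a \<in> Idl\<^bsub>R\<^esub> (set (take i xs)) \<longrightarrow> a \<in> Idl\<^bsub>R\<^esub> (set (take i xs))) \<and>
     Idl\<^bsub>R\<^esub> (set xs) \<noteq> carrier R"

definition depth :: "('a, 'b) ring_scheme \<Rightarrow> 'a set \<Rightarrow> enat" where
  "depth R m = Sup {enat (length xs) | xs. regular_sequence R xs \<and> set xs \<subseteq> m}"

definition cohen_macaulay_local_ring :: "('a, 'b) ring_scheme \<Rightarrow> bool" where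
  "cohen_macaulay_local_ring R \<longleftrightarrow> cring R \<and> noetherian_ring R \<and>
     (\<exists>m. {M. maximalideal M R} = {m} \<and> depth R m = krull_dim R)"

definition cohen_macaulay_ring :: "('a, 'b) ring_scheme \<Rightarrow> bool" where
  "cohen_macaulay_ring R \<longleftrightarrow> cring R \<and> noetherian_ring R \<and>
     (\<forall>m. maximalideal m R \<longrightarrow>
        cohen_macaulay_local_ring (localization R (carrier R - m)))"

definition cohen_macaulay_ideal :: "('a, 'b) ring_scheme \<Rightarrow> 'a set \<Rightarrow> bool" where
  "cohen_macaulay_ideal S I \<longleftrightarrow> cohen_macaulay_ring (S Quot I)"


section \<open>The polynomial ring $K[x_1,\dots,x_n]$\<close>

text \<open>A monomial is its exponent function \<open>nat \<Rightarrow>\<^sub>0 nat\<close> and a polynomial a finitely supported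
  function from monomials to coefficients; \<open>(*)\<close> on \<open>\<Rightarrow>\<^sub>0\<close> is convolution. The variables
  are indexed by \<open>{1..n}\<close>.\<close>

type_synonym monomial = "nat \<Rightarrow>\<^sub>0 nat"
type_synonym 'k polynomial = "monomial \<Rightarrow>\<^sub>0 'k"

definition poly_ring :: "nat \<Rightarrow> ('k::field) polynomial ring" where
  "poly_ring n =
     \<lparr>carrier = {p. \<forall>m\<in>Poly_Mapping.keys p. Poly_Mapping.keys m \<subseteq> {1..n}},
      mult = (*), one = 1, zero = 0, add = (+)\<rparr>"


section \<open>\<open>t\<close>-spread lexsegment ideals\<close>

text \<open>The monomial $x_{i_1}\cdots x_{i_d}$; the addition of \<open>monomial\<close> is the product of
  monomials.\<close>

definition var_prod :: "nat \<Rightarrow> (nat \<Rightarrow> nat) \<Rightarrow> monomial" where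
  "var_prod d i = (\<Sum>r=1..d. Poly_Mapping.single (i r) 1)"

definition t_spread_monomials :: "nat \<Rightarrow> nat \<Rightarrow> nat \<Rightarrow> monomial set" where
  "t_spread_monomials n d t = {var_prod d i | i.
     (\<forall>r\<in>{1..d}. i r \<in> {1..n}) \<and> mono_on {1..d} i \<and>
     (\<forall>r\<in>{1..<d}. i r + t \<le> i (Suc r))}"

text \<open>\<open>slex_gt u v\<close> is $u >_{\mathrm{slex}} v$: a smaller index at the first difference
  gives the larger monomial. It holds only between squarefree monomials of equal degree.\<close>

definition slex_gt :: "monomial \<Rightarrow> monomial \<Rightarrow> bool" where
  "slex_gt u v \<longleftrightarrow> (\<exists>d i j. u = var_prod d i \<and> v = var_prod d j \<and>
     strict_mono_on {1..d} i \<and> strict_mono_on {1..d} j \<and>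
     (\<exists>s\<in>{1..d}. (\<forall>r\<in>{1..<s}. i r = j r) \<and> i s < j s))"

definition slex_ge :: "monomial \<Rightarrow> monomial \<Rightarrow> bool" where
  "slex_ge u v \<longleftrightarrow> u = v \<or> slex_gt u v"

definition lexsegment :: "nat \<Rightarrow> nat \<Rightarrow> nat \<Rightarrow> monomial \<Rightarrow> monomial \<Rightarrow> monomial set" where
  "lexsegment n d t u v = {w \<in> t_spread_monomials n d t. slex_ge u w \<and> slex_ge w v}"

definition lexsegment_ideal ::
    "nat \<Rightarrow> nat \<Rightarrow> nat \<Rightarrow> monomial \<Rightarrow> monomial \<Rightarrow> ('k::field) polynomial set" where
  "lexsegment_ideal n d t u v =
     Idl\<^bsub>poly_ring n\<^esub> ((\<lambda>w. Poly_Mapping.single w 1) ` lexsegment n d t u v)"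

end

theory Submission
  imports Defs
begin

text \<open>Let \<open>u\<^sub>0\<close> be the smallest \<open>t\<close>-spread monomial divisible by \<open>x\<^sub>1\<close> and \<open>v\<^sub>0\<close> the largest
  one with first variable \<open>x\<^sub>2\<close>; both lie in the lexsegment.

  If \<open>u = u\<^sub>0\<close> and \<open>v = v\<^sub>0\<close>, then \<open>I = (u, v)\<close> with \<open>u\<close>, \<open>v\<close> coprime because \<open>n\<close> is large,
  and \<open>S/I\<close> is a complete intersection. At a prime \<open>m\<close> a regular sequence of the right length is
  explicit. No Nullstellensatz is needed: for a maximal set \<open>Y\<close> of variables independent modulo
  \<open>m\<close>, both the depth and the dimension of \<open>(S/I)\<^sub>m\<close> are \<open>n - 2 - |Y|\<close>.

  Otherwise some minimal vertex cover \<open>C\<close> of the supports of the generators has at least three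
  elements. The ideal \<open>(x\<^sub>c : c \<in> C)\<close> is an associated prime, so the depth at the origin is at
  most \<open>n - |C| < n - 2\<close>, while \<open>I \<subseteq> (x\<^sub>1, x\<^sub>2)\<close> forces dimension at least \<open>n - 2\<close>.

  Chains of primes are bounded by algebraic independence: elements chosen in the successive
  differences of a chain are algebraically independent modulo its first member, and more than \<open>q\<close>
  polynomials in \<open>q\<close> variables are dependent by counting monomials.\<close>

section \<open>Ideals of a subring of a commutative ring\<close>

text \<open>The commutative algebra takes place inside the polynomial ring: an ideal of a localized
  quotient is replaced by its contraction, an ideal stable under division by elements outside
  \<open>m\<close>, and the actual localization enters only through a dictionary. From (b) to (a),
  every maximal ideal of \<open>S/I\<close> has to be treated. Over an arbitrary field it need not
  be the origin: some variables of \<open>u\<close> and \<open>v\<close> may be units there, and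
  others may satisfy complicated relations. The argument therefore runs at every prime above
  \<open>I\<close>, with \<open>Y\<close> measuring what stays transcendental. From (a) to (b), the
  origin suffices. The covers come from moving one index. If \<open>v\<close> is not
  \<open>v\<^sub>0\<close>, raising the last index of \<open>v\<^sub>0\<close> by one stays in the
  lexsegment; if \<open>u\<close> is not \<open>u\<^sub>0\<close>, so does lowering the second index
  of \<open>u\<^sub>0\<close> by one. Inside a suitable cover the extreme monomial and its shifted
  copy each meet only one vertex and so force two different ones; the opposite extreme monomial
  avoids both and forces a third.\<close>

definition ideal_in :: "'a::comm_ring_1 set \<Rightarrow> 'a set \<Rightarrow> bool" where
  "ideal_in A J \<longleftrightarrow> J \<subseteq> A \<and> 0 \<in> J \<and> (\<forall>a\<in>J. \<forall>b\<in>J. a + b \<in> J) \<and> (\<forall>a\<in>A. \<forall>b\<in>J. a * b \<in> J)"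

definition prime_in :: "'a::comm_ring_1 set \<Rightarrow> 'a set \<Rightarrow> bool" where
  "prime_in A P \<longleftrightarrow> ideal_in A P \<and> 1 \<notin> P \<and> (\<forall>a\<in>A. \<forall>b\<in>A. a * b \<in> P \<longrightarrow> a \<in> P \<or> b \<in> P)"

definition ideal_gen :: "'a::comm_ring_1 set \<Rightarrow> 'a set \<Rightarrow> 'a set" where
  "ideal_gen A G = \<Inter>{J. ideal_in A J \<and> G \<subseteq> J}"

text \<open>The maximal condition is the form in which Nakayama's lemma and the construction of
  associated primes use the property; finite generation serves only the passage to
  \<open>noetherian_ring\<close>.\<close>

definition noetherian_in :: "'a::comm_ring_1 set \<Rightarrow> bool" where
  "noetherian_in A \<longleftrightarrow>
     (\<forall>F. F \<noteq> {} \<and> (\<forall>J\<in>F. ideal_in A J) \<longrightarrow> (\<exists>J\<in>F. \<forall>J'\<in>F. J \<subseteq> J' \<longrightarrow> J' = J))"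

lemma ideal_inD:
  assumes "ideal_in A J"
  shows "J \<subseteq> A" "0 \<in> J" "\<And>a b. a \<in> J \<Longrightarrow> b \<in> J \<Longrightarrow> a + b \<in> J"
    "\<And>a b. a \<in> A \<Longrightarrow> b \<in> J \<Longrightarrow> a * b \<in> J" "\<And>a b. a \<in> A \<Longrightarrow> b \<in> J \<Longrightarrow> b * a \<in> J"
  using assms by (auto simp: ideal_in_def mult.commute)

lemma prime_inD:
  assumes "prime_in A P"
  shows "ideal_in A P" "1 \<notin> P" "\<And>a b. a \<in> A \<Longrightarrow> b \<in> A \<Longrightarrow> a * b \<in> P \<Longrightarrow> a \<in> P \<or> b \<in> P"
  using assms by (auto simp: prime_in_def)

locale subring1 =
  fixes A :: "'a::comm_ring_1 set"
  assumes one_mem: "1 \<in> A"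
    and diff_mem: "\<And>a b. a \<in> A \<Longrightarrow> b \<in> A \<Longrightarrow> a - b \<in> A"
    and mult_mem: "\<And>a b. a \<in> A \<Longrightarrow> b \<in> A \<Longrightarrow> a * b \<in> A"
begin

lemma zero_mem: "0 \<in> A"
  using diff_mem[OF one_mem one_mem] by simp

lemma uminus_mem: "a \<in> A \<Longrightarrow> - a \<in> A"
  using diff_mem[OF zero_mem] by simp

lemma add_mem: "a \<in> A \<Longrightarrow> b \<in> A \<Longrightarrow> a + b \<in> A"
  using diff_mem[of a "- b"] uminus_mem by simp

lemma sum_mem: "(\<And>x. x \<in> X \<Longrightarrow> f x \<in> A) \<Longrightarrow> sum f X \<in> A"
  by (induction X rule: infinite_finite_induct) (auto intro: add_mem zero_mem)

lemma prod_mem: "(\<And>x. x \<in> X \<Longrightarrow> f x \<in> A) \<Longrightarrow> prod f X \<in> A"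
  by (induction X rule: infinite_finite_induct) (auto intro: mult_mem one_mem)

lemma power_mem: "a \<in> A \<Longrightarrow> a ^ k \<in> A"
  by (induction k) (auto intro: mult_mem one_mem)

lemmas mem_intros = one_mem zero_mem diff_mem mult_mem uminus_mem add_mem sum_mem prod_mem power_mem

lemma ideal_in_uminus: "ideal_in A J \<Longrightarrow> a \<in> J \<Longrightarrow> - a \<in> J"
  using ideal_inD(4)[of A J "-1" a] one_mem uminus_mem by fastforce

lemma ideal_in_diff: "ideal_in A J \<Longrightarrow> a \<in> J \<Longrightarrow> b \<in> J \<Longrightarrow> a - b \<in> J"
  using ideal_inD(3)[of A J a "- b"] ideal_in_uminus by fastforce

lemma ideal_in_sum: "ideal_in A J \<Longrightarrow> (\<And>x. x \<in> X \<Longrightarrow> f x \<in> J) \<Longrightarrow> sum f X \<in> J"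
  by (induction X rule: infinite_finite_induct) (auto intro: ideal_inD)

lemma ideal_in_carrier: "ideal_in A A"
  by (auto simp: ideal_in_def intro: mem_intros)

lemma ideal_in_colon:
  assumes "ideal_in A J" "a \<in> A"
  shows "ideal_in A {b \<in> A. a * b \<in> J}"
  using assms ideal_inD[OF assms(1)] unfolding ideal_in_def
  by (auto intro: mem_intros simp: distrib_left mult.left_commute)

lemma ideal_gen_ideal: "G \<subseteq> A \<Longrightarrow> ideal_in A (ideal_gen A G)"
  unfolding ideal_gen_def using ideal_in_carrier
  by (auto simp: ideal_in_def)

lemma ideal_gen_incl: "G \<subseteq> ideal_gen A G"
  by (auto simp: ideal_gen_def)

lemma ideal_gen_least: "ideal_in A J \<Longrightarrow> G \<subseteq> J \<Longrightarrow> ideal_gen A G \<subseteq> J"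
  by (auto simp: ideal_gen_def)

lemma ideal_gen_mono: "G \<subseteq> H \<Longrightarrow> H \<subseteq> A \<Longrightarrow> ideal_gen A G \<subseteq> ideal_gen A H"
  by (auto simp: ideal_gen_def)

lemma ideal_gen_sub: "G \<subseteq> A \<Longrightarrow> ideal_gen A G \<subseteq> A"
  using ideal_gen_ideal ideal_inD(1) by blast

text \<open>A maximal finitely generated ideal inside \<open>J\<close> does not grow when an element
  of \<open>J\<close> is adjoined, so it is \<open>J\<close>.\<close>

lemma noetherian_in_finite_gen:
  assumes "noetherian_in A" "ideal_in A J"
  shows "\<exists>G. finite G \<and> G \<subseteq> J \<and> J = ideal_gen A G"
proof -
  let ?F = "{ideal_gen A G | G. finite G \<and> G \<subseteq> J}"
  have JA: "J \<subseteq> A" using assms(2) ideal_inD by blast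
  have "?F \<noteq> {}" by blast
  moreover have "\<forall>K\<in>?F. ideal_in A K" using JA ideal_gen_ideal by blast
  ultimately obtain K where K: "K \<in> ?F" "\<forall>J'\<in>?F. K \<subseteq> J' \<longrightarrow> J' = K"
    using assms(1) unfolding noetherian_in_def by meson
  then obtain G where G: "finite G" "G \<subseteq> J" "K = ideal_gen A G" by blast
  have "x \<in> K" if "x \<in> J" for x
  proof -
    have "ideal_gen A (insert x G) \<in> ?F" using G that by blast
    moreover have "K \<subseteq> ideal_gen A (insert x G)"
      unfolding G(3) by (rule ideal_gen_mono) (use that G(2) JA in auto)
    ultimately have "ideal_gen A (insert x G) = K" using K(2) by blast
    then show ?thesis using ideal_gen_incl[of "insert x G"] by blast
  qed
  moreover have "K \<subseteq> J" unfolding G(3) using ideal_gen_least assms(2) G(2) by blast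
  ultimately show ?thesis using G by blast
qed

end

section \<open>Regular sequences after localization at a prime\<close>

locale local_subring = subring1 A for A :: "'a::comm_ring_1 set" +
  fixes m :: "'a set"
  assumes prime_m: "prime_in A m"
begin

lemmas ideal_m = prime_inD(1)[OF prime_m]

lemma m_sub: "m \<subseteq> A"
  using ideal_m ideal_inD by blast

lemma compl_mult: "s \<in> A - m \<Longrightarrow> s' \<in> A - m \<Longrightarrow> s * s' \<in> A - m"
  using prime_inD(3)[OF prime_m] mult_mem by blast

lemma compl_one: "1 \<in> A - m"
  using prime_inD(2)[OF prime_m] one_mem by blast

lemma compl_diff: "s \<in> A - m \<Longrightarrow> x \<in> m \<Longrightarrow> s - x \<in> A - m"
  using ideal_inD(3)[OF ideal_m, of "s - x" x] m_sub diff_mem by auto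

text \<open>These are the contractions of the ideals of the localization at \<open>m\<close>;
  working with them replaces computations with fractions.\<close>

definition saturated :: "'a set \<Rightarrow> bool" where
  "saturated J \<longleftrightarrow> ideal_in A J \<and> (\<forall>s\<in>A - m. \<forall>a\<in>A. s * a \<in> J \<longrightarrow> a \<in> J)"

text \<open>The contraction to \<open>A\<close> of the ideal generated by \<open>G\<close> in the localization \<open>A\<^sub>m\<close>.\<close>

definition loc :: "'a set \<Rightarrow> 'a set" where
  "loc G = {a \<in> A. \<exists>s\<in>A - m. s * a \<in> ideal_gen A G}"

lemma saturatedD:
  assumes "saturated J"
  shows "ideal_in A J" "\<And>s a. s \<in> A - m \<Longrightarrow> a \<in> A \<Longrightarrow> s * a \<in> J \<Longrightarrow> a \<in> J"
  using assms by (auto simp: saturated_def)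

lemma saturated_loc:
  assumes "G \<subseteq> A"
  shows "saturated (loc G)"
proof -
  note I = ideal_gen_ideal[OF assms]
  note D = ideal_inD[OF I]
  have "a + b \<in> loc G" if "a \<in> loc G" "b \<in> loc G" for a b
  proof -
    from that obtain s s' where s: "s \<in> A - m" "s' \<in> A - m" "a \<in> A" "b \<in> A"
      "s * a \<in> ideal_gen A G" "s' * b \<in> ideal_gen A G" by (auto simp: loc_def)
    have "(s * s') * (a + b) = s' * (s * a) + s * (s' * b)" by (simp add: algebra_simps)
    also have "\<dots> \<in> ideal_gen A G" using s D by blast
    finally show ?thesis using s compl_mult add_mem unfolding loc_def by blast
  qed
  moreover have "a * b \<in> loc G" if "a \<in> A" "b \<in> loc G" for a b
  proof -
    from that obtain s where s: "s \<in> A - m" "b \<in> A" "s * b \<in> ideal_gen A G" by (auto simp: loc_def)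
    have "s * (a * b) = a * (s * b)" by (simp add: algebra_simps)
    also have "\<dots> \<in> ideal_gen A G" using s that D by blast
    finally show ?thesis using s that mult_mem unfolding loc_def by blast
  qed
  moreover have "0 \<in> loc G" using D compl_one zero_mem by (auto simp: loc_def)
  ultimately have "ideal_in A (loc G)" by (auto simp: ideal_in_def loc_def)
  moreover have "a \<in> loc G" if "s \<in> A - m" "a \<in> A" "s * a \<in> loc G" for s a
  proof -
    from that obtain s' where s: "s' \<in> A - m" "s' * (s * a) \<in> ideal_gen A G" by (auto simp: loc_def)
    then have "(s' * s) * a \<in> ideal_gen A G" by (simp add: mult.assoc)
    then show ?thesis using that s compl_mult unfolding loc_def by blast
  qed
  ultimately show ?thesis by (auto simp: saturated_def)
qed

lemmas loc_ideal = saturatedD(1)[OF saturated_loc]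
lemmas loc_satD = saturatedD(2)[OF saturated_loc]

lemma gen_sub_loc: "G \<subseteq> A \<Longrightarrow> ideal_gen A G \<subseteq> loc G"
  using compl_one ideal_gen_sub by (auto simp: loc_def intro!: bexI[of _ 1])

lemma loc_incl: "G \<subseteq> A \<Longrightarrow> G \<subseteq> loc G"
  using gen_sub_loc ideal_gen_incl by blast

lemma loc_sub: "loc G \<subseteq> A"
  by (auto simp: loc_def)

lemma loc_least: "saturated J \<Longrightarrow> G \<subseteq> J \<Longrightarrow> loc G \<subseteq> J"
  using ideal_gen_least unfolding loc_def saturated_def by blast

lemma loc_mono: "G \<subseteq> loc H \<Longrightarrow> H \<subseteq> A \<Longrightarrow> loc G \<subseteq> loc H"
  using loc_least saturated_loc by blast

lemma saturated_m: "saturated m"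
  using ideal_m prime_inD(3)[OF prime_m] by (auto simp: saturated_def)

text \<open>An element outside \<open>m\<close> is a unit after localization, so a saturated ideal
  containing one also contains 1.\<close>

lemma saturated_sub_m:
  assumes "saturated J" "1 \<notin> J" shows "J \<subseteq> m"
proof
  fix x assume "x \<in> J"
  then have "x \<in> A" "x * 1 \<in> J" using saturatedD(1)[OF assms(1)] ideal_inD(1) by auto
  then show "x \<in> m" using assms one_mem saturatedD(2)[OF assms(1), of x 1] by blast
qed

text \<open>Membership in \<open>(x) + (G)\<close> after clearing denominators. The right-hand side
  is itself a saturated ideal containing the generators, and \<open>loc\<close> is the least
  such.\<close>

lemma loc_insert:
  assumes "G \<subseteq> A" "x \<in> A"
  shows "loc (insert x G) = {a \<in> A. \<exists>s\<in>A - m. \<exists>c\<in>A. s * a - x * c \<in> loc G}" (is "_ = ?R")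
proof
  have GA: "insert x G \<subseteq> A" using assms by auto
  note L = ideal_inD[OF loc_ideal[OF assms(1)]]
  note L' = ideal_inD[OF loc_ideal[OF GA]]
  have sub: "loc G \<subseteq> loc (insert x G)" using loc_mono[of G "insert x G"] loc_incl[OF GA] GA by blast
  show "?R \<subseteq> loc (insert x G)"
  proof
    fix a assume "a \<in> ?R"
    then obtain s c where s: "a \<in> A" "s \<in> A - m" "c \<in> A" "s * a - x * c \<in> loc G" by auto
    have "x \<in> loc (insert x G)" using loc_incl[OF GA] by auto
    then have "x * c \<in> loc (insert x G)" using L'(5) s by blast
    then have "(s * a - x * c) + x * c \<in> loc (insert x G)" using s sub L'(3) by blast
    then show "a \<in> loc (insert x G)" using loc_satD[OF GA] s by auto
  qed
  have "ideal_in A ?R"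
  proof -
    have "a + b \<in> ?R" if ab: "a \<in> ?R" "b \<in> ?R" for a b
    proof -
      from ab obtain s c s' c' where s: "a \<in> A" "s \<in> A - m" "c \<in> A" "s * a - x * c \<in> loc G"
        "b \<in> A" "s' \<in> A - m" "c' \<in> A" "s' * b - x * c' \<in> loc G" by auto
      have "s' * (s * a - x * c) + s * (s' * b - x * c') \<in> loc G" using s L by blast
      then have "(s * s') * (a + b) - x * (s' * c + s * c') \<in> loc G" by (simp add: algebra_simps)
      moreover have "s * s' \<in> A - m" "s' * c + s * c' \<in> A" "a + b \<in> A"
        using s compl_mult by (auto intro: mem_intros)
      ultimately show ?thesis by blast
    qed
    moreover have "a * b \<in> ?R" if ab: "a \<in> A" "b \<in> ?R" for a b
    proof -
      from ab obtain s c where s: "b \<in> A" "s \<in> A - m" "c \<in> A" "s * b - x * c \<in> loc G" by auto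
      have "a * (s * b - x * c) \<in> loc G" using s ab L by blast
      then have "s * (a * b) - x * (a * c) \<in> loc G" by (simp add: algebra_simps)
      then show ?thesis using s ab mult_mem by blast
    qed
    moreover have "0 \<in> ?R" using L(2) zero_mem compl_one by force
    ultimately show ?thesis by (auto simp: ideal_in_def)
  qed
  moreover have "a \<in> ?R" if a: "s \<in> A - m" "a \<in> A" "s * a \<in> ?R" for s a
  proof -
    from a obtain s' c where s: "s' \<in> A - m" "c \<in> A" "s' * (s * a) - x * c \<in> loc G" by auto
    then have "(s' * s) * a - x * c \<in> loc G" by (simp add: algebra_simps)
    then show ?thesis using s a compl_mult by blast
  qed
  ultimately have "saturated ?R" by (auto simp: saturated_def)
  moreover have "insert x G \<subseteq> ?R"
  proof -
    have "g \<in> ?R" if "g \<in> G" for g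
    proof -
      have "g \<in> loc G" using that loc_incl[OF assms(1)] by blast
      then have "g \<in> A" "1 * g - x * 0 \<in> loc G" using loc_sub by auto
      then show ?thesis using compl_one zero_mem by blast
    qed
    moreover have "x \<in> ?R" using compl_one one_mem assms(2) L(2) by force
    ultimately show ?thesis by blast
  qed
  ultimately show "loc (insert x G) \<subseteq> ?R" by (rule loc_least)
qed

text \<open>Nakayama's lemma for \<open>N \<subseteq> J + x N\<close>: if \<open>J + (b)\<close> is maximal among the ideals with
  \<open>b \<in> N - J\<close> and \<open>b \<equiv> x c\<close>, then \<open>J + (c) = J + (b)\<close>, so \<open>(1 - r x) c \<in> J\<close> for some \<open>r\<close>.\<close>

lemma nakayama:
  assumes noeth: "noetherian_in A" and J: "saturated J" and x: "x \<in> m" and N: "N \<subseteq> A"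
    and step: "\<And>b. b \<in> N \<Longrightarrow> \<exists>s\<in>A - m. \<exists>c\<in>N. s * b - x * c \<in> J"
  shows "N \<subseteq> J"
proof (rule ccontr)
  assume nN: "\<not> N \<subseteq> J"
  note JD = ideal_inD[OF saturatedD(1)[OF J]]
  have JA: "J \<subseteq> A" by (rule JD(1))
  have locJ: "loc J = J" using loc_least[OF J] loc_incl[OF JA] by blast
  let ?F = "(\<lambda>b. loc (insert b J)) ` (N - J)"
  have "?F \<noteq> {}" using nN by auto
  moreover have "\<forall>K\<in>?F. ideal_in A K" using loc_ideal N JA by auto
  ultimately obtain K where K: "K \<in> ?F" "\<forall>J'\<in>?F. K \<subseteq> J' \<longrightarrow> J' = K"
    using noeth unfolding noetherian_in_def by meson
  then obtain b where b: "b \<in> N - J" "K = loc (insert b J)" by auto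
  obtain s c where s: "s \<in> A - m" "c \<in> N" "s * b - x * c \<in> J" using step b by blast
  have bA: "b \<in> A" and cA: "c \<in> A" and xA: "x \<in> A" using b s N x m_sub by auto
  have "c \<notin> J"
  proof
    assume "c \<in> J"
    then have "(s * b - x * c) + x * c \<in> J" using s xA JD by blast
    then show False using saturatedD(2)[OF J] s b bA by auto
  qed
  have "b \<in> loc (insert c J)"
  proof -
    have "s * b - c * x \<in> loc J" using s locJ by (simp add: mult.commute)
    then show ?thesis unfolding loc_insert[OF JA cA] using s xA bA by blast
  qed
  moreover have "J \<subseteq> loc (insert c J)" using loc_incl[of "insert c J"] JA cA by auto
  ultimately have "K \<subseteq> loc (insert c J)" unfolding b(2) using loc_mono[of "insert b J" "insert c J"] JA cA by auto
  then have "loc (insert c J) = K" using K(2) s \<open>c \<notin> J\<close> by auto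
  then have "c \<in> loc (insert b J)" using b(2) loc_incl[of "insert c J"] JA cA by auto
  then obtain s' r where r: "s' \<in> A - m" "r \<in> A" "s' * c - b * r \<in> J"
    using locJ by (auto simp: loc_insert[OF JA bA])
  have "s * (s' * c - b * r) + r * (s * b - x * c) \<in> J" using s r JD by blast
  then have "(s * s' - r * x) * c \<in> J" by (simp add: algebra_simps)
  moreover have "s * s' - r * x \<in> A - m"
    by (intro compl_diff compl_mult s r ideal_inD(4)[OF ideal_m] x)
  ultimately show False using saturatedD(2)[OF J] cA \<open>c \<notin> J\<close> by blast
qed

section \<open>Regular sequences at a prime and their permutation\<close>

definition reg :: "'a set \<Rightarrow> 'a \<Rightarrow> bool" where
  "reg G x \<longleftrightarrow> (\<forall>a\<in>A. x * a \<in> loc G \<longrightarrow> a \<in> loc G)"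

text \<open>Properness of the generated ideal is left out: in all comparisons with
  \<open>regular_sequence\<close> the elements lie in \<open>m\<close>, which already makes the
  quotient nonzero.\<close>

fun regseq :: "'a set \<Rightarrow> 'a list \<Rightarrow> bool" where
  "regseq G [] = True"
| "regseq G (x # xs) = (reg G x \<and> regseq (insert x G) xs)"

lemma regseq_append: "regseq G (xs @ ys) \<longleftrightarrow> regseq G xs \<and> regseq (set xs \<union> G) ys"
  by (induction xs arbitrary: G) auto

lemma reg_unit:
  assumes "G \<subseteq> A" "x \<in> A - m" shows "reg G x"
  using loc_satD[OF assms(1)] assms(2) by (auto simp: reg_def)

lemma reg_mult:
  assumes "x \<in> A" "y \<in> A" "reg G x" "reg G y" shows "reg G (x * y)"
  unfolding reg_def
proof (intro ballI impI)
  fix a assume a: "a \<in> A" "x * y * a \<in> loc G"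
  then have "x * (y * a) \<in> loc G" by (simp add: mult.assoc)
  then have "y * a \<in> loc G" using assms a mult_mem unfolding reg_def by blast
  then show "a \<in> loc G" using assms a unfolding reg_def by blast
qed

lemma reg_prod:
  assumes "G \<subseteq> A" "\<And>x. x \<in> X \<Longrightarrow> f x \<in> A" "\<And>x. x \<in> X \<Longrightarrow> reg G (f x)"
  shows "reg G (prod f X)"
  using assms(2,3)
proof (induction X rule: infinite_finite_induct)
  case (insert x X)
  have "prod f X \<in> A" using insert.prems by (auto intro: prod_mem)
  then show ?case using reg_mult[of "f x" "prod f X"] insert by auto
qed (use reg_unit[OF assms(1) compl_one] in auto)

lemma reg_congruent:
  assumes "G \<subseteq> A" "x \<in> A" "y \<in> A" "x - y \<in> loc G" "reg G x" shows "reg G y"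
  unfolding reg_def
proof (intro ballI impI)
  fix a assume a: "a \<in> A" "y * a \<in> loc G"
  note D = ideal_inD[OF loc_ideal[OF assms(1)]]
  have "y * a + a * (x - y) \<in> loc G" using a assms D by blast
  then have "x * a \<in> loc G" by (simp add: algebra_simps)
  then show "a \<in> loc G" using assms a by (auto simp: reg_def)
qed

text \<open>The exchange property in a Noetherian local ring. If \<open>y\<close> kills
  \<open>a\<close> modulo \<open>G\<close>, then \<open>a\<close> is \<open>x c\<close> up to a
  denominator because \<open>y\<close> is regular modulo \<open>x\<close>; cancelling
  \<open>x\<close> shows that \<open>y\<close> kills \<open>c\<close>. So the annihilator
  \<open>N\<close> of \<open>y\<close> satisfies \<open>N \<subseteq> J + x N\<close> and vanishes
  by \<open>nakayama\<close>. For the second claim, \<open>x a = y b\<close> makes \<open>b\<close>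
  a multiple of \<open>x\<close>, which can be cancelled.\<close>

lemma regular_swap:
  assumes noeth: "noetherian_in A" and G: "G \<subseteq> A" and x: "x \<in> m" and y: "y \<in> A"
    and rx: "reg G x" and ry: "reg (insert x G) y"
  shows "reg G y" "reg (insert y G) x"
proof -
  have xA: "x \<in> A" using x m_sub by auto
  note D = ideal_inD[OF loc_ideal[OF G]]
  have 1: "\<exists>s\<in>A - m. \<exists>c\<in>A. s * a - x * c \<in> loc G" if "a \<in> A" "y * a - x * b \<in> loc G" "b \<in> A" for a b
  proof -
    have "y * a \<in> loc (insert x G)"
    proof -
      have "1 * (y * a) - x * b \<in> loc G" "y * a \<in> A" using that y mult_mem by auto
      then show ?thesis unfolding loc_insert[OF G xA] using that(3) compl_one by blast
    qed
    then have "a \<in> loc (insert x G)" using ry that by (auto simp: reg_def)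
    then show ?thesis by (auto simp: loc_insert[OF G xA])
  qed
  let ?N = "{a \<in> A. y * a \<in> loc G}"
  have "?N \<subseteq> loc G"
  proof (rule nakayama[OF noeth saturated_loc[OF G] x])
    fix b assume b: "b \<in> ?N"
    then obtain s c where s: "s \<in> A - m" "c \<in> A" "s * b - x * c \<in> loc G" using 1[of b 0] zero_mem by auto
    have "s * (y * b) - y * (s * b - x * c) \<in> loc G"
      by (rule ideal_in_diff[OF loc_ideal[OF G] D(4) D(4)]) (use s b y in auto)
    then have "x * (y * c) \<in> loc G" by (simp add: algebra_simps)
    then have "y * c \<in> loc G" using rx s y mult_mem by (auto simp: reg_def)
    then show "\<exists>s\<in>A - m. \<exists>c\<in>?N. s * b - x * c \<in> loc G" using s by auto
  qed auto
  then show "reg G y" by (auto simp: reg_def)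
  show "reg (insert y G) x"
    unfolding reg_def
  proof (intro ballI impI)
    fix a assume a: "a \<in> A" "x * a \<in> loc (insert y G)"
    then obtain s b where s: "s \<in> A - m" "b \<in> A" "s * (x * a) - y * b \<in> loc G"
      by (auto simp: loc_insert[OF G y])
    have "- (s * (x * a) - y * b) \<in> loc G" using s ideal_in_uminus[OF loc_ideal[OF G]] by blast
    then have "y * b - x * (s * a) \<in> loc G" by (simp add: algebra_simps)
    then obtain s' c where s': "s' \<in> A - m" "c \<in> A" "s' * b - x * c \<in> loc G"
      using 1[of b "s * a"] a s mult_mem by auto
    have "s' * (s * (x * a) - y * b) + y * (s' * b - x * c) \<in> loc G" using s s' y D by blast
    then have "x * ((s' * s) * a - y * c) \<in> loc G" by (simp add: algebra_simps)
    moreover have "(s' * s) * a - y * c \<in> A" using s s' a y by (auto intro: mem_intros)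
    ultimately have "(s' * s) * a - y * c \<in> loc G" using rx unfolding reg_def by blast
    then show "a \<in> loc (insert y G)"
      unfolding loc_insert[OF G y] using a s s' compl_mult by blast
  qed
qed

text \<open>\<open>regular_swap\<close> wants the element standing first to lie in \<open>m\<close>.
  Here these are the elements that \<open>y\<close> passes; in the reverse move it is
  \<open>y\<close> itself, which explains the different hypotheses of the two lemmas.\<close>

lemma regseq_last_to_front:
  assumes "noetherian_in A" "set xs \<subseteq> m" "y \<in> A" "G \<subseteq> A" "regseq G (xs @ [y])"
  shows "regseq G (y # xs)"
  using assms(2-)
proof (induction xs arbitrary: G)
  case (Cons x xs)
  have "insert x G \<subseteq> A" using Cons.prems m_sub by auto
  then have "regseq (insert x G) (y # xs)" using Cons by auto
  then show ?case using regular_swap[OF assms(1), of G x y] Cons.prems by (auto simp: insert_commute)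
qed simp

lemma regseq_front_to_last:
  assumes "noetherian_in A" "set xs \<subseteq> A" "y \<in> m" "G \<subseteq> A" "regseq G (y # xs)"
  shows "regseq G (xs @ [y])"
  using assms(2-)
proof (induction xs arbitrary: G)
  case (Cons x xs)
  have "reg G x" "reg (insert x G) y"
    using regular_swap[OF assms(1), of G y x] Cons.prems by auto
  moreover have "regseq (insert x G) (xs @ [y])"
    using Cons calculation by (auto simp: insert_commute)
  ultimately show ?case by auto
qed simp

text \<open>Cutting by a regular \<open>x\<close> carries an associated prime \<open>P\<close> into
  a strictly larger one. Let \<open>N\<close> be the annihilator of \<open>P\<close> modulo
  \<open>G\<close>; it contains \<open>a\<close>. If \<open>N\<close> lay in
  \<open>(x) + (G)\<close>, cancelling \<open>x\<close> would give
  \<open>N \<subseteq> (G) + x N\<close>, and \<open>nakayama\<close> would put \<open>a\<close>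
  into \<open>loc G\<close>. So some \<open>b\<close> in \<open>N\<close> survives modulo
  \<open>x\<close>, and an associated prime above the annihilator of \<open>b\<close> contains both
  \<open>P\<close> and \<open>x\<close>, while regularity keeps \<open>x\<close> out of
  \<open>P\<close>.\<close>

lemma colon_chain_step:
  assumes noeth: "noetherian_in A" and G: "G \<subseteq> A" and a: "a \<in> A"
    and P: "prime_in A {b \<in> A. a * b \<in> loc G}" and x: "x \<in> m" and rx: "reg G x"
  shows "\<exists>a'\<in>A. prime_in A {b \<in> A. a' * b \<in> loc (insert x G)} \<and>
    {b \<in> A. a * b \<in> loc G} \<subset> {b \<in> A. a' * b \<in> loc (insert x G)}"
proof -
  define P where "P = {b \<in> A. a * b \<in> loc G}"
  define N where "N = {b \<in> A. \<forall>p\<in>P. b * p \<in> loc G}"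
  have xA: "x \<in> A" using x m_sub by auto
  have GA: "insert x G \<subseteq> A" using G xA by auto
  note D = ideal_inD[OF loc_ideal[OF G]]
  note D' = ideal_inD[OF loc_ideal[OF GA]]
  have sub: "loc G \<subseteq> loc (insert x G)" using loc_mono[of G "insert x G"] loc_incl[OF GA] GA by blast
  have aN: "a \<in> N" using a by (auto simp: N_def P_def)
  have aG: "a \<notin> loc G" using prime_inD(2)[OF P] one_mem by auto
  have "\<exists>b\<in>N. b \<notin> loc (insert x G)"
  proof (rule ccontr)
    assume H: "\<not> ?thesis"
    have "N \<subseteq> loc G"
    proof (rule nakayama[OF noeth saturated_loc[OF G] x])
      fix b assume b: "b \<in> N"
      then obtain s c where s: "b \<in> A" "s \<in> A - m" "c \<in> A" "s * b - x * c \<in> loc G"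
        using H loc_insert[OF G xA] by blast
      have "c * p \<in> loc G" if p: "p \<in> P" for p
      proof -
        have pA: "p \<in> A" using p by (auto simp: P_def)
        have "b * p \<in> loc G" using b p by (auto simp: N_def)
        then have "s * (b * p) \<in> loc G" using s D(4) by blast
        moreover have "p * (s * b - x * c) \<in> loc G" using s pA D(4) by blast
        ultimately have "s * (b * p) - p * (s * b - x * c) \<in> loc G"
          by (rule ideal_in_diff[OF loc_ideal[OF G]])
        then have "x * (c * p) \<in> loc G" by (simp add: algebra_simps)
        then show ?thesis using rx s pA mult_mem by (auto simp: reg_def)
      qed
      then show "\<exists>s\<in>A - m. \<exists>c\<in>N. s * b - x * c \<in> loc G" using s by (auto simp: N_def)
    qed (auto simp: N_def)
    then show False using aN aG by blast
  qed
  then obtain b where b: "b \<in> N" "b \<notin> loc (insert x G)" by blast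
  have bA: "b \<in> A" using b by (auto simp: N_def)
  \<comment> \<open>A maximal annihilator among the nonzero multiples of \<open>b\<close> is prime:
    if \<open>d\<close> does not kill \<open>b * r\<close>, then \<open>b * r * d\<close> has an
    annihilator at least as large, hence the same one, and \<open>c\<close> lies in it.\<close>
  define Q where "Q = (\<lambda>r. {c \<in> A. b * r * c \<in> loc (insert x G)})"
  let ?F = "Q ` {r \<in> A. b * r \<notin> loc (insert x G)}"
  have "1 \<in> {r \<in> A. b * r \<notin> loc (insert x G)}" using b one_mem by auto
  then have "?F \<noteq> {}" by blast
  moreover have "\<forall>K\<in>?F. ideal_in A K"
    using ideal_in_colon[OF loc_ideal[OF GA]] bA mult_mem by (auto simp: Q_def)
  ultimately obtain K where K: "K \<in> ?F" "\<forall>J'\<in>?F. K \<subseteq> J' \<longrightarrow> J' = K"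
    using noeth unfolding noetherian_in_def by meson
  then obtain r where r: "r \<in> A" "b * r \<notin> loc (insert x G)" "K = Q r" by auto
  have brA: "b * r \<in> A" using bA r mult_mem by auto
  have Kid: "ideal_in A (Q r)" using ideal_in_colon[OF loc_ideal[OF GA] brA] by (simp add: Q_def)
  have "prime_in A (Q r)"
    unfolding prime_in_def
  proof (intro conjI ballI impI)
    show "1 \<notin> Q r" using r by (auto simp: Q_def)
    fix c d assume cd: "c \<in> A" "d \<in> A" "c * d \<in> Q r"
    show "c \<in> Q r \<or> d \<in> Q r"
    proof (rule ccontr)
      assume n: "\<not> ?thesis"
      have "b * (r * d) \<notin> loc (insert x G)" using n cd by (auto simp: Q_def mult.assoc)
      then have "Q (r * d) \<in> ?F" using r cd mult_mem by auto
      moreover have "Q r \<subseteq> Q (r * d)"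
      proof
        fix z assume z: "z \<in> Q r"
        then have "d * (b * r * z) \<in> loc (insert x G)" using cd D'(4) by (auto simp: Q_def)
        then show "z \<in> Q (r * d)" using z by (auto simp: Q_def algebra_simps)
      qed
      ultimately have "Q (r * d) = Q r" using K(2) r(3) by blast
      moreover have "c \<in> Q (r * d)" using cd by (auto simp: Q_def algebra_simps)
      ultimately show False using n by blast
    qed
  qed (use Kid in auto)
  moreover have "P \<subseteq> Q r"
  proof
    fix p assume p: "p \<in> P"
    then have "r * (b * p) \<in> loc (insert x G)" using b r D' sub by (auto simp: N_def)
    then show "p \<in> Q r" using p by (auto simp: Q_def P_def algebra_simps)
  qed
  moreover have "x \<in> Q r"
    using D'(4)[OF brA] loc_incl[OF GA] xA by (auto simp: Q_def)
  moreover have "x \<notin> P"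
    using rx a aG by (auto simp: P_def reg_def mult.commute)
  ultimately show ?thesis
    unfolding P_def[symmetric] using brA by (auto simp: Q_def intro!: bexI[of _ "b * r"])
qed

text \<open>The bound \<open>depth \<le> dim A/P\<close> for an associated prime \<open>P\<close>.\<close>

lemma associated_prime_chain:
  assumes noeth: "noetherian_in A" and "G \<subseteq> m" and "a \<in> A"
    and "prime_in A {b \<in> A. a * b \<in> loc G}" and "set xs \<subseteq> m" and "regseq G xs"
  shows "\<exists>P. P 0 = {b \<in> A. a * b \<in> loc G} \<and> (\<forall>i\<le>length xs. prime_in A (P i) \<and> P i \<subseteq> m \<and> G \<subseteq> P i) \<and>
    (\<forall>i<length xs. P i \<subset> P (Suc i))"
  using assms(2-)
proof (induction xs arbitrary: a G)
  case Nil
  have GA: "G \<subseteq> A" using Nil m_sub by auto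
  let ?P = "{b \<in> A. a * b \<in> loc G}"
  have "saturated ?P"
    using ideal_in_colon[OF loc_ideal[OF GA] Nil(2)] loc_satD[OF GA] Nil(2) mult_mem
    by (auto simp: saturated_def mult.left_commute)
  then have "?P \<subseteq> m" using saturated_sub_m prime_inD(2)[OF Nil(3)] by blast
  moreover have "G \<subseteq> ?P"
    using loc_incl[OF GA] GA Nil(2) ideal_inD(4)[OF loc_ideal[OF GA]] by auto
  ultimately show ?case using Nil by (intro exI[of _ "\<lambda>_. ?P"]) auto
next
  case (Cons x xs)
  have GA: "G \<subseteq> A" and GA': "insert x G \<subseteq> m" using Cons.prems m_sub by auto
  let ?P = "{b \<in> A. a * b \<in> loc G}"
  obtain a' where a': "a' \<in> A" "prime_in A {b \<in> A. a' * b \<in> loc (insert x G)}"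
    "?P \<subset> {b \<in> A. a' * b \<in> loc (insert x G)}"
    using colon_chain_step[OF noeth GA Cons.prems(2,3), of x] Cons.prems by auto
  obtain P where P: "P 0 = {b \<in> A. a' * b \<in> loc (insert x G)}"
      "\<forall>i\<le>length xs. prime_in A (P i) \<and> P i \<subseteq> m \<and> insert x G \<subseteq> P i"
      "\<forall>i<length xs. P i \<subset> P (Suc i)"
    using Cons.IH[OF GA' a'(1,2)] Cons.prems by auto
  have "G \<subseteq> ?P"
    using loc_incl[OF GA] GA Cons.prems(2) ideal_inD(4)[OF loc_ideal[OF GA]] by auto
  moreover have "?P \<subseteq> m" using a'(3) P by blast
  ultimately show ?case
    using P a' Cons.prems(3)
    by (intro exI[of _ "\<lambda>i. case i of 0 \<Rightarrow> ?P | Suc j \<Rightarrow> P j"]) (auto split: nat.splits simp: less_Suc_eq_0_disj)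
qed

end

section \<open>Polynomials in finitely many variables\<close>

abbreviation "pkeys \<equiv> Poly_Mapping.keys"
abbreviation "plookup \<equiv> Poly_Mapping.lookup"
abbreviation "psingle \<equiv> Poly_Mapping.single"

text \<open>All polynomial rings are subsets of one type, so dropping variables is an inclusion and
  no embeddings have to be carried along.\<close>

definition polys :: "nat set \<Rightarrow> ('k::field) polynomial set" where
  "polys V = {p. \<forall>m\<in>pkeys p. pkeys m \<subseteq> V}"

abbreviation mon :: "monomial \<Rightarrow> ('k::field) polynomial" where
  "mon m \<equiv> psingle m 1"

abbreviation var :: "nat \<Rightarrow> ('k::field) polynomial" where
  "var i \<equiv> mon (psingle i 1)"

lemma keys_add_nat: "pkeys (m + m' :: monomial) = pkeys m \<union> pkeys m'"
  by (auto simp: in_keys_iff lookup_add)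

lemma polysI: "(\<And>m. plookup p m \<noteq> 0 \<Longrightarrow> pkeys m \<subseteq> V) \<Longrightarrow> p \<in> polys V"
  by (auto simp: polys_def in_keys_iff)

lemma polysD: "p \<in> polys V \<Longrightarrow> plookup p m \<noteq> 0 \<Longrightarrow> pkeys m \<subseteq> V"
  by (auto simp: polys_def in_keys_iff)

lemma single_in_polys: "pkeys m \<subseteq> V \<Longrightarrow> psingle m c \<in> polys V"
  by (auto simp: polys_def)

lemma polys_mono: "V \<subseteq> W \<Longrightarrow> polys V \<subseteq> polys W"
  by (auto simp: polys_def)

lemma var_in_polys: "i \<in> V \<Longrightarrow> var i \<in> polys V"
  by (rule single_in_polys) auto

interpretation polys: subring1 "polys V :: ('k::field) polynomial set" for V
proof
  show "(1::'k polynomial) \<in> polys V" by (auto simp: polys_def)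
  fix a b :: "'k polynomial"
  assume ab: "a \<in> polys V" "b \<in> polys V"
  show "a - b \<in> polys V"
    by (rule polysI) (metis ab polysD diff_zero lookup_minus diff_self)
  show "a * b \<in> polys V"
  proof (rule polysI)
    fix m assume "plookup (a * b) m \<noteq> 0"
    then have "m \<in> {x + y | x y. x \<in> pkeys a \<and> y \<in> pkeys b}"
      using keys_mult[of a b] by (auto simp: in_keys_iff)
    then show "pkeys m \<subseteq> V" using ab by (fastforce simp: polys_def keys_add_nat)
  qed
qed

lemma carrier_poly_ring: "carrier (poly_ring n) = polys {1..n}"
  by (simp add: poly_ring_def polys_def)

section \<open>Monomial expansion and coefficients with respect to one variable\<close>

lemma poly_sum_monomials:
  fixes f :: "('k::field) polynomial"
  shows "f = (\<Sum>m\<in>pkeys f. psingle m (plookup f m))"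
  by (rule poly_mapping_eqI)
    (auto simp: lookup_sum lookup_single when_def in_keys_iff if_distrib sum.delta cong: if_cong)

lemma poly_induct [case_names zero single add]:
  fixes P :: "('k::field) polynomial \<Rightarrow> bool"
  assumes "P 0" "\<And>m c. P (psingle m c)" "\<And>f g. P f \<Longrightarrow> P g \<Longrightarrow> P (f + g)"
  shows "P f"
proof -
  have "P (\<Sum>m\<in>S. psingle m (plookup f m))" if "finite S" for S
    using that by (induction S rule: finite_induct) (auto intro: assms)
  then show ?thesis using poly_sum_monomials[of f] finite_keys by metis
qed

text \<open>The coefficient of \<open>x\<^sub>w\<^sup>p\<close> of \<open>f\<close>, seen as a polynomial in \<open>x\<^sub>w\<close>.\<close>

lift_definition xcoeff :: "nat \<Rightarrow> nat \<Rightarrow> ('k::field) polynomial \<Rightarrow> 'k polynomial" is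
  "\<lambda>w p f m. if plookup m w = 0 then f (m + psingle w p) else 0"
proof -
  fix w p :: nat and f :: "monomial \<Rightarrow> 'k"
  assume "finite {x. f x \<noteq> 0}"
  then have "finite ((\<lambda>m. m + psingle w p) -` {x. f x \<noteq> 0})"
    by (rule finite_vimageI) (auto simp: inj_on_def)
  then show "finite {m. (if plookup m w = 0 then f (m + psingle w p) else 0) \<noteq> 0}"
    by (rule rev_finite_subset) auto
qed

text \<open>Two instances matter: keeping the monomials of a fixed \<open>w\<close>-degree, and
  keeping those without variables from a set \<open>C\<close>, which is the substitution of 0 for
  these variables.\<close>

definition mfilter :: "(monomial \<Rightarrow> bool) \<Rightarrow> ('k::field) polynomial \<Rightarrow> 'k polynomial" where
  "mfilter Q f = Abs_poly_mapping (\<lambda>m. if Q m then plookup f m else 0)"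

lemma lookup_mfilter: "plookup (mfilter Q f) m = (if Q m then plookup f m else 0)"
proof -
  have "finite {m. (if Q m then plookup f m else 0) \<noteq> 0}"
    using finite_lookup[of f] by (rule rev_finite_subset) auto
  then show ?thesis by (simp add: mfilter_def)
qed

lemma xcoeff_zero [simp]: "xcoeff w p 0 = 0"
  by (rule poly_mapping_eqI) (simp add: xcoeff.rep_eq)

lemma xcoeff_add: "xcoeff w p (f + g) = xcoeff w p f + xcoeff w p g"
  by (rule poly_mapping_eqI) (simp add: xcoeff.rep_eq lookup_add)

lemma xcoeff_diff: "xcoeff w p (f - g) = xcoeff w p f - xcoeff w p g"
  by (rule poly_mapping_eqI) (simp add: xcoeff.rep_eq lookup_minus)

lemma mfilter_zero [simp]: "mfilter Q 0 = 0"
  by (rule poly_mapping_eqI) (simp add: lookup_mfilter)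

lemma mfilter_add: "mfilter Q (f + g) = mfilter Q f + mfilter Q g"
  by (rule poly_mapping_eqI) (simp add: lookup_mfilter lookup_add)

lemma mfilter_single: "mfilter Q (psingle m c) = (if Q m then psingle m c else 0)"
  by (rule poly_mapping_eqI) (auto simp: lookup_mfilter lookup_single when_def)

lemma xcoeff_single:
  "xcoeff w p (psingle m c) = (if plookup m w = p then psingle (m - psingle w p) c else 0)"
proof (rule poly_mapping_eqI)
  fix k :: monomial
  have "plookup k w = 0 \<and> m = k + psingle w p \<longleftrightarrow> plookup m w = p \<and> k = m - psingle w p"
  proof
    assume "plookup m w = p \<and> k = m - psingle w p"
    then have "plookup k w = 0" "m = k + psingle w p"
      by (auto simp: lookup_minus lookup_add lookup_single when_def intro!: poly_mapping_eqI)
    then show "plookup k w = 0 \<and> m = k + psingle w p" by blast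
  qed (auto simp: lookup_add)
  then show "plookup (xcoeff w p (psingle m c)) k =
      plookup (if plookup m w = p then psingle (m - psingle w p) c else 0) k"
    by (auto simp: xcoeff.rep_eq lookup_single when_def)
qed

text \<open>The Cauchy product. Both sides are additive in each factor, which reduces the claim to
  two monomials, where only the summand with \<open>q\<close> the \<open>w\<close>-degree of the
  first can survive.\<close>

lemma xcoeff_mult: "xcoeff w p (f * g) = (\<Sum>q\<le>p. xcoeff w q f * xcoeff w (p - q) g)"
proof (induction f rule: poly_induct)
  case (single m c)
  show ?case
  proof (induction g rule: poly_induct)
    case (single m' c')
    let ?s = "plookup m w" and ?s' = "plookup m' w"
    have eq: "(\<Sum>q\<le>p. xcoeff w q (psingle m c) * xcoeff w (p - q) (psingle m' c')) =
      (\<Sum>q\<le>p. if q = ?s then (if ?s + ?s' = p then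
        psingle (m - psingle w ?s + (m' - psingle w ?s')) (c * c') else 0) else 0)"
      by (intro sum.cong) (auto simp: xcoeff_single mult_single)
    have "?s + ?s' = p \<Longrightarrow> m + m' - psingle w p = m - psingle w ?s + (m' - psingle w ?s')"
      by (rule poly_mapping_eqI) (auto simp: lookup_minus lookup_add lookup_single when_def)
    then show ?case
      unfolding eq by (auto simp: mult_single xcoeff_single lookup_add sum.delta)
  qed (auto simp: distrib_left xcoeff_add sum.distrib)
qed (auto simp: distrib_right xcoeff_add sum.distrib)

lemma xcoeff_polys: "f \<in> polys V \<Longrightarrow> xcoeff w p f \<in> polys (V - {w})"
proof (rule polysI)
  fix m assume f: "f \<in> polys V" and "plookup (xcoeff w p f) m \<noteq> 0"
  then have "plookup m w = 0" "plookup f (m + psingle w p) \<noteq> 0"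
    by (auto simp: xcoeff.rep_eq split: if_splits)
  then have "pkeys m \<subseteq> V" "w \<notin> pkeys m"
    using polysD[OF f, of "m + psingle w p"] by (auto simp: keys_add_nat in_keys_iff)
  then show "pkeys m \<subseteq> V - {w}" by blast
qed

lemma xcoeff_free:
  assumes "f \<in> polys V" "w \<notin> V"
  shows "xcoeff w p f = (if p = 0 then f else 0)"
proof (rule poly_mapping_eqI)
  fix m
  have "plookup f m = 0" if "plookup m w \<noteq> 0" for m
    using polysD[OF assms(1), of m] that assms(2) lookup_not_eq_zero_eq_in_keys[of m w] by blast
  then show "plookup (xcoeff w p f) m = plookup (if p = 0 then f else 0) m"
    by (auto simp: xcoeff.rep_eq lookup_add)
qed

lemma xcoeff_mult_free:
  assumes "f \<in> polys V" "w \<notin> V"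
  shows "xcoeff w p (f * g) = f * xcoeff w p g"
proof -
  have "xcoeff w p (f * g) = (\<Sum>q\<le>p. if q = 0 then f * xcoeff w p g else 0)"
    unfolding xcoeff_mult by (intro sum.cong) (auto simp: xcoeff_free[OF assms])
  then show ?thesis by simp
qed

lemma xcoeff_xpow: "xcoeff w p (mon (psingle w q)) = (if p = q then 1 else 0)"
  by (auto simp: xcoeff_single)

lemma xcoeff_mult_xpow:
  assumes "f \<in> polys V" "w \<notin> V"
  shows "xcoeff w p (f * mon (psingle w q)) = (if p = q then f else 0)"
  by (simp add: xcoeff_mult_free[OF assms] xcoeff_xpow)

lemma xcoeff_times_xpow: "xcoeff w p f * mon (psingle w p) = mfilter (\<lambda>m. plookup m w = p) f"
proof (induction f rule: poly_induct)
  case (single m c)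
  have "plookup m w = p \<Longrightarrow> m - psingle w p + psingle w p = m"
    by (rule poly_mapping_eqI) (auto simp: lookup_minus lookup_add lookup_single when_def)
  then show ?case by (auto simp: xcoeff_single mfilter_single mult_single)
qed (auto simp: xcoeff_add mfilter_add distrib_right)

lemma xcoeff_bound: "\<exists>D. \<forall>p\<ge>D. xcoeff w p f = 0"
proof -
  have "\<forall>p\<ge>Suc (Max (insert 0 ((\<lambda>m. plookup m w) ` pkeys f))). xcoeff w p f = 0"
  proof (intro allI impI)
    fix p assume p: "p \<ge> Suc (Max (insert 0 ((\<lambda>m. plookup m w) ` pkeys f)))"
    have "plookup f (m + psingle w p) = 0" if "plookup m w = 0" for m
    proof (rule ccontr)
      assume "plookup f (m + psingle w p) \<noteq> 0"
      then have "plookup (m + psingle w p) w \<le> Max (insert 0 ((\<lambda>m. plookup m w) ` pkeys f))"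
        by (intro Max_ge) (auto simp: in_keys_iff)
      then show False using p that by (simp add: lookup_add)
    qed
    then show "xcoeff w p f = 0" by (intro poly_mapping_eqI) (auto simp: xcoeff.rep_eq)
  qed
  then show ?thesis by blast
qed

lemma xcoeff_expand:
  assumes "\<forall>p\<ge>D. xcoeff w p f = 0"
  shows "f = (\<Sum>p<D. xcoeff w p f * mon (psingle w p))"
proof (rule poly_mapping_eqI)
  fix m
  have "plookup f m = 0" if "plookup m w \<ge> D"
  proof -
    have "mfilter (\<lambda>m'. plookup m' w = plookup m w) f = 0"
      using assms that xcoeff_times_xpow[of w "plookup m w" f] by simp
    then have "plookup (mfilter (\<lambda>m'. plookup m' w = plookup m w) f) m = 0" by simp
    then show ?thesis by (simp add: lookup_mfilter)
  qed
  then show "plookup f m = plookup (\<Sum>p<D. xcoeff w p f * mon (psingle w p)) m"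
    by (auto simp: xcoeff_times_xpow lookup_sum lookup_mfilter)
qed

text \<open>An ideal generated without \<open>w\<close> is extended from the smaller ring: the
  polynomials all of whose coefficients lie in it form an ideal containing \<open>G\<close>.\<close>

lemma xcoeff_ideal_gen:
  fixes G :: "('k::field) polynomial set"
  assumes G: "G \<subseteq> polys (V - {w})" and h: "h \<in> ideal_gen (polys V) G"
  shows "xcoeff w p h \<in> ideal_gen (polys V) G"
proof -
  have sub: "polys (V - {w}) \<subseteq> (polys V :: 'k polynomial set)" by (rule polys_mono) auto
  have GA: "G \<subseteq> polys V" using G sub by auto
  let ?I = "ideal_gen (polys V) G"
  let ?J = "{f \<in> polys V. \<forall>p. xcoeff w p f \<in> ?I}"
  note I = polys.ideal_gen_ideal[OF GA]
  note D = ideal_inD[OF I]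
  have "ideal_in (polys V) ?J"
    unfolding ideal_in_def
  proof (intro conjI ballI)
    fix a b :: "'k polynomial" assume ab: "a \<in> polys V" "b \<in> ?J"
    have "xcoeff w q a * xcoeff w (p - q) b \<in> ?I" for p q
      using ab D(4)[of "xcoeff w q a" "xcoeff w (p - q) b"] xcoeff_polys[OF ab(1)] sub by blast
    then have "xcoeff w p (a * b) \<in> ?I" for p
      unfolding xcoeff_mult by (intro polys.ideal_in_sum[OF I])
    then show "a * b \<in> ?J" using ab polys.mult_mem by blast
  qed (use D in \<open>auto simp: xcoeff_add polys.zero_mem polys.add_mem\<close>)
  moreover have "G \<subseteq> ?J"
    using G GA polys.ideal_gen_incl[of G V] D(2) by (auto simp: xcoeff_free[of _ "V - {w}"] subset_iff)
  ultimately show ?thesis using polys.ideal_gen_least h by blast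
qed

locale poly_local = local_subring "polys V" m
  for V :: "nat set" and m :: "('k::field) polynomial set"
begin

text \<open>Induction on the \<open>x\<^sub>w\<close>-degree of the cofactor: its leading coefficient, multiplied by that of
  \<open>f\<close>, lies in the ideal, because ideals generated without \<open>x\<^sub>w\<close> contain the
  \<open>x\<^sub>w\<close>-coefficients of their elements.\<close>

lemma reg_leading_coeff:
  assumes w: "w \<in> V" and G: "G \<subseteq> polys (V - {w})" and f: "f \<in> polys V"
    and lc: "xcoeff w e f \<notin> m" and top: "\<And>p. p > e \<Longrightarrow> xcoeff w p f = 0"
  shows "reg G f"
proof -
  have sub: "polys (V - {w}) \<subseteq> (polys V :: 'k polynomial set)" by (rule polys_mono) auto
  have GA: "G \<subseteq> polys V" using G sub by auto
  let ?I = "ideal_gen (polys V) G"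
  note I = polys.ideal_gen_ideal[OF GA]
  note D = ideal_inD[OF I]
  define c where "c = xcoeff w e f"
  have cV: "c \<in> polys (V - {w})" unfolding c_def by (rule xcoeff_polys[OF f])
  have cA: "c \<in> polys V - m" using cV sub lc by (auto simp: c_def)
  have main: "\<exists>s\<in>polys V - m. s * a \<in> ?I"
    if "a \<in> polys V" "\<forall>p\<ge>N. xcoeff w p a = 0" "f * a \<in> ?I" for a N
    using that(1,2,3)
  proof (induction N arbitrary: a)
    case 0
    then have "a = 0" using xcoeff_expand[of 0 w a] by simp
    then show ?case using D(2) compl_one by auto
  next
    case (Suc N)
    define b where "b = xcoeff w N a"
    have bV: "b \<in> polys (V - {w})" unfolding b_def by (rule xcoeff_polys[OF Suc.prems(1)])
    have bA: "b \<in> polys V" using bV sub by auto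
    have cbV: "c * b \<in> polys (V - {w})" using cV bV polys.mult_mem by blast
    have wn: "w \<notin> V - {w}" by simp
    have xA: "mon (psingle w N) \<in> polys V" using w by (intro single_in_polys) auto
    have "xcoeff w (e + N) (f * a) = (\<Sum>q\<le>e+N. if q = e then c * b else 0)"
      unfolding xcoeff_mult
    proof (intro sum.cong refl)
      fix q assume "q \<in> {..e + N}"
      then consider "q > e" | "q = e" | "q < e" "e + N - q \<ge> Suc N" by force
      then show "xcoeff w q f * xcoeff w (e + N - q) a = (if q = e then c * b else 0)"
        using top Suc.prems(2) by cases (auto simp: b_def c_def)
    qed
    also have "\<dots> = c * b" by simp
    finally have cb: "c * b \<in> ?I" using xcoeff_ideal_gen[OF G Suc.prems(3)] by metis
    \<comment> \<open>The top term of \<open>a\<close> is removed without division: \<open>c\<close>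
      scales \<open>a\<close>, and since \<open>c * b\<close> lies in the ideal the correction is
      harmless. The factor \<open>c\<close> is absorbed later because it lies outside
      \<open>m\<close>.\<close>
    define a' where "a' = c * a - c * b * mon (psingle w N)"
    have "f * a' = c * (f * a) - (c * b) * (mon (psingle w N) * f)"
      by (simp add: a'_def algebra_simps)
    also have "\<dots> \<in> ?I"
      using D(4)[OF _ Suc.prems(3), of c] D(5)[OF _ cb] xA f cA polys.mult_mem
      by (intro polys.ideal_in_diff[OF I]) auto
    finally have "f * a' \<in> ?I" .
    moreover have "\<forall>p\<ge>N. xcoeff w p a' = 0"
    proof (intro allI impI)
      fix p assume "p \<ge> N"
      then show "xcoeff w p a' = 0"
        using Suc.prems(2)
        by (cases "p = N")
          (auto simp: a'_def xcoeff_diff xcoeff_mult_xpow[OF cbV wn] xcoeff_mult_free[OF cV wn] b_def[symmetric])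
    qed
    moreover have "a' \<in> polys V"
      using cA Suc.prems(1) bA xA unfolding a'_def by (auto intro: polys.mem_intros)
    ultimately obtain s where s: "s \<in> polys V - m" "s * a' \<in> ?I" using Suc.IH by blast
    have "s * a' + s * mon (psingle w N) * (c * b) \<in> ?I"
      by (intro D(3) s D(4)[OF _ cb] polys.mult_mem xA) (use s in auto)
    then have "(s * c) * a \<in> ?I" by (simp add: a'_def algebra_simps)
    then show ?case using s cA compl_mult by blast
  qed
  show ?thesis
    unfolding reg_def
  proof (intro ballI impI)
    fix a assume a: "a \<in> polys V" "f * a \<in> loc G"
    then obtain s where s: "s \<in> polys V - m" "s * (f * a) \<in> ?I" by (auto simp: loc_def)
    then have "f * (s * a) \<in> ?I" by (simp add: mult.left_commute)
    moreover have "s * a \<in> polys V" using s a polys.mult_mem by blast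
    ultimately obtain s' where "s' \<in> polys V - m" "s' * (s * a) \<in> ?I"
      using main xcoeff_bound by blast
    then show "a \<in> loc G" using s a compl_mult unfolding loc_def by (auto simp: mult.assoc[symmetric])
  qed
qed

end

subsection \<open>Hilbert's basis theorem\<close>

lemma polys_empty: "polys {} = (range (psingle 0) :: ('k::field) polynomial set)"
proof (intro equalityI subsetI)
  fix p :: "'k polynomial" assume p: "p \<in> polys {}"
  have "p = psingle 0 (plookup p 0)"
  proof (rule poly_mapping_eqI)
    fix m
    show "plookup p m = plookup (psingle 0 (plookup p 0)) m"
      using polysD[OF p, of m] by (cases "m = 0") (auto simp: lookup_single)
  qed
  then show "p \<in> range (psingle 0)" by blast
qed (auto intro: single_in_polys)

lemma const_inverse:
  fixes c :: "'k::field" assumes "c \<noteq> 0"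
  shows "psingle 0 (inverse c) * psingle 0 c = (1 :: 'k polynomial)"
  using assms by (simp add: mult_single)

lemma noetherian_polys_empty: "noetherian_in (polys {} :: ('k::field) polynomial set)"
  unfolding noetherian_in_def
proof (intro allI impI)
  fix F :: "'k polynomial set set"
  assume F: "F \<noteq> {} \<and> (\<forall>J\<in>F. ideal_in (polys {}) J)"
  have full: "J = polys {}" if "ideal_in (polys {}) J" "p \<in> J" "p \<noteq> 0" for J and p :: "'k polynomial"
  proof -
    note p0 = that(3)
    have "p \<in> polys {}" using that ideal_inD(1) by blast
    then obtain c where c: "p = psingle 0 c" by (auto simp: polys_empty)
    then have "c \<noteq> 0" using p0 by auto
    have "psingle 0 (inverse c) * p \<in> J" using ideal_inD(4)[OF that(1)] that(2) by (auto simp: polys_empty)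
    then have "1 \<in> J" unfolding c const_inverse[OF \<open>c \<noteq> 0\<close>] .
    then show ?thesis using ideal_inD(1,4)[OF that(1)] by (metis mult.right_neutral subsetI subset_antisym)
  qed
  show "\<exists>J\<in>F. \<forall>J'\<in>F. J \<subseteq> J' \<longrightarrow> J' = J"
  proof (cases "\<exists>J\<in>F. \<exists>p\<in>J. p \<noteq> 0")
    case True
    then obtain J p where J: "J \<in> F" "p \<in> J" "p \<noteq> 0" by blast
    then show ?thesis using full F by (metis ideal_inD(1) subset_antisym)
  next
    case False
    then have "J = {0}" if "J \<in> F" for J using F ideal_inD(2) that by fastforce
    then show ?thesis using F by blast
  qed
qed

lemma noetherian_inI_chain:
  assumes "\<And>J :: nat \<Rightarrow> _. (\<And>i. ideal_in A (J i)) \<Longrightarrow> (\<And>i. J i \<subseteq> J (Suc i)) \<Longrightarrow> \<exists>N. \<forall>i\<ge>N. J i = J N"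
  shows "noetherian_in A"
  unfolding noetherian_in_def
proof (intro allI impI)
  fix F assume F: "F \<noteq> {} \<and> (\<forall>J\<in>F. ideal_in A J)"
  show "\<exists>J\<in>F. \<forall>J'\<in>F. J \<subseteq> J' \<longrightarrow> J' = J"
  proof (rule ccontr)
    assume "\<not> ?thesis"
    then have *: "\<And>J. J \<in> F \<Longrightarrow> \<exists>J'. J' \<in> F \<and> J \<subset> J'" by blast
    obtain J0 where "J0 \<in> F" using F by blast
    then have "\<exists>J. \<forall>i::nat. J i \<in> F \<and> J i \<subset> J (Suc i)"
      using dependent_nat_choice[of "\<lambda>_ J. J \<in> F" "\<lambda>_ J J'. J \<subset> J'"] * by blast
    then obtain J where J: "\<And>i::nat. J i \<in> F" "\<And>i. J i \<subset> J (Suc i)" by blast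
    obtain N where "\<forall>i\<ge>N. J i = J N" using assms[of J] J F by blast
    then have "J (Suc N) = J N" by (rule allE[of _ "Suc N"]) simp
    then show False using J(2)[of N] by simp
  qed
qed

text \<open>Degree at most \<open>k\<close> instead of exactly \<open>k\<close> lets 0 belong to the
  set and makes it an ideal.\<close>

definition lead :: "nat \<Rightarrow> nat \<Rightarrow> ('k::field) polynomial set \<Rightarrow> 'k polynomial set" where
  "lead w k J = {xcoeff w k f | f. f \<in> J \<and> (\<forall>p>k. xcoeff w p f = 0)}"

lemma ideal_lead:
  fixes J :: "('k::field) polynomial set"
  assumes w: "w \<notin> V" and J: "ideal_in (polys (insert w V)) J"
  shows "ideal_in (polys V) (lead w k J)"
proof -
  note D = ideal_inD[OF J]
  have VA: "polys V \<subseteq> (polys (insert w V) :: 'k polynomial set)" by (rule polys_mono) auto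
  have eq: "insert w V - {w} = V" using w by auto
  show ?thesis
    unfolding ideal_in_def
  proof (intro conjI ballI)
    show "lead w k J \<subseteq> polys V"
      using xcoeff_polys[of _ "insert w V" w] D(1) unfolding eq lead_def by blast
    show "0 \<in> lead w k J" unfolding lead_def using D(2) by (auto intro!: exI[of _ 0])
    fix a b assume "a \<in> lead w k J" "b \<in> lead w k J"
    then obtain f g where "f \<in> J" "\<forall>p>k. xcoeff w p f = 0" "a = xcoeff w k f"
      "g \<in> J" "\<forall>p>k. xcoeff w p g = 0" "b = xcoeff w k g" by (auto simp: lead_def)
    then show "a + b \<in> lead w k J"
      unfolding lead_def using D(3) by (auto simp: xcoeff_add intro!: exI[of _ "f + g"])
  next
    fix a b :: "'k polynomial" assume a: "a \<in> polys V" and "b \<in> lead w k J"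
    then obtain f where "f \<in> J" "\<forall>p>k. xcoeff w p f = 0" "b = xcoeff w k f" by (auto simp: lead_def)
    then show "a * b \<in> lead w k J"
      unfolding lead_def using D(4)[of a f] a VA
      by (auto simp: xcoeff_mult_free[OF a w] intro!: exI[of _ "a * f"])
  qed
qed

lemma xcoeff_mult_var: "xcoeff w (Suc p) (f * var w) = xcoeff w p f"
proof -
  have "xcoeff w (Suc p) (f * var w) = (\<Sum>q\<le>Suc p. if q = p then xcoeff w p f else 0)"
    unfolding xcoeff_mult by (intro sum.cong) (auto simp: xcoeff_single)
  then show ?thesis by simp
qed

lemma lead_Suc:
  assumes "ideal_in (polys (insert w V)) J"
  shows "lead w k J \<subseteq> lead w (Suc k) J"
proof
  fix a assume "a \<in> lead w k J"
  then obtain f where f: "f \<in> J" "\<forall>p>k. xcoeff w p f = 0" "a = xcoeff w k f" by (auto simp: lead_def)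
  have "f * var w \<in> J" using ideal_inD(5)[OF assms _ f(1)] var_in_polys by blast
  moreover have "\<forall>p>Suc k. xcoeff w p (f * var w) = 0"
  proof (intro allI impI)
    fix p assume "p > Suc k"
    then show "xcoeff w p (f * var w) = 0"
      using f(2) xcoeff_mult_var[of w _ f] by (cases p) (simp_all del: One_nat_def)
  qed
  moreover have "a = xcoeff w (Suc k) (f * var w)" using f(3) xcoeff_mult_var by metis
  ultimately show "a \<in> lead w (Suc k) J" unfolding lead_def by blast
qed

text \<open>Induction on the degree bound: subtracting an element of \<open>J\<close> with the same
  leading coefficient lowers the degree of an element of \<open>J'\<close>.\<close>

lemma lead_eq_imp_eq:
  fixes J :: "('k::field) polynomial set"
  assumes J: "ideal_in (polys (insert w V)) J" and J': "ideal_in (polys (insert w V)) J'"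
    and sub: "J \<subseteq> J'" and lead: "\<And>k. lead w k J' \<subseteq> lead w k J"
  shows "J' = J"
proof -
  note D = ideal_inD[OF J]
  have "f \<in> J" if "f \<in> J'" "\<forall>p\<ge>k. xcoeff w p f = 0" for f k
    using that
  proof (induction k arbitrary: f)
    case 0
    then have "f = 0" using xcoeff_expand[of 0 w f] by simp
    then show ?case using D(2) by simp
  next
    case (Suc k)
    then have "xcoeff w k f \<in> lead w k J'" unfolding lead_def Suc_le_eq by blast
    then obtain g where g: "g \<in> J" "\<forall>p>k. xcoeff w p g = 0" "xcoeff w k f = xcoeff w k g"
      using lead unfolding lead_def by blast
    have "f - g \<in> J'" using polys.ideal_in_diff[OF J'] Suc.prems g sub by blast
    moreover have "\<forall>p\<ge>k. xcoeff w p (f - g) = 0"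
      using g Suc.prems(2) by (metis xcoeff_diff diff_self le_less less_eq_Suc_le diff_zero)
    ultimately have "f - g \<in> J" using Suc.IH by blast
    then have "f - g + g \<in> J" using D(3) g by blast
    then show ?case by simp
  qed
  then show ?thesis using sub xcoeff_bound by blast
qed

lemma noetherian_in_maximal_range:
  assumes "noetherian_in A" "\<And>i. ideal_in A (J i)"
  shows "\<exists>i0. \<forall>i. J i0 \<subseteq> J i \<longrightarrow> J i = J i0"
  using assms(1)[unfolded noetherian_in_def, rule_format, of "range J"] assms(2) by auto

text \<open>The ideals \<open>L k i\<close> of leading coefficients grow in the degree
  \<open>k\<close> and in the chain index \<open>i\<close>. The maximal condition on the diagonal
  makes them constant for \<open>k\<close> and \<open>i\<close> beyond \<open>k0\<close>; each of
  the finitely many rows up to \<open>k0\<close> stabilizes at some \<open>n k\<close>. So one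
  \<open>N\<close> serves all degrees, and \<open>lead_eq_imp_eq\<close> lifts this to the chain
  \<open>J\<close>.\<close>

lemma noetherian_polys_insert:
  assumes noeth: "noetherian_in (polys V :: ('k::field) polynomial set)" and w: "w \<notin> V"
  shows "noetherian_in (polys (insert w V) :: 'k polynomial set)"
proof (rule noetherian_inI_chain)
  fix J :: "nat \<Rightarrow> 'k polynomial set"
  assume J: "\<And>i. ideal_in (polys (insert w V)) (J i)" and mono: "\<And>i. J i \<subseteq> J (Suc i)"
  have Jmono: "J i \<subseteq> J j" if "i \<le> j" for i j using lift_Suc_mono_le[of J, OF mono that] .
  define L where "L = (\<lambda>k i. lead w k (J i))"
  have Lid: "ideal_in (polys V) (L k i)" for k i unfolding L_def by (rule ideal_lead[OF w J])
  have L1: "L k i \<subseteq> L k j" if "i \<le> j" for k i j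
    using Jmono[OF that] by (auto simp: L_def lead_def)
  have L2: "L k i \<subseteq> L l i" if "k \<le> l" for k i l
    unfolding L_def using lift_Suc_mono_le[of "\<lambda>k. lead w k (J i)", OF lead_Suc[OF J] that] .
  obtain k0 where k0: "\<And>i. L k0 k0 \<subseteq> L i i \<Longrightarrow> L i i = L k0 k0"
    using noetherian_in_maximal_range[OF noeth, of "\<lambda>i. L i i"] Lid by blast
  have diag: "L k i = L k0 k0" if "k \<ge> k0" "i \<ge> k0" for k i
  proof -
    have "L k0 k0 \<subseteq> L k i" using L1 L2 that by blast
    moreover have "L k i \<subseteq> L (max k i) (max k i)" using L1 L2 by (meson max.cobounded1 max.cobounded2 order_trans)
    moreover have "L (max k i) (max k i) = L k0 k0" using k0 calculation by blast
    ultimately show ?thesis by blast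
  qed
  have "\<exists>n. \<forall>i. L k n \<subseteq> L k i \<longrightarrow> L k i = L k n" for k
    using noetherian_in_maximal_range[OF noeth, of "L k"] Lid by blast
  then obtain n where n: "\<And>k i. L k (n k) \<subseteq> L k i \<Longrightarrow> L k i = L k (n k)" by metis
  define N where "N = Max (insert k0 (n ` {..k0}))"
  have N: "k0 \<le> N" "\<And>k. k \<le> k0 \<Longrightarrow> n k \<le> N" unfolding N_def by (auto intro!: Max_ge simp del: Max_insert)
  have "L k i = L k N" if "i \<ge> N" for k i
  proof (cases "k \<le> k0")
    case True
    then show ?thesis using n[of k i] n[of k N] L1 N(2)[OF True] that by (metis order_trans)
  next
    case False
    then show ?thesis using diag[of k i] diag[of k N] N(1) that by simp
  qed
  then have "\<forall>i\<ge>N. J i = J N"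
    using lead_eq_imp_eq[OF J J Jmono] unfolding L_def by (metis subset_refl)
  then show "\<exists>N. \<forall>i\<ge>N. J i = J N" by blast
qed

theorem noetherian_polys: "finite V \<Longrightarrow> noetherian_in (polys V :: ('k::field) polynomial set)"
  by (induction V rule: finite_induct) (auto intro: noetherian_polys_empty noetherian_polys_insert)

subsection \<open>Prime ideals generated by variables\<close>

declare One_nat_def [simp del]

lemma single_eq_zero_iff [simp]: "psingle m c = 0 \<longleftrightarrow> c = 0"
  by (metis lookup_single_eq lookup_zero single_zero)

text \<open>A product of monomials avoids \<open>C\<close> exactly when both factors do.\<close>

lemma mfilter_mult:
  "mfilter (\<lambda>m. pkeys m \<inter> C = {}) (f * g) =
     mfilter (\<lambda>m. pkeys m \<inter> C = {}) f * mfilter (\<lambda>m. pkeys m \<inter> C = {}) g"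
proof (induction f rule: poly_induct)
  case (single m c)
  show ?case
    by (induction g rule: poly_induct)
      (auto simp: mult_single mfilter_single keys_add_nat distrib_left mfilter_add Int_Un_distrib2)
qed (auto simp: distrib_right mfilter_add)

text \<open>Written as the kernel of the substitution of 0 for the variables in \<open>C\<close>, so
  that primality follows from the absence of zero divisors; \<open>var_ideal_least\<close> relates
  it to generation by these variables.\<close>

definition var_ideal :: "nat set \<Rightarrow> nat set \<Rightarrow> ('k::field) polynomial set" where
  "var_ideal V C = {f \<in> polys V. mfilter (\<lambda>m. pkeys m \<inter> C = {}) f = 0}"

lemma prime_var_ideal: "prime_in (polys V) (var_ideal V C :: ('k::field) polynomial set)"
  unfolding prime_in_def ideal_in_def var_ideal_def
  by (auto simp: mfilter_add mfilter_mult polys.zero_mem polys.add_mem polys.mult_mem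
      mfilter_single simp flip: single_one)

lemma var_in_var_ideal_iff: "i \<in> V \<Longrightarrow> var i \<in> var_ideal V C \<longleftrightarrow> i \<in> C"
  by (auto simp: var_ideal_def mfilter_single var_in_polys)

lemma mon_in_var_ideal_iff: "pkeys m \<subseteq> V \<Longrightarrow> mon m \<in> var_ideal V C \<longleftrightarrow> pkeys m \<inter> C \<noteq> {}"
  by (auto simp: var_ideal_def mfilter_single single_in_polys)

lemma mfilter_in_polys: "f \<in> polys V \<Longrightarrow> mfilter (\<lambda>m. pkeys m \<inter> C = {}) f \<in> polys (V - C)"
  by (rule polysI) (auto simp: lookup_mfilter dest: polysD split: if_splits)

lemma diff_mfilter_in_var_ideal:
  assumes "f \<in> polys V" shows "f - mfilter (\<lambda>m. pkeys m \<inter> C = {}) f \<in> var_ideal V C"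
proof -
  have "mfilter (\<lambda>m. pkeys m \<inter> C = {}) f \<in> polys V"
    using mfilter_in_polys[OF assms, of C] polys_mono[of "V - C" V] by blast
  then show ?thesis
    unfolding var_ideal_def using assms
    by (auto intro!: polys.diff_mem poly_mapping_eqI simp: lookup_mfilter lookup_minus)
qed

text \<open>Every monomial of such a polynomial contains a variable from \<open>C\<close>, which can
  be split off.\<close>

lemma var_ideal_least:
  fixes J :: "('k::field) polynomial set"
  assumes J: "ideal_in (polys V) J" and C: "\<And>c. c \<in> C \<Longrightarrow> var c \<in> J"
  shows "var_ideal V C \<subseteq> J"
proof
  fix f :: "'k polynomial" assume f: "f \<in> var_ideal V C"
  have "psingle m (plookup f m) \<in> J" if m: "m \<in> pkeys f" for m
  proof -
    have mV: "pkeys m \<subseteq> V" using f m by (auto simp: var_ideal_def polys_def)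
    have "plookup (mfilter (\<lambda>m. pkeys m \<inter> C = {}) f) m = 0" using f by (simp add: var_ideal_def)
    then obtain c where c: "c \<in> pkeys m" "c \<in> C" using m by (auto simp: lookup_mfilter in_keys_iff split: if_splits)
    have "m - psingle c 1 + psingle c 1 = m"
      using c(1) by (intro poly_mapping_eqI) (auto simp: lookup_minus lookup_add lookup_single when_def in_keys_iff)
    then have eq: "psingle m (plookup f m) = psingle (m - psingle c 1) (plookup f m) * var c"
      by (simp add: mult_single)
    have "pkeys (m - psingle c 1) \<subseteq> V" using mV by (auto simp: in_keys_iff lookup_minus)
    then show ?thesis unfolding eq using ideal_inD(4)[OF J] C[OF c(2)] single_in_polys by blast
  qed
  then show "f \<in> J" using poly_sum_monomials[of f] polys.ideal_in_sum[OF J] by metis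
qed

subsection \<open>Algebraic independence modulo a prime and chains of primes\<close>

definition exps :: "nat \<Rightarrow> nat \<Rightarrow> nat list set" where
  "exps r N = {l. set l \<subseteq> {..N} \<and> length l = r}"

fun powers :: "('k::field) polynomial list \<Rightarrow> nat list \<Rightarrow> 'k polynomial" where
  "powers (f # fs) (e # l) = f ^ e * powers fs l"
| "powers _ _ = 1"

text \<open>Algebraic independence over \<open>K\<close> of the residue classes modulo
  \<open>P\<close>. A relation is given by its coefficient function \<open>c\<close> on exponent
  lists bounded by \<open>N\<close>, which avoids evaluating polynomials at lists of polynomials and
  prepares the counting.\<close>

definition alg_indep :: "('k::field) polynomial set \<Rightarrow> 'k polynomial list \<Rightarrow> bool" where
  "alg_indep P fs \<longleftrightarrow> (\<forall>N c. (\<Sum>l\<in>exps (length fs) N. psingle 0 (c l) * powers fs l) \<in> P \<longrightarrow>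
     (\<forall>l\<in>exps (length fs) N. c l = 0))"

lemma finite_exps: "finite (exps r N)"
  unfolding exps_def by (rule finite_lists_length_eq) auto

lemma card_exps: "card (exps r N) = (N + 1) ^ r"
  unfolding exps_def by (subst card_lists_length_eq) (auto simp: One_nat_def)

lemma sum_exps_Suc:
  fixes h :: "nat list \<Rightarrow> 'b::comm_monoid_add"
  shows "(\<Sum>l\<in>exps (Suc r) N. h l) = (\<Sum>e\<le>N. \<Sum>l\<in>exps r N. h (e # l))"
proof -
  have "exps (Suc r) N = (\<lambda>(e, l). e # l) ` ({..N} \<times> exps r N)"
    by (auto simp: exps_def length_Suc_conv image_iff)
  moreover have "inj_on (\<lambda>(e, l). e # l) ({..N} \<times> exps r N)" by (auto simp: inj_on_def)
  ultimately show ?thesis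
    by (simp add: sum.reindex sum.cartesian_product comp_def case_prod_unfold)
qed

lemma powers_in_polys: "set fs \<subseteq> polys V \<Longrightarrow> powers fs l \<in> polys V"
  by (induction fs l rule: powers.induct) (auto intro: polys.mem_intros)

text \<open>The relation is divided by the power of \<open>f\<close> that it contains and then read modulo \<open>Q\<close>.\<close>

lemma alg_indep_Cons:
  fixes P :: "('k::field) polynomial set"
  assumes P: "prime_in (polys V) P" and Q: "ideal_in (polys V) Q" and PQ: "P \<subseteq> Q"
    and f: "f \<in> Q" "f \<notin> P" and fs: "set fs \<subseteq> polys V" and ind: "alg_indep Q fs"
  shows "alg_indep P (f # fs)"
  unfolding alg_indep_def
proof (intro allI impI ballI)
  fix N c l
  let ?r = "length fs"
  assume sum: "(\<Sum>l\<in>exps (length (f # fs)) N. psingle 0 (c l) * powers (f # fs) l) \<in> P"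
    and l: "l \<in> exps (length (f # fs)) N"
  define B where "B = (\<lambda>e. \<Sum>l\<in>exps ?r N. psingle 0 (c (e # l)) * powers fs l)"
  note PD = ideal_inD[OF prime_inD(1)[OF P]]
  note QD = ideal_inD[OF Q]
  have fA: "f \<in> polys V" using f QD by blast
  have BA: "B e \<in> polys V" for e
    unfolding B_def by (intro polys.mem_intros powers_in_polys fs single_in_polys) auto
  have tot: "(\<Sum>e\<le>N. f ^ e * B e) \<in> P"
    using sum by (simp add: sum_exps_Suc B_def sum_distrib_left algebra_simps)
  have fpow: "f ^ e \<notin> P" for e
  proof (induction e)
    case (Suc e)
    then show ?case using prime_inD(3)[OF P fA polys.power_mem[OF fA], of e] f(2) by auto
  qed (use prime_inD(2)[OF P] in simp)
  have zero: "\<forall>l\<in>exps ?r N. c (e # l) = 0" if "e \<le> N" for e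
    using that
  proof (induction e rule: less_induct)
    case (less e)
    have B0: "B e' = 0" if "e' < e" for e'
      unfolding B_def using less that by (intro sum.neutral) auto
    have "(\<Sum>e'\<le>N. f ^ e' * B e') = (\<Sum>e'\<in>{e..N}. f ^ e' * B e')"
      by (rule sum.mono_neutral_right) (auto simp: B0)
    also have "\<dots> = f ^ e * (\<Sum>e'\<in>{e..N}. f ^ (e' - e) * B e')"
      unfolding sum_distrib_left by (intro sum.cong) (auto simp: power_add[symmetric] mult.assoc[symmetric])
    finally have "f ^ e * (\<Sum>e'\<in>{e..N}. f ^ (e' - e) * B e') \<in> P" using tot by simp
    moreover have "(\<Sum>e'\<in>{e..N}. f ^ (e' - e) * B e') \<in> polys V"
      using fA BA by (intro polys.mem_intros)
    ultimately have 1: "(\<Sum>e'\<in>{e..N}. f ^ (e' - e) * B e') \<in> P"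
      using prime_inD(3)[OF P] fpow fA polys.power_mem by blast
    have split: "(\<Sum>e'\<in>{e..N}. f ^ (e' - e) * B e') = B e + (\<Sum>e'\<in>{e<..N}. f ^ (e' - e) * B e')"
    proof -
      have "{e..N} = insert e {e<..N}" using less.prems by auto
      then show ?thesis by simp
    qed
    have "f ^ (e' - e) * B e' \<in> Q" if e': "e' \<in> {e<..N}" for e'
    proof -
      obtain k where "e' - e = Suc k" using e' by (cases "e' - e") auto
      moreover have "f ^ k * B e' * f \<in> Q"
        by (rule QD(4)[OF polys.mult_mem[OF polys.power_mem[OF fA] BA] f(1)])
      ultimately show ?thesis by (simp add: algebra_simps)
    qed
    then have "(\<Sum>e'\<in>{e<..N}. f ^ (e' - e) * B e') \<in> Q" by (intro polys.ideal_in_sum[OF Q])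
    then have "B e + (\<Sum>e'\<in>{e<..N}. f ^ (e' - e) * B e') - (\<Sum>e'\<in>{e<..N}. f ^ (e' - e) * B e') \<in> Q"
      using 1 PQ split by (intro polys.ideal_in_diff[OF Q]) auto
    then have "B e \<in> Q" by simp
    moreover have "B e \<in> Q \<longrightarrow> (\<forall>l\<in>exps ?r N. c (e # l) = 0)"
      using ind[unfolded alg_indep_def, THEN spec[of _ N], THEN spec[of _ "\<lambda>l. c (e # l)"]]
      unfolding B_def .
    ultimately show ?case by blast
  qed
  from l obtain e l' where "l = e # l'" "e \<le> N" "l' \<in> exps ?r N"
    by (auto simp: exps_def length_Suc_conv)
  then show "c l = 0" using zero by blast
qed

section \<open>Independent variables and the counting bound\<close>

definition mon_exps :: "nat list \<Rightarrow> nat list \<Rightarrow> monomial" where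
  "mon_exps ys l = (\<Sum>i<length ys. psingle (ys ! i) (l ! i))"

lemma powers_vars:
  "length l = length ys \<Longrightarrow> powers (map var ys) l = (mon (mon_exps ys l) :: ('k::field) polynomial)"
proof (induction ys arbitrary: l)
  case (Cons y ys)
  then obtain e l' where l: "l = e # l'" "length l' = length ys" by (auto simp: length_Suc_conv)
  have pow: "var y ^ e = (mon (psingle y e) :: 'k polynomial)"
    by (induction e) (auto simp: mult_single single_add[symmetric] One_nat_def)
  have "mon_exps (y # ys) l = psingle y e + mon_exps ys l'"
    unfolding mon_exps_def l by (simp add: sum.lessThan_Suc_shift del: sum.lessThan_Suc)
  then show ?case using Cons.IH[OF l(2)] l pow by (simp add: mult_single del: single_one)
qed (simp add: mon_exps_def)

lemma mon_exps_lookup: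
  assumes "distinct ys" "i < length ys"
  shows "plookup (mon_exps ys l) (ys ! i) = l ! i"
proof -
  have "plookup (mon_exps ys l) (ys ! i) = (\<Sum>j<length ys. if j = i then l ! i else 0)"
    unfolding mon_exps_def lookup_sum lookup_single
    using assms by (intro sum.cong) (auto simp: when_def nth_eq_iff_index_eq)
  then show ?thesis using assms by simp
qed

text \<open>A relation lies in \<open>P \<inter> polys (set ys)\<close> and is therefore zero;
  distinct exponent lists give distinct monomials, so its coefficients can be read off.\<close>

lemma alg_indep_vars:
  fixes P :: "('k::field) polynomial set"
  assumes ys: "distinct ys" and P: "P \<inter> polys (set ys) \<subseteq> {0}"
  shows "alg_indep P (map var ys)"
  unfolding alg_indep_def
proof (intro allI impI ballI)
  fix N :: nat and c :: "nat list \<Rightarrow> 'k" and l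
  let ?E = "exps (length (map var ys :: 'k polynomial list)) N"
  let ?f = "\<Sum>l\<in>?E. psingle 0 (c l) * powers (map var ys) l"
  assume f: "?f \<in> P" and l: "l \<in> ?E"
  have len: "length l = length ys" if "l \<in> ?E" for l using that by (auto simp: exps_def)
  have "?f \<in> polys (set ys)"
    by (intro polys.mem_intros powers_in_polys) (auto intro: single_in_polys var_in_polys)
  then have f0: "?f = 0" using f P by blast
  have "?f = (\<Sum>l\<in>?E. psingle (mon_exps ys l) (c l))"
    by (intro sum.cong refl) (simp add: powers_vars[OF len] mult_single)
  moreover have inj: "l' = l" if "l' \<in> ?E" "mon_exps ys l' = mon_exps ys l" for l'
    by (rule nth_equalityI) (use len[OF that(1)] len[OF l] mon_exps_lookup[OF ys] that(2) in metis)+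
  ultimately have "plookup ?f (mon_exps ys l) = (\<Sum>l'\<in>?E. if l' = l then c l else 0)"
    by (simp add: lookup_sum lookup_single when_def) (intro sum.cong, auto)
  then show "c l = 0" using f0 l finite_exps by simp
qed

text \<open>Gaussian elimination, one equation at a time: if \<open>e\<close> involves an unknown
  \<open>y\<close>, then \<open>b\<close> is the system with \<open>y\<close> eliminated, and
  \<open>d\<close> extends its solution by solving \<open>e\<close> for \<open>y\<close>.\<close>

lemma homogeneous_system:
  fixes a :: "'e \<Rightarrow> 'v \<Rightarrow> 'k::field"
  assumes "finite E" "finite X" "card E < card X"
  shows "\<exists>c. (\<exists>x\<in>X. c x \<noteq> 0) \<and> (\<forall>e\<in>E. (\<Sum>x\<in>X. c x * a e x) = 0)"
  using assms
proof (induction E arbitrary: X a rule: finite_induct)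
  case empty
  then obtain x where "x \<in> X" by (metis card.empty card_gt_0_iff ex_in_conv)
  then show ?case by (intro exI[of _ "\<lambda>_. 1"]) auto
next
  case (insert e E)
  show ?case
  proof (cases "\<forall>x\<in>X. a e x = 0")
    case True
    obtain c where "\<exists>x\<in>X. c x \<noteq> 0" "\<forall>e\<in>E. (\<Sum>x\<in>X. c x * a e x) = 0"
      using insert.IH[of X a] insert.prems insert.hyps by auto
    then show ?thesis using True by (intro exI[of _ c]) auto
  next
    case False
    then obtain y where y: "y \<in> X" "a e y \<noteq> 0" by blast
    define b where "b = (\<lambda>e' x. a e' x - a e x / a e y * a e' y)"
    have "card E < card (X - {y})" "finite (X - {y})"
      using insert.prems insert.hyps y by (auto simp: card_Diff_singleton)
    then obtain c where c: "\<exists>x\<in>X - {y}. c x \<noteq> 0" "\<forall>e'\<in>E. (\<Sum>x\<in>X - {y}. c x * b e' x) = 0"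
      using insert.IH[of "X - {y}" b] by blast
    define d where "d = c(y := - (\<Sum>x\<in>X - {y}. c x * a e x) / a e y)"
    have split: "(\<Sum>x\<in>X. d x * a e' x) = d y * a e' y + (\<Sum>x\<in>X - {y}. c x * a e' x)" for e'
    proof -
      have "(\<Sum>x\<in>X. d x * a e' x) = d y * a e' y + (\<Sum>x\<in>X - {y}. d x * a e' x)"
        using insert.prems(1) y(1) by (rule sum.remove)
      also have "(\<Sum>x\<in>X - {y}. d x * a e' x) = (\<Sum>x\<in>X - {y}. c x * a e' x)"
        by (intro sum.cong) (auto simp: d_def)
      finally show ?thesis .
    qed
    have "(\<Sum>x\<in>X. d x * a e x) = 0" unfolding split using y(2) by (simp add: d_def)
    moreover have "(\<Sum>x\<in>X. d x * a e' x) = 0" if "e' \<in> E" for e'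
    proof -
      have "(\<Sum>x\<in>X - {y}. c x * b e' x) =
          (\<Sum>x\<in>X - {y}. c x * a e' x) - (\<Sum>x\<in>X - {y}. c x * a e x) / a e y * a e' y"
        unfolding b_def sum_divide_distrib sum_distrib_right sum_subtractf[symmetric]
        by (intro sum.cong) (auto simp: algebra_simps)
      then show ?thesis unfolding split using c(2) that by (simp add: d_def)
    qed
    moreover have "\<exists>x\<in>X. d x \<noteq> 0" using c(1) by (auto simp: d_def)
    ultimately show ?thesis by (intro exI[of _ d]) auto
  qed
qed

text \<open>Bounding each exponent rather than the total degree gives the count
  \<open>(B + 1) ^ card V\<close> without binomial coefficients.\<close>

definition box :: "nat set \<Rightarrow> nat \<Rightarrow> monomial set" where
  "box V B = {m. pkeys m \<subseteq> V \<and> (\<forall>v. plookup m v \<le> B)}"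

lemma finite_card_box:
  assumes "finite V"
  shows "finite (box V B)" "card (box V B) \<le> (B + 1) ^ card V"
proof -
  let ?\<phi> = "\<lambda>m. restrict (plookup m) V"
  have im: "?\<phi> ` box V B \<subseteq> (\<Pi>\<^sub>E v\<in>V. {..B})" by (auto simp: box_def)
  have inj: "inj_on ?\<phi> (box V B)"
  proof (rule inj_onI, rule poly_mapping_eqI)
    fix m m' v assume m: "m \<in> box V B" "m' \<in> box V B" "?\<phi> m = ?\<phi> m'"
    show "plookup m v = plookup m' v"
    proof (cases "v \<in> V")
      case True
      then show ?thesis using fun_cong[OF m(3), of v] by simp
    next
      case False
      then have "v \<notin> pkeys m" "v \<notin> pkeys m'" using m by (auto simp: box_def)
      then show ?thesis by (simp add: not_in_keys_iff_lookup_eq_zero)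
    qed
  qed
  have fin: "finite (\<Pi>\<^sub>E v\<in>V. {..B})" using assms by (simp add: finite_PiE)
  show "finite (box V B)" using finite_imageD[OF finite_subset[OF im fin] inj] .
  have "card (box V B) \<le> card (\<Pi>\<^sub>E v\<in>V. {..B})" by (rule card_inj_on_le[OF inj im fin])
  then show "card (box V B) \<le> (B + 1) ^ card V" using assms by (simp add: card_PiE One_nat_def)
qed

lemma keys_mult_box:
  fixes f g :: "('k::field) polynomial"
  assumes "pkeys f \<subseteq> box V a" "pkeys g \<subseteq> box V b"
  shows "pkeys (f * g) \<subseteq> box V (a + b)"
proof
  fix m assume "m \<in> pkeys (f * g)"
  then obtain x y where "x \<in> pkeys f" "y \<in> pkeys g" "m = x + y" using keys_mult[of f g] by blast
  then show "m \<in> box V (a + b)"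
    using assms unfolding box_def by (auto simp: keys_add_nat lookup_add intro!: add_mono)
qed

lemma keys_one_box: "pkeys (1 :: ('k::field) polynomial) \<subseteq> box V 0"
  by (auto simp: box_def)

lemma keys_power_box:
  fixes f :: "('k::field) polynomial"
  assumes "pkeys f \<subseteq> box V a" shows "pkeys (f ^ e) \<subseteq> box V (e * a)"
  by (induction e) (use keys_one_box keys_mult_box[OF assms] in auto)

lemma box_mono: "a \<le> b \<Longrightarrow> box V a \<subseteq> box V b"
  unfolding box_def using order_trans by blast

lemma keys_powers_box:
  fixes fs :: "('k::field) polynomial list"
  assumes "\<And>f. f \<in> set fs \<Longrightarrow> pkeys f \<subseteq> box V a" "set l \<subseteq> {..N}"
  shows "pkeys (powers fs l) \<subseteq> box V (length fs * (N * a))"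
  using assms
proof (induction fs l rule: powers.induct)
  case (1 f fs e l)
  have "pkeys (f ^ e) \<subseteq> box V (N * a)"
    using keys_power_box[of f V a e] 1 box_mono[of "e * a" "N * a" V] by fastforce
  then show ?case using keys_mult_box[of "f ^ e" V "N * a"] 1 by auto
qed (auto simp: box_def)

lemma exists_box:
  fixes f :: "('k::field) polynomial"
  assumes "f \<in> polys V" shows "\<exists>a. pkeys f \<subseteq> box V a"
proof -
  have "finite (\<Union>m\<in>pkeys f. plookup m ` pkeys m)" by auto
  then obtain a where a: "\<And>x. x \<in> (\<Union>m\<in>pkeys f. plookup m ` pkeys m) \<Longrightarrow> x \<le> a"
    by (meson finite_nat_set_iff_bounded_le)
  have "plookup m v \<le> a" if "m \<in> pkeys f" for m v
    using a[of "plookup m v"] that by (cases "v \<in> pkeys m") (blast, simp add: in_keys_iff)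
  then show ?thesis using assms by (auto simp: box_def polys_def intro!: exI[of _ a])
qed

lemma exists_box_list:
  fixes fs :: "('k::field) polynomial list"
  assumes "set fs \<subseteq> polys V" shows "\<exists>a. \<forall>f\<in>set fs. pkeys f \<subseteq> box V a"
  using assms
proof (induction fs)
  case (Cons f fs)
  then obtain a b where "\<forall>f\<in>set fs. pkeys f \<subseteq> box V a" "pkeys f \<subseteq> box V b" using exists_box[of f V] by auto
  then show ?case
    using box_mono[of a "max a b" V] box_mono[of b "max a b" V] by (intro exI[of _ "max a b"]) auto
qed simp

text \<open>Too many \<open>fs\<close> have more power products with exponents at most \<open>N\<close> than there are monomials
  of comparable degree.\<close>

lemma alg_indep_bound:
  fixes P :: "('k::field) polynomial set"
  assumes V: "finite V" and P: "ideal_in (polys V) P" and C: "C \<subseteq> V" "\<And>c. c \<in> C \<Longrightarrow> var c \<in> P"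
    and fs: "set fs \<subseteq> polys V" and ind: "alg_indep P fs"
  shows "length fs + card C \<le> card V"
proof (rule ccontr)
  assume "\<not> ?thesis"
  moreover have cardV: "card (V - C) + card C = card V"
    using V C(1) by (metis card_Diff_subset card_mono finite_subset le_add_diff_inverse2)
  ultimately have gt: "Suc (card (V - C)) \<le> length fs" by simp
  define \<rho> :: "'k polynomial \<Rightarrow> 'k polynomial" where "\<rho> = mfilter (\<lambda>m. pkeys m \<inter> C = {})"
  obtain a where a: "\<And>f. f \<in> set fs \<Longrightarrow> pkeys f \<subseteq> box V a" using exists_box_list[OF fs] by blast
  define q r where "q = card (V - C)" and "r = length fs"
  \<comment> \<open>Chosen so that the estimate \<open>((r * a + 1) * (N + 1)) ^ q\<close> for the
    number of monomials becomes \<open>N * (N + 1) ^ q\<close>, which is less than the number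
    \<open>(N + 1) ^ r\<close> of exponent lists as soon as \<open>r > q\<close>.\<close>
  define N where "N = (r * a + 1) ^ q"
  let ?E = "box (V - C) (r * (N * a))"
  have "card ?E \<le> (r * (N * a) + 1) ^ q"
    using finite_card_box(2)[of "V - C" "r * (N * a)"] V by (simp add: q_def)
  also have "\<dots> \<le> ((r * a + 1) * (N + 1)) ^ q"
    by (rule power_mono) (auto simp: algebra_simps)
  also have "\<dots> = N * (N + 1) ^ q" unfolding N_def power_mult_distrib ..
  also have "\<dots> < (N + 1) ^ Suc q" by simp
  also have "\<dots> \<le> (N + 1) ^ r" using gt unfolding q_def r_def by (intro power_increasing) auto
  finally have "card ?E < card (exps r N)" by (simp add: card_exps)
  \<comment> \<open>One equation for each monomial of the box free of \<open>C\<close>, one unknown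
    for each exponent list. Monomials with a variable from \<open>C\<close> impose no equation,
    since they lie in \<open>P\<close> anyway.\<close>
  then obtain c where c: "\<exists>l\<in>exps r N. c l \<noteq> 0"
      "\<forall>m\<in>?E. (\<Sum>l\<in>exps r N. c l * plookup (powers fs l) m) = 0"
    using homogeneous_system[of ?E "exps r N" "\<lambda>m l. plookup (powers fs l) m"] finite_card_box(1) V finite_exps
    by blast
  let ?f = "\<Sum>l\<in>exps r N. psingle 0 (c l) * powers fs l"
  have fA: "?f \<in> polys V"
    by (intro polys.mem_intros powers_in_polys fs single_in_polys) auto
  have scal: "plookup (psingle 0 x * g) m = x * plookup g m" for x :: 'k and g m
    unfolding mult_map_scale_conv_mult[symmetric] by (simp add: map.rep_eq when_def)
  have "\<rho> ?f = 0"
  proof (rule poly_mapping_eqI)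
    fix m
    have *: "plookup ?f m = (\<Sum>l\<in>exps r N. c l * plookup (powers fs l) m)" by (simp add: lookup_sum scal)
    have "plookup ?f m = 0" if "pkeys m \<inter> C = {}"
    proof (cases "m \<in> ?E")
      case False
      have "plookup (powers fs l) m = 0" if l: "l \<in> exps r N" for l
      proof (rule ccontr)
        assume "plookup (powers fs l) m \<noteq> 0"
        then have "m \<in> box V (r * (N * a))"
          using keys_powers_box[of fs V a l N] a l by (auto simp: exps_def r_def in_keys_iff)
        then show False using False \<open>pkeys m \<inter> C = {}\<close> by (auto simp: box_def)
      qed
      then show ?thesis unfolding * by simp
    qed (use * c(2) in simp)
    then show "plookup (\<rho> ?f) m = plookup 0 m" by (simp add: \<rho>_def lookup_mfilter)
  qed
  then have "?f \<in> var_ideal V C" using fA by (simp add: \<rho>_def var_ideal_def)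
  then have "?f \<in> P" using var_ideal_least[OF P C(2)] by blast
  then show False using ind c(1) unfolding alg_indep_def r_def by blast
qed

text \<open>Going down the chain, the list of independent elements starts with the variables of
  \<open>Y\<close> at the top and gains one element at each strict inclusion. At the bottom the
  variables in \<open>C\<close> vanish modulo \<open>P 0\<close> and drop out of the count. These
  two end terms make the bound sharp enough to replace height and transcendence degree
  formulas.\<close>

theorem prime_chain_bound:
  fixes P :: "nat \<Rightarrow> ('k::field) polynomial set"
  assumes V: "finite V" and P: "\<And>i. i \<le> k \<Longrightarrow> prime_in (polys V) (P i)"
    and strict: "\<And>i. i < k \<Longrightarrow> P i \<subset> P (Suc i)"
    and C: "C \<subseteq> V" "\<And>c. c \<in> C \<Longrightarrow> var c \<in> P 0"
    and Y: "Y \<subseteq> V" "P k \<inter> polys Y \<subseteq> {0}"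
  shows "k + card Y + card C \<le> card V"
proof -
  have "finite Y" using V Y finite_subset by blast
  then obtain ys where ys: "set ys = Y" "distinct ys" using finite_distinct_list by blast
  have "\<exists>fs. length fs = i + card Y \<and> set fs \<subseteq> polys V \<and> alg_indep (P (k - i)) fs" if "i \<le> k" for i
    using that
  proof (induction i)
    case 0
    have "alg_indep (P k) (map var ys)" using alg_indep_vars ys Y by blast
    moreover have "set (map var ys :: 'k polynomial list) \<subseteq> polys V" using ys Y var_in_polys by auto
    ultimately show ?case
      using ys by (intro exI[of _ "map var ys"]) (auto simp: distinct_card[symmetric])
  next
    case (Suc i)
    then obtain fs where fs: "length fs = i + card Y" "set fs \<subseteq> polys V" "alg_indep (P (k - i)) fs" by auto
    have sub: "P (k - Suc i) \<subset> P (k - i)" using strict[of "k - Suc i"] Suc.prems by (simp add: Suc_diff_Suc)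
    then obtain f where f: "f \<in> P (k - i)" "f \<notin> P (k - Suc i)" by blast
    have id: "ideal_in (polys V) (P (k - i))" using P[of "k - i"] prime_inD(1) by auto
    have "alg_indep (P (k - Suc i)) (f # fs)"
      by (rule alg_indep_Cons[OF P id _ f fs(2,3)]) (use sub in auto)
    moreover have "f \<in> polys V" using f(1) ideal_inD(1)[OF id] by blast
    ultimately show ?case using fs by (intro exI[of _ "f # fs"]) auto
  qed
  from this[of k] obtain fs where "length fs = k + card Y" "set fs \<subseteq> polys V" "alg_indep (P 0) fs" by auto
  moreover have "ideal_in (polys V) (P 0)" using P[of 0] prime_inD(1) by auto
  ultimately show ?thesis using alg_indep_bound[OF V _ C, of fs] by auto
qed

section \<open>Localizations of commutative rings\<close>

locale mult_subset = cring R for R (structure) +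
  fixes T
  assumes T_sub: "T \<subseteq> carrier R" and T_one: "\<one> \<in> T"
    and T_mult: "\<And>s t. s \<in> T \<Longrightarrow> t \<in> T \<Longrightarrow> s \<otimes> t \<in> T"
begin

lemma T_closed: "s \<in> T \<Longrightarrow> s \<in> carrier R"
  using T_sub by blast

lemma frac_rel_iff:
  "((a, s), (b, t)) \<in> frac_rel R T \<longleftrightarrow> a \<in> carrier R \<and> b \<in> carrier R \<and> s \<in> T \<and> t \<in> T \<and>
     (\<exists>w\<in>T. w \<otimes> (a \<otimes> t \<ominus> b \<otimes> s) = \<zero>)"
  by (simp add: frac_rel_def)

lemma frac_rel_sym:
  assumes "((a, s), (b, t)) \<in> frac_rel R T" shows "((b, t), (a, s)) \<in> frac_rel R T"
proof -
  from assms obtain w where w: "a \<in> carrier R" "b \<in> carrier R" "s \<in> T" "t \<in> T" "w \<in> T"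
    "w \<otimes> (a \<otimes> t \<ominus> b \<otimes> s) = \<zero>" by (auto simp: frac_rel_iff)
  note c = w(1,2) w(3,4,5)[THEN T_closed]
  have "w \<otimes> (b \<otimes> s \<ominus> a \<otimes> t) = \<ominus> (w \<otimes> (a \<otimes> t \<ominus> b \<otimes> s))" using c by algebra
  then show ?thesis using w by (auto simp: frac_rel_iff)
qed

text \<open>Scaling the two relations by \<open>r\<close> and \<open>s\<close> cancels the terms in
  \<open>b\<close> and leaves a common factor \<open>t\<close>, which becomes part of the
  witness.\<close>

lemma frac_rel_trans:
  assumes "((a, s), (b, t)) \<in> frac_rel R T" "((b, t), (c, r)) \<in> frac_rel R T"
  shows "((a, s), (c, r)) \<in> frac_rel R T"
proof -
  from assms obtain w w' where w: "a \<in> carrier R" "b \<in> carrier R" "c \<in> carrier R"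
    "s \<in> T" "t \<in> T" "r \<in> T" "w \<in> T" "w' \<in> T"
    "w \<otimes> (a \<otimes> t \<ominus> b \<otimes> s) = \<zero>" "w' \<otimes> (b \<otimes> r \<ominus> c \<otimes> t) = \<zero>" by (auto simp: frac_rel_iff)
  note cl = w(1,2,3) w(4-8)[THEN T_closed]
  have "(w \<otimes> w' \<otimes> t) \<otimes> (a \<otimes> r \<ominus> c \<otimes> s) =
      w' \<otimes> r \<otimes> (w \<otimes> (a \<otimes> t \<ominus> b \<otimes> s)) \<oplus> w \<otimes> s \<otimes> (w' \<otimes> (b \<otimes> r \<ominus> c \<otimes> t))"
    using cl by algebra
  also have "\<dots> = \<zero>" using w cl by simp
  finally show ?thesis using w T_mult by (auto simp: frac_rel_iff)
qed

lemma frac_rel_refl: "a \<in> carrier R \<Longrightarrow> s \<in> T \<Longrightarrow> ((a, s), (a, s)) \<in> frac_rel R T"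
  using T_closed T_one by (auto simp: frac_rel_iff r_neg minus_eq intro!: bexI[of _ \<one>])

lemma mem_fraction: "(b, t) \<in> fraction R T a s \<longleftrightarrow> ((a, s), (b, t)) \<in> frac_rel R T"
  by (simp add: fraction_def)

lemma fraction_eq_iff:
  assumes "a \<in> carrier R" "b \<in> carrier R" "s \<in> T" "t \<in> T"
  shows "fraction R T a s = fraction R T b t \<longleftrightarrow> (\<exists>w\<in>T. w \<otimes> (a \<otimes> t \<ominus> b \<otimes> s) = \<zero>)"
proof -
  have "fraction R T a s = fraction R T b t \<longleftrightarrow> ((a, s), (b, t)) \<in> frac_rel R T"
  proof
    assume "fraction R T a s = fraction R T b t"
    then show "((a, s), (b, t)) \<in> frac_rel R T"
      using frac_rel_refl[of b t] assms by (metis mem_fraction)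
  next
    assume r: "((a, s), (b, t)) \<in> frac_rel R T"
    have "(c, q) \<in> fraction R T a s \<longleftrightarrow> (c, q) \<in> fraction R T b t" for c q
      using r frac_rel_sym frac_rel_trans by (meson mem_fraction)
    then show "fraction R T a s = fraction R T b t" by auto
  qed
  then show ?thesis using assms by (simp add: frac_rel_iff)
qed

lemma fraction_eqI:
  assumes "a \<in> carrier R" "b \<in> carrier R" "s \<in> T" "t \<in> T" "a \<otimes> t = b \<otimes> s"
  shows "fraction R T a s = fraction R T b t"
  using assms T_closed T_one
  by (auto simp: fraction_eq_iff r_neg minus_eq intro!: bexI[of _ \<one>])

text \<open>The operations of \<open>localization\<close> are unions over all representatives; once
  the result does not depend on them, the union collapses to a single class.\<close>

lemma UN_fraction:
  assumes "a \<in> carrier R" "s \<in> T" "b \<in> carrier R" "t \<in> T"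
    and "\<And>a' s' b' t'. ((a, s), (a', s')) \<in> frac_rel R T \<Longrightarrow> ((b, t), (b', t')) \<in> frac_rel R T \<Longrightarrow>
      F a' s' b' t' = F a s b t"
  shows "(\<Union>(a', s')\<in>fraction R T a s. \<Union>(b', t')\<in>fraction R T b t. F a' s' b' t') = F a s b t"
proof (intro equalityI subsetI)
  fix z
  assume "z \<in> (\<Union>(a', s')\<in>fraction R T a s. \<Union>(b', t')\<in>fraction R T b t. F a' s' b' t')"
  then obtain a' s' b' t' where "(a', s') \<in> fraction R T a s" "(b', t') \<in> fraction R T b t"
    "z \<in> F a' s' b' t'" by blast
  then show "z \<in> F a s b t" using assms(5)[of a' s' b' t'] by (simp add: mem_fraction)
next
  fix z
  assume "z \<in> F a s b t"
  moreover have "(a, s) \<in> fraction R T a s" "(b, t) \<in> fraction R T b t"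
    using frac_rel_refl assms(1-4) by (simp_all add: mem_fraction)
  ultimately show "z \<in> (\<Union>(a', s')\<in>fraction R T a s. \<Union>(b', t')\<in>fraction R T b t. F a' s' b' t')"
    by blast
qed

lemma mult_fraction:
  assumes "a \<in> carrier R" "s \<in> T" "b \<in> carrier R" "t \<in> T"
  shows "fraction R T a s \<otimes>\<^bsub>localization R T\<^esub> fraction R T b t = fraction R T (a \<otimes> b) (s \<otimes> t)"
proof -
  have "fraction R T (a' \<otimes> b') (s' \<otimes> t') = fraction R T (a \<otimes> b) (s \<otimes> t)"
    if r: "((a, s), (a', s')) \<in> frac_rel R T" "((b, t), (b', t')) \<in> frac_rel R T" for a' s' b' t'
  proof -
    from r frac_rel_sym obtain w w' where w: "a' \<in> carrier R" "b' \<in> carrier R"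
      "s' \<in> T" "t' \<in> T" "w \<in> T" "w' \<in> T"
      "w \<otimes> (a' \<otimes> s \<ominus> a \<otimes> s') = \<zero>" "w' \<otimes> (b' \<otimes> t \<ominus> b \<otimes> t') = \<zero>" by (meson frac_rel_iff)
    note cl = assms(1,3) assms(2,4)[THEN T_closed] w(1,2) w(3-6)[THEN T_closed]
    have "(w \<otimes> w') \<otimes> (a' \<otimes> b' \<otimes> (s \<otimes> t) \<ominus> a \<otimes> b \<otimes> (s' \<otimes> t')) =
        w' \<otimes> b' \<otimes> t \<otimes> (w \<otimes> (a' \<otimes> s \<ominus> a \<otimes> s')) \<oplus> w \<otimes> a \<otimes> s' \<otimes> (w' \<otimes> (b' \<otimes> t \<ominus> b \<otimes> t'))"
      using cl by algebra
    also have "\<dots> = \<zero>" using w(7,8) cl by simp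
    finally have "\<exists>v\<in>T. v \<otimes> (a' \<otimes> b' \<otimes> (s \<otimes> t) \<ominus> a \<otimes> b \<otimes> (s' \<otimes> t')) = \<zero>"
      using T_mult w by blast
    then show ?thesis
      by (subst fraction_eq_iff) (use cl w assms T_mult in auto)
  qed
  then show ?thesis
    using UN_fraction[OF assms, of "\<lambda>a s b t. fraction R T (a \<otimes> b) (s \<otimes> t)"]
    by (simp add: localization_def)
qed

lemma add_fraction:
  assumes "a \<in> carrier R" "s \<in> T" "b \<in> carrier R" "t \<in> T"
  shows "fraction R T a s \<oplus>\<^bsub>localization R T\<^esub> fraction R T b t =
    fraction R T (a \<otimes> t \<oplus> b \<otimes> s) (s \<otimes> t)"
proof -
  have "fraction R T (a' \<otimes> t' \<oplus> b' \<otimes> s') (s' \<otimes> t') = fraction R T (a \<otimes> t \<oplus> b \<otimes> s) (s \<otimes> t)"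
    if r: "((a, s), (a', s')) \<in> frac_rel R T" "((b, t), (b', t')) \<in> frac_rel R T" for a' s' b' t'
  proof -
    from r frac_rel_sym obtain w w' where w: "a' \<in> carrier R" "b' \<in> carrier R"
      "s' \<in> T" "t' \<in> T" "w \<in> T" "w' \<in> T"
      "w \<otimes> (a' \<otimes> s \<ominus> a \<otimes> s') = \<zero>" "w' \<otimes> (b' \<otimes> t \<ominus> b \<otimes> t') = \<zero>" by (meson frac_rel_iff)
    note cl = assms(1,3) assms(2,4)[THEN T_closed] w(1,2) w(3-6)[THEN T_closed]
    have "(w \<otimes> w') \<otimes> ((a' \<otimes> t' \<oplus> b' \<otimes> s') \<otimes> (s \<otimes> t) \<ominus> (a \<otimes> t \<oplus> b \<otimes> s) \<otimes> (s' \<otimes> t')) =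
        w' \<otimes> t \<otimes> t' \<otimes> (w \<otimes> (a' \<otimes> s \<ominus> a \<otimes> s')) \<oplus> w \<otimes> s \<otimes> s' \<otimes> (w' \<otimes> (b' \<otimes> t \<ominus> b \<otimes> t'))"
      using cl by algebra
    also have "\<dots> = \<zero>" using w(7,8) cl by simp
    finally have "\<exists>v\<in>T. v \<otimes> ((a' \<otimes> t' \<oplus> b' \<otimes> s') \<otimes> (s \<otimes> t) \<ominus> (a \<otimes> t \<oplus> b \<otimes> s) \<otimes> (s' \<otimes> t')) = \<zero>"
      using T_mult w by blast
    then show ?thesis
      by (subst fraction_eq_iff) (use cl w assms T_mult in auto)
  qed
  then show ?thesis
    using UN_fraction[OF assms, of "\<lambda>a s b t. fraction R T (a \<otimes> t \<oplus> b \<otimes> s) (s \<otimes> t)"]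
    by (simp add: localization_def)
qed

lemma carrier_localization:
  "carrier (localization R T) = {fraction R T a s | a s. a \<in> carrier R \<and> s \<in> T}"
  by (auto simp: localization_def quotient_def fraction_def)

lemma fraction_in_carrier:
  "a \<in> carrier R \<Longrightarrow> s \<in> T \<Longrightarrow> fraction R T a s \<in> carrier (localization R T)"
  by (auto simp: carrier_localization)

lemma localization_cases:
  assumes "x \<in> carrier (localization R T)"
  obtains a s where "a \<in> carrier R" "s \<in> T" "x = fraction R T a s"
  using assms by (auto simp: carrier_localization)

lemma one_localization: "\<one>\<^bsub>localization R T\<^esub> = fraction R T \<one> \<one>"
  and zero_localization: "\<zero>\<^bsub>localization R T\<^esub> = fraction R T \<zero> \<one>"
  by (simp_all add: localization_def)

lemma cring_localization: "cring (localization R T)"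
proof (rule cringI)
  let ?L = "localization R T"
  note simps = mult_fraction add_fraction T_one T_mult T_closed one_localization zero_localization
  show "abelian_group ?L"
  proof (rule abelian_groupI)
    fix x y assume "x \<in> carrier ?L" "y \<in> carrier ?L"
    then show "x \<oplus>\<^bsub>?L\<^esub> y \<in> carrier ?L"
      by (elim localization_cases) (auto simp: simps intro!: fraction_in_carrier)
  next
    show "\<zero>\<^bsub>?L\<^esub> \<in> carrier ?L" by (auto simp: simps intro!: fraction_in_carrier)
  next
    fix x y z assume "x \<in> carrier ?L" "y \<in> carrier ?L" "z \<in> carrier ?L"
    then obtain a s b t c r where e: "a \<in> carrier R" "s \<in> T" "b \<in> carrier R" "t \<in> T" "c \<in> carrier R" "r \<in> T"
      "x = fraction R T a s" "y = fraction R T b t" "z = fraction R T c r" by (metis localization_cases)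
    note cl = e(1,3,5) e(2,4,6)[THEN T_closed]
    have "((a \<otimes> t \<oplus> b \<otimes> s) \<otimes> r \<oplus> c \<otimes> (s \<otimes> t)) \<otimes> (s \<otimes> (t \<otimes> r)) =
      (a \<otimes> (t \<otimes> r) \<oplus> (b \<otimes> r \<oplus> c \<otimes> t) \<otimes> s) \<otimes> ((s \<otimes> t) \<otimes> r)" using cl by algebra
    then have "fraction R T ((a \<otimes> t \<oplus> b \<otimes> s) \<otimes> r \<oplus> c \<otimes> (s \<otimes> t)) ((s \<otimes> t) \<otimes> r) =
      fraction R T (a \<otimes> (t \<otimes> r) \<oplus> (b \<otimes> r \<oplus> c \<otimes> t) \<otimes> s) (s \<otimes> (t \<otimes> r))"
      by (rule fraction_eqI[rotated 4]) (use e cl T_mult in auto)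
    then show "(x \<oplus>\<^bsub>?L\<^esub> y) \<oplus>\<^bsub>?L\<^esub> z = x \<oplus>\<^bsub>?L\<^esub> (y \<oplus>\<^bsub>?L\<^esub> z)"
      using e cl by (simp add: simps)
  next
    fix x y assume "x \<in> carrier ?L" "y \<in> carrier ?L"
    then obtain a s b t where e: "a \<in> carrier R" "s \<in> T" "b \<in> carrier R" "t \<in> T"
      "x = fraction R T a s" "y = fraction R T b t" by (metis localization_cases)
    note cl = e(1,3) e(2,4)[THEN T_closed]
    have "(a \<otimes> t \<oplus> b \<otimes> s) \<otimes> (t \<otimes> s) = (b \<otimes> s \<oplus> a \<otimes> t) \<otimes> (s \<otimes> t)" using cl by algebra
    then have "fraction R T (a \<otimes> t \<oplus> b \<otimes> s) (s \<otimes> t) = fraction R T (b \<otimes> s \<oplus> a \<otimes> t) (t \<otimes> s)"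
      by (rule fraction_eqI[rotated 4]) (use e cl T_mult in auto)
    then show "x \<oplus>\<^bsub>?L\<^esub> y = y \<oplus>\<^bsub>?L\<^esub> x"
      using e cl by (simp add: simps)
  next
    fix x assume "x \<in> carrier ?L"
    then obtain a s where e: "a \<in> carrier R" "s \<in> T" "x = fraction R T a s" by (metis localization_cases)
    note cl = e(1) e(2)[THEN T_closed]
    show "\<zero>\<^bsub>?L\<^esub> \<oplus>\<^bsub>?L\<^esub> x = x"
      using e cl by (auto simp: simps intro!: fraction_eqI)
    have "\<ominus> a \<otimes> s \<oplus> a \<otimes> s = \<zero>" using cl by algebra
    moreover have "fraction R T \<zero> (s \<otimes> s) = fraction R T \<zero> \<one>"
      by (rule fraction_eqI) (use e cl T_mult T_one in auto)
    moreover have "fraction R T (\<ominus> a) s \<oplus>\<^bsub>?L\<^esub> x = fraction R T (\<ominus> a \<otimes> s \<oplus> a \<otimes> s) (s \<otimes> s)"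
      unfolding e(3) by (rule add_fraction) (use e in auto)
    ultimately have "fraction R T (\<ominus> a) s \<oplus>\<^bsub>?L\<^esub> x = \<zero>\<^bsub>?L\<^esub>"
      by (simp only: zero_localization)
    then show "\<exists>y\<in>carrier ?L. y \<oplus>\<^bsub>?L\<^esub> x = \<zero>\<^bsub>?L\<^esub>"
      using e fraction_in_carrier by blast
  qed
  show "comm_monoid ?L"
  proof (rule comm_monoidI)
    fix x y assume "x \<in> carrier ?L" "y \<in> carrier ?L"
    then show "x \<otimes>\<^bsub>?L\<^esub> y \<in> carrier ?L"
      by (elim localization_cases) (auto simp: simps intro!: fraction_in_carrier)
  next
    show "\<one>\<^bsub>?L\<^esub> \<in> carrier ?L" by (auto simp: simps intro!: fraction_in_carrier)
  next
    fix x y z assume "x \<in> carrier ?L" "y \<in> carrier ?L" "z \<in> carrier ?L"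
    then obtain a s b t c r where e: "a \<in> carrier R" "s \<in> T" "b \<in> carrier R" "t \<in> T" "c \<in> carrier R" "r \<in> T"
      "x = fraction R T a s" "y = fraction R T b t" "z = fraction R T c r" by (metis localization_cases)
    note cl = e(1,3,5) e(2,4,6)[THEN T_closed]
    show "(x \<otimes>\<^bsub>?L\<^esub> y) \<otimes>\<^bsub>?L\<^esub> z = x \<otimes>\<^bsub>?L\<^esub> (y \<otimes>\<^bsub>?L\<^esub> z)"
      using e cl by (auto simp: simps m_assoc)
  next
    fix x assume "x \<in> carrier ?L"
    then show "\<one>\<^bsub>?L\<^esub> \<otimes>\<^bsub>?L\<^esub> x = x" by (elim localization_cases) (auto simp: simps)
  next
    fix x y assume "x \<in> carrier ?L" "y \<in> carrier ?L"
    then show "x \<otimes>\<^bsub>?L\<^esub> y = y \<otimes>\<^bsub>?L\<^esub> x"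
      by (elim localization_cases) (auto simp: simps m_comm)
  qed
  fix x y z assume "x \<in> carrier ?L" "y \<in> carrier ?L" "z \<in> carrier ?L"
  then obtain a s b t c r where e: "a \<in> carrier R" "s \<in> T" "b \<in> carrier R" "t \<in> T" "c \<in> carrier R" "r \<in> T"
    "x = fraction R T a s" "y = fraction R T b t" "z = fraction R T c r" by (metis localization_cases)
  note cl = e(1,3,5) e(2,4,6)[THEN T_closed]
  have "(a \<otimes> t \<oplus> b \<otimes> s) \<otimes> c \<otimes> (s \<otimes> r \<otimes> (t \<otimes> r)) =
    (a \<otimes> c \<otimes> (t \<otimes> r) \<oplus> b \<otimes> c \<otimes> (s \<otimes> r)) \<otimes> (s \<otimes> t \<otimes> r)" using cl by algebra
  then have "fraction R T ((a \<otimes> t \<oplus> b \<otimes> s) \<otimes> c) (s \<otimes> t \<otimes> r) =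
    fraction R T (a \<otimes> c \<otimes> (t \<otimes> r) \<oplus> b \<otimes> c \<otimes> (s \<otimes> r)) (s \<otimes> r \<otimes> (t \<otimes> r))"
    by (rule fraction_eqI[rotated 4]) (use e cl T_mult in auto)
  then show "(x \<oplus>\<^bsub>?L\<^esub> y) \<otimes>\<^bsub>?L\<^esub> z = x \<otimes>\<^bsub>?L\<^esub> z \<oplus>\<^bsub>?L\<^esub> y \<otimes>\<^bsub>?L\<^esub> z"
    using e cl by (simp add: simps)
qed

end

section \<open>Ideals and regular sequences of a localized quotient\<close>

text \<open>By the correspondence of primes this is the dimension of the localization at
  \<open>m\<close> of \<open>A\<close> modulo \<open>G\<close>; \<open>local_depth\<close> is the
  matching reformulation of the depth.\<close>

definition local_dim :: "'a::comm_ring_1 set \<Rightarrow> 'a set \<Rightarrow> 'a set \<Rightarrow> enat" where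
  "local_dim A m G = Sup {enat k | k. \<exists>P :: nat \<Rightarrow> 'a set.
     (\<forall>i\<le>k. prime_in A (P i) \<and> G \<subseteq> P i \<and> P i \<subseteq> m) \<and> (\<forall>i<k. P i \<subset> P (Suc i))}"

definition (in local_subring) local_depth :: "'a set \<Rightarrow> enat" where
  "local_depth G = Sup {enat (length gs) | gs. set gs \<subseteq> m \<and> regseq G gs}"

lemma (in local_subring) regseq_iff_nth:
  "regseq G gs \<longleftrightarrow> (\<forall>i<length gs. reg (set (take i gs) \<union> G) (gs ! i))"
proof (induction gs arbitrary: G)
  case (Cons g gs)
  show ?case unfolding regseq.simps Cons.IH
    by (auto simp: less_Suc_eq_0_disj)
qed simp

text \<open>Every element of \<open>R\<close> is an image \<open>h a\<close> up to a unit, so the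
  generators of the preimage of an ideal also generate the ideal. The form with units covers both
  the quotient, with \<open>w = \<one>\<close>, and its localizations.\<close>

lemma (in cring) noetherian_ring_of_surjection:
  fixes A :: "'c::comm_ring_1 set"
  assumes A: "subring1 A" "noetherian_in A"
    and h: "\<And>a. a \<in> A \<Longrightarrow> h a \<in> carrier R" "\<And>a b. a \<in> A \<Longrightarrow> b \<in> A \<Longrightarrow> h (a + b) = h a \<oplus> h b"
      "\<And>a b. a \<in> A \<Longrightarrow> b \<in> A \<Longrightarrow> h (a * b) = h a \<otimes> h b" "h 0 = \<zero>"
    and surj: "\<And>r. r \<in> carrier R \<Longrightarrow> \<exists>a\<in>A. \<exists>w\<in>Units R. r \<otimes> w = h a"
  shows "noetherian_ring R"
proof (rule noetherian_ringI)
  interpret A: subring1 A by fact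
  fix X assume X: "ideal X R"
  interpret X: ideal X R by fact
  let ?J = "{a \<in> A. h a \<in> X}"
  have idJ: "ideal_in A {a \<in> A. h a \<in> Y}" if Y: "ideal Y R" for Y
  proof -
    interpret Y: ideal Y R by fact
    show ?thesis
      unfolding ideal_in_def
      using h by (auto intro: A.mem_intros Y.I_l_closed)
  qed
  obtain G where G: "finite G" "G \<subseteq> ?J" "?J = ideal_gen A G"
    using A.noetherian_in_finite_gen[OF A(2) idJ[OF X]] by blast
  have sub: "h ` G \<subseteq> carrier R" using G(2) h(1) by auto
  have idl: "ideal (Idl (h ` G)) R" using genideal_ideal[OF sub] .
  interpret Y: ideal "Idl (h ` G)" R by fact
  have "ideal_gen A G \<subseteq> {a \<in> A. h a \<in> Idl (h ` G)}"
    using G(2) genideal_self[OF sub] by (intro A.ideal_gen_least idJ[OF idl]) auto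
  then have J: "\<And>a. a \<in> A \<Longrightarrow> h a \<in> X \<Longrightarrow> h a \<in> Idl (h ` G)" using G(3) by blast
  have "X \<subseteq> Idl (h ` G)"
  proof
    fix r assume r: "r \<in> X"
    then have rc: "r \<in> carrier R" using X.Icarr by blast
    obtain a w where aw: "a \<in> A" "w \<in> Units R" "r \<otimes> w = h a" using surj[OF rc] by blast
    have "r \<otimes> w \<in> X" by (rule X.I_r_closed[OF r Units_closed[OF aw(2)]])
    then have "r \<otimes> w \<in> Idl (h ` G)" using J aw by metis
    then have "r \<otimes> w \<otimes> inv w \<in> Idl (h ` G)" using aw Y.I_r_closed by auto
    moreover have "r \<otimes> w \<otimes> inv w = r"
      using rc aw(2) Units_closed[OF aw(2)] Units_inv_closed[OF aw(2)] by (simp add: m_assoc)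
    ultimately show "r \<in> Idl (h ` G)" by simp
  qed
  moreover have "Idl (h ` G) \<subseteq> X" using G(2) by (intro genideal_minimal X) auto
  ultimately show "\<exists>B\<subseteq>carrier R. finite B \<and> X = Idl B" using sub G(1) by blast
qed

text \<open>A characterization of \<open>R\<close> as the localization at \<open>m\<close> of
  \<open>A\<close> modulo \<open>G\<close> by properties of the canonical map \<open>h\<close>. The
  ideal theory then never touches classes of fractions.\<close>

locale local_quotient = local_subring A m + R: cring R
  for A :: "'a::comm_ring_1 set" and m and R (structure) +
  fixes h and G :: "'a set"
  assumes G_sub: "G \<subseteq> m"
    and h_closed: "\<And>a. a \<in> A \<Longrightarrow> h a \<in> carrier R"
    and h_add: "\<And>a b. a \<in> A \<Longrightarrow> b \<in> A \<Longrightarrow> h (a + b) = h a \<oplus> h b"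
    and h_mult: "\<And>a b. a \<in> A \<Longrightarrow> b \<in> A \<Longrightarrow> h (a * b) = h a \<otimes> h b"
    and h_one: "h 1 = \<one>"
    and h_unit: "\<And>s. s \<in> A - m \<Longrightarrow> h s \<in> Units R"
    and h_surj: "\<And>r. r \<in> carrier R \<Longrightarrow> \<exists>a\<in>A. \<exists>s\<in>A - m. r \<otimes> h s = h a"
    and h_zero: "\<And>a. a \<in> A \<Longrightarrow> h a = \<zero> \<longleftrightarrow> a \<in> loc G"
begin

lemma GA: "G \<subseteq> A"
  using G_sub m_sub by blast

text \<open>Contraction, with \<open>ext\<close> as extension. By \<open>pre_ext\<close> and
  \<open>ext_pre\<close> they are inverse to each other between the saturated ideals containing
  \<open>G\<close> and the ideals of \<open>R\<close>.\<close>

definition pre :: "'b set \<Rightarrow> 'a set" where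
  "pre X = {a \<in> A. h a \<in> X}"

definition ext :: "'a set \<Rightarrow> 'b set" where
  "ext J = {r \<in> carrier R. \<exists>a\<in>J. \<exists>s\<in>A - m. r \<otimes> h s = h a}"

lemma h_0: "h 0 = \<zero>"
  using h_zero[OF zero_mem] ideal_inD(2)[OF loc_ideal[OF GA]] by blast

lemma h_uminus: "a \<in> A \<Longrightarrow> h (- a) = \<ominus> h a"
  using h_add[of "- a" a] uminus_mem h_0 h_closed by (simp add: R.minus_equality)

lemma h_diff: "a \<in> A \<Longrightarrow> b \<in> A \<Longrightarrow> h (a - b) = h a \<ominus> h b"
  using h_add[of a "- b"] uminus_mem h_uminus by (simp add: R.minus_eq)

lemma unit_cancel:
  assumes "ideal X R" "r \<in> carrier R" "w \<in> Units R" "r \<otimes> w \<in> X" shows "r \<in> X"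
proof -
  have "(r \<otimes> w) \<otimes> inv w \<in> X" using ideal.I_r_closed[OF assms(1,4)] assms(3) by blast
  moreover have "(r \<otimes> w) \<otimes> inv w = r"
    using assms(2,3) R.Units_closed[OF assms(3)] R.Units_inv_closed[OF assms(3)] by (simp add: R.m_assoc)
  ultimately show ?thesis by simp
qed

text \<open>Denominators are units, so membership of a fraction is decided by its numerator.\<close>

lemma mem_ideal_iff:
  assumes "ideal X R" "r \<in> carrier R" "a \<in> A" "s \<in> A - m" "r \<otimes> h s = h a"
  shows "r \<in> X \<longleftrightarrow> a \<in> pre X"
proof
  assume "r \<in> X"
  then have "r \<otimes> h s \<in> X" using ideal.I_r_closed[OF assms(1)] h_closed assms(4) by auto
  then show "a \<in> pre X" using assms by (simp add: pre_def)
next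
  assume "a \<in> pre X"
  then have "r \<otimes> h s \<in> X" using assms by (simp add: pre_def)
  then show "r \<in> X" using unit_cancel[OF assms(1,2) h_unit[OF assms(4)]] by blast
qed

lemma saturated_pre:
  assumes "ideal X R" shows "saturated (pre X)"
proof -
  interpret X: ideal X R by fact
  have "ideal_in A (pre X)"
    unfolding ideal_in_def pre_def
    using h_0 by (auto simp: h_add h_mult h_closed intro: mem_intros X.I_l_closed)
  moreover have "a \<in> pre X" if "s \<in> A - m" "a \<in> A" "s * a \<in> pre X" for s a
  proof -
    have "h s \<otimes> h a \<in> X" using that h_mult[of s a] by (simp add: pre_def)
    then have "h a \<otimes> h s \<in> X" using R.m_comm[of "h a" "h s"] that h_closed by simp
    then have "h a \<in> X" using unit_cancel[OF assms _ h_unit[OF that(1)]] h_closed[OF that(2)] by blast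
    then show ?thesis using that(2) by (simp add: pre_def)
  qed
  ultimately show ?thesis by (auto simp: saturated_def)
qed

lemma G_sub_pre: "ideal X R \<Longrightarrow> G \<subseteq> pre X"
proof -
  assume "ideal X R"
  then interpret X: ideal X R .
  show ?thesis
    using h_zero[THEN iffD2] loc_incl[OF GA] GA X.zero_closed unfolding pre_def by fastforce
qed

lemma h_eq_iff: "a \<in> A \<Longrightarrow> b \<in> A \<Longrightarrow> h a = h b \<longleftrightarrow> a - b \<in> loc G"
  using h_zero[of "a - b"] h_closed by (simp add: h_diff diff_mem)

lemma pre_ext:
  assumes J: "saturated J" "G \<subseteq> J" shows "pre (ext J) = J"
proof
  note JD = ideal_inD[OF saturatedD(1)[OF J(1)]]
  show "J \<subseteq> pre (ext J)"
    using JD(1) h_closed compl_one h_one by (force simp: pre_def ext_def)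
  show "pre (ext J) \<subseteq> J"
  proof
    fix b assume "b \<in> pre (ext J)"
    then obtain a s where as: "b \<in> A" "a \<in> J" "s \<in> A - m" "h b \<otimes> h s = h a"
      by (auto simp: pre_def ext_def)
    have "b * s - a \<in> loc G"
      using as JD(1) by (subst h_eq_iff[symmetric]) (auto simp: h_mult intro: mem_intros)
    then have "b * s - a \<in> J" using loc_least[OF J] by blast
    then have "b * s - a + a \<in> J" using as JD by blast
    then show "b \<in> J" using saturatedD(2)[OF J(1), of s b] as by (simp add: mult.commute)
  qed
qed

lemma ideal_ext:
  assumes J: "saturated J" shows "ideal (ext J) R"
proof (rule idealI)
  note JD = ideal_inD[OF saturatedD(1)[OF J(1)]]
  show "ring R" by unfold_locales
  have cl: "x \<oplus> y \<in> ext J" if xy: "x \<in> ext J" "y \<in> ext J" for x y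
  proof -
    from xy obtain a s b t where *: "x \<in> carrier R" "y \<in> carrier R" "a \<in> J" "s \<in> A - m" "x \<otimes> h s = h a"
      "b \<in> J" "t \<in> A - m" "y \<otimes> h t = h b" by (auto simp: ext_def)
    have hc: "h s \<in> carrier R" "h t \<in> carrier R" using * h_closed by auto
    have "(x \<oplus> y) \<otimes> h (s * t) = h t \<otimes> (x \<otimes> h s) \<oplus> h s \<otimes> (y \<otimes> h t)"
    proof -
      have "(x \<oplus> y) \<otimes> (h s \<otimes> h t) = h t \<otimes> (x \<otimes> h s) \<oplus> h s \<otimes> (y \<otimes> h t)"
        using *(1,2) hc by algebra
      then show ?thesis using * by (simp add: h_mult)
    qed
    also have "\<dots> = h (t * a + s * b)" using * JD(1) by (simp add: h_add h_mult mult_mem subset_iff)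
    finally have "(x \<oplus> y) \<otimes> h (s * t) = h (t * a + s * b)" .
    moreover have "t * a + s * b \<in> J" using * by (intro JD(3) JD(4)) auto
    moreover have "s * t \<in> A - m" using * compl_mult by blast
    moreover have "x \<oplus> y \<in> carrier R" using * by simp
    ultimately show ?thesis unfolding ext_def by blast
  qed
  have mul: "x \<otimes> r \<in> ext J" if xr: "x \<in> ext J" "r \<in> carrier R" for x r
  proof -
    from xr obtain a s where *: "x \<in> carrier R" "a \<in> J" "s \<in> A - m" "x \<otimes> h s = h a" by (auto simp: ext_def)
    from h_surj[OF xr(2)] obtain b t where **: "b \<in> A" "t \<in> A - m" "r \<otimes> h t = h b" by blast
    have hc: "h s \<in> carrier R" "h t \<in> carrier R" using * ** h_closed by auto
    have "(x \<otimes> r) \<otimes> (h s \<otimes> h t) = (x \<otimes> h s) \<otimes> (r \<otimes> h t)" using *(1) xr(2) hc by algebra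
    also have "\<dots> = h (a * b)" using * ** JD(1) by (simp add: h_mult subset_iff)
    finally have "(x \<otimes> r) \<otimes> h (s * t) = h (a * b)" using * ** by (simp add: h_mult)
    moreover have "a * b \<in> J" using * ** JD(5) by blast
    moreover have "s * t \<in> A - m" using * ** compl_mult by blast
    moreover have "x \<otimes> r \<in> carrier R" using * xr by simp
    ultimately show ?thesis unfolding ext_def by blast
  qed
  show "x \<otimes> r \<in> ext J" "r \<otimes> x \<in> ext J" if "x \<in> ext J" "r \<in> carrier R" for x r
    using mul[OF that] that R.m_comm by (auto simp: ext_def)
  have "\<zero> \<in> ext J" using JD(2) compl_one h_0 h_closed one_mem by (force simp: ext_def)
  moreover have "\<ominus> x \<in> ext J" if "x \<in> ext J" for x
    using mul[OF that, of "\<ominus> \<one>"] that by (auto simp: ext_def R.r_minus)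
  ultimately show "subgroup (ext J) (add_monoid R)"
    using cl by (intro R.add.subgroupI) (auto simp: ext_def a_inv_def[symmetric])
qed

lemma ext_pre:
  assumes X: "ideal X R" shows "ext (pre X) = X"
proof -
  have "r \<in> ext (pre X) \<longleftrightarrow> r \<in> X" if r: "r \<in> carrier R" for r
  proof -
    from h_surj[OF r] obtain a s where "a \<in> A" "s \<in> A - m" "r \<otimes> h s = h a" by blast
    then show ?thesis
      using mem_ideal_iff[OF X r] mem_ideal_iff[OF ideal_ext[OF saturated_pre[OF X]] r]
        pre_ext[OF saturated_pre[OF X] G_sub_pre[OF X]] by blast
  qed
  then show ?thesis using ideal.Icarr[OF X] by (auto simp: ext_def)
qed

lemma pre_mono_strict: "ideal X R \<Longrightarrow> ideal Y R \<Longrightarrow> X \<subset> Y \<Longrightarrow> pre X \<subset> pre Y"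
proof -
  assume X: "ideal X R" and Y: "ideal Y R" and "X \<subset> Y"
  then have "pre X \<subseteq> pre Y" by (auto simp: pre_def)
  moreover have "pre X \<noteq> pre Y"
  proof
    assume "pre X = pre Y"
    then have "ext (pre X) = ext (pre Y)" by simp
    then show False using ext_pre[OF X] ext_pre[OF Y] \<open>X \<subset> Y\<close> by simp
  qed
  ultimately show ?thesis by blast
qed

lemma ext_mono_strict:
  "saturated J \<Longrightarrow> saturated K \<Longrightarrow> G \<subseteq> J \<Longrightarrow> J \<subset> K \<Longrightarrow> ext J \<subset> ext K"
proof -
  assume J: "saturated J" and K: "saturated K" and G: "G \<subseteq> J" and JK: "J \<subset> K"
  then have "ext J \<subseteq> ext K" by (auto simp: ext_def)
  moreover have "pre (ext K) = K" by (rule pre_ext[OF K]) (use G JK in blast)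
  then have "ext J \<noteq> ext K"
    using arg_cong[of "ext J" "ext K" pre] pre_ext[OF J G] JK by auto
  ultimately show ?thesis by blast
qed

lemma one_mem_ideal: "ideal X R \<Longrightarrow> \<one> \<in> X \<longleftrightarrow> 1 \<in> pre X"
  using one_mem h_one by (simp add: pre_def)

lemma prime_pre:
  assumes X: "primeideal X R" shows "prime_in A (pre X)" "pre X \<subseteq> m"
proof -
  interpret X: primeideal X R by fact
  have "\<one> \<notin> X" using X.I_notcarr X.one_imp_carrier by blast
  then have 1: "1 \<notin> pre X" using one_mem_ideal[OF X.is_ideal] by blast
  then show "pre X \<subseteq> m" using saturated_sub_m saturated_pre X.is_ideal by blast
  show "prime_in A (pre X)"
    unfolding prime_in_def
    using saturatedD(1)[OF saturated_pre[OF X.is_ideal]] 1 X.I_prime h_closed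
    by (auto simp: pre_def h_mult)
qed

lemma prime_saturated: "prime_in A P \<Longrightarrow> P \<subseteq> m \<Longrightarrow> saturated P"
  using prime_inD unfolding saturated_def by blast

lemma primeideal_ext:
  assumes P: "prime_in A P" "G \<subseteq> P" "P \<subseteq> m" shows "primeideal (ext P) R"
proof -
  note sat = prime_saturated[OF P(1,3)]
  note id = ideal_ext[OF sat]
  have pe: "pre (ext P) = P" by (rule pre_ext[OF sat P(2)])
  show ?thesis
  proof (rule primeidealI[OF id])
    show "cring R" by unfold_locales
    show "carrier R \<noteq> ext P"
      using one_mem_ideal[OF id] pe prime_inD(2)[OF P(1)] R.one_closed by blast
    fix x y assume xy: "x \<in> carrier R" "y \<in> carrier R" "x \<otimes> y \<in> ext P"
    from h_surj[OF xy(1)] h_surj[OF xy(2)] obtain a s b t where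
      *: "a \<in> A" "s \<in> A - m" "x \<otimes> h s = h a" "b \<in> A" "t \<in> A - m" "y \<otimes> h t = h b" by blast
    have hc: "h s \<in> carrier R" "h t \<in> carrier R" using * h_closed by auto
    have "(x \<otimes> y) \<otimes> (h s \<otimes> h t) = (x \<otimes> h s) \<otimes> (y \<otimes> h t)" using xy(1,2) hc by algebra
    then have "(x \<otimes> y) \<otimes> h (s * t) = h (a * b)" using * by (simp add: h_mult)
    then have "a * b \<in> P"
      using mem_ideal_iff[OF id _ _ compl_mult[OF *(2,5)], of "x \<otimes> y" "a * b"] xy * mult_mem pe by auto
    then show "x \<in> ext P \<or> y \<in> ext P"
      using prime_inD(3)[OF P(1)] * mem_ideal_iff[OF id xy(1) *(1-3)] mem_ideal_iff[OF id xy(2) *(4-6)] pe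
      by blast
  qed
qed

lemma ideal_sub_ext_m:
  assumes "ideal X R" "\<one> \<notin> X" shows "X \<subseteq> ext m"
proof -
  have "pre X \<subseteq> m" using saturated_sub_m[OF saturated_pre] one_mem_ideal assms by blast
  then have "ext (pre X) \<subseteq> ext m" by (auto simp: ext_def)
  then show ?thesis using ext_pre assms by blast
qed

section \<open>Dimension and depth of the localized quotient\<close>

lemma maximalideals: "{M. maximalideal M R} = {ext m}"
proof -
  have id: "ideal (ext m) R" by (rule ideal_ext[OF saturated_m])
  have one: "\<one> \<notin> ext m"
    using one_mem_ideal[OF id] pre_ext[OF saturated_m G_sub] prime_inD(2)[OF prime_m] by blast
  have "maximalideal (ext m) R"
  proof (rule maximalidealI[OF id])
    show "carrier R \<noteq> ext m" using one R.one_closed by blast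
    fix J assume J: "ideal J R" "ext m \<subseteq> J" "J \<subseteq> carrier R"
    show "J = ext m \<or> J = carrier R"
      using ideal_sub_ext_m[OF J(1)] ideal.one_imp_carrier[OF J(1)] J(2) by blast
  qed
  moreover have "M = ext m" if M: "maximalideal M R" for M
  proof -
    interpret M: maximalideal M R by fact
    have "\<one> \<notin> M" using M.I_notcarr M.one_imp_carrier by blast
    then show ?thesis
      using M.I_maximal[OF id ideal_sub_ext_m[OF M.is_ideal]] one R.one_closed ideal.Icarr[OF id] by blast
  qed
  ultimately show ?thesis by blast
qed

lemma krull_dim_eq: "krull_dim R = local_dim A m G"
proof -
  have "(\<exists>P. (\<forall>i\<le>k. primeideal (P i) R) \<and> (\<forall>i<k. P i \<subset> P (Suc i))) \<longleftrightarrow>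
    (\<exists>P. (\<forall>i\<le>k. prime_in A (P i) \<and> G \<subseteq> P i \<and> P i \<subseteq> m) \<and> (\<forall>i<k. P i \<subset> P (Suc i)))"
    (is "?L \<longleftrightarrow> ?R") for k :: nat
  proof
    assume ?L
    then obtain P where P: "\<forall>i\<le>k. primeideal (P i) R" "\<forall>i<k. P i \<subset> P (Suc i)" by blast
    have id: "ideal (P i) R" if "i \<le> k" for i using P that primeideal.axioms(1) by blast
    show ?R
      using P id prime_pre G_sub_pre pre_mono_strict by (intro exI[of _ "\<lambda>i. pre (P i)"]) auto
  next
    assume ?R
    then obtain P where P: "\<forall>i\<le>k. prime_in A (P i) \<and> G \<subseteq> P i \<and> P i \<subseteq> m" "\<forall>i<k. P i \<subset> P (Suc i)" by blast
    have "ext (P i) \<subset> ext (P (Suc i))" if "i < k" for i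
      using P that prime_saturated by (intro ext_mono_strict) auto
    then show ?L using P primeideal_ext by (intro exI[of _ "\<lambda>i. ext (P i)"]) auto
  qed
  then show ?thesis by (simp add: krull_dim_def local_dim_def)
qed

lemma pre_genideal:
  assumes "set gs \<subseteq> A" "list_all2 (\<lambda>x g. x \<in> carrier R \<and> (\<exists>s\<in>A - m. x \<otimes> h s = h g)) xs gs"
  shows "pre (Idl (set xs)) = loc (set gs \<union> G)"
proof
  have len: "length xs = length gs"
    and rel: "\<And>i. i < length gs \<Longrightarrow> xs ! i \<in> carrier R \<and> (\<exists>s\<in>A - m. xs ! i \<otimes> h s = h (gs ! i))"
    using assms(2) by (auto simp: list_all2_conv_all_nth)
  have xc: "set xs \<subseteq> carrier R" using len rel by (auto simp: in_set_conv_nth)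
  have GG: "set gs \<union> G \<subseteq> A" using assms(1) GA by auto
  note sat = saturated_loc[OF GG]
  note id = R.genideal_ideal[OF xc]
  note id' = ideal_ext[OF sat]
  have pe: "pre (ext (loc (set gs \<union> G))) = loc (set gs \<union> G)"
    using pre_ext[OF sat] loc_incl[OF GG] by blast
  have "x \<in> ext (loc (set gs \<union> G))" if "x \<in> set xs" for x
  proof -
    have "x \<in> set xs" by fact
    then obtain i where i: "i < length gs" "x = xs ! i" using len unfolding in_set_conv_nth by auto
    have "gs ! i \<in> loc (set gs \<union> G)" using loc_incl[OF GG] i(1) by auto
    then show ?thesis using rel[OF i(1)] unfolding i(2) ext_def by blast
  qed
  then have "Idl (set xs) \<subseteq> ext (loc (set gs \<union> G))" using R.genideal_minimal[OF id'] by blast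
  then have "pre (Idl (set xs)) \<subseteq> pre (ext (loc (set gs \<union> G)))" unfolding pre_def by blast
  then show "pre (Idl (set xs)) \<subseteq> loc (set gs \<union> G)" unfolding pe .
  have "g \<in> pre (Idl (set xs))" if "g \<in> set gs" for g
  proof -
    have "g \<in> set gs" by fact
    then obtain i where i: "i < length gs" "g = gs ! i" unfolding in_set_conv_nth by auto
    obtain s where s: "s \<in> A - m" "xs ! i \<otimes> h s = h g" using rel i by blast
    have "xs ! i \<in> Idl (set xs)" using R.genideal_self[OF xc] i len by auto
    moreover have "g \<in> A" "xs ! i \<in> carrier R" using assms(1) \<open>g \<in> set gs\<close> rel[OF i(1)] by auto
    ultimately show ?thesis using mem_ideal_iff[OF id _ _ s] by blast
  qed
  then show "loc (set gs \<union> G) \<subseteq> pre (Idl (set xs))"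
    using G_sub_pre[OF id] by (intro loc_least saturated_pre id) auto
qed

text \<open>Passing from \<open>x\<close> to a numerator \<open>g\<close> changes it by a unit and
  hence alters neither the generated ideals nor regularity. The properness clause holds because the
  sequence stays inside the maximal ideal.\<close>

lemma regular_sequence_iff:
  assumes gs: "set gs \<subseteq> A" and rel: "list_all2 (\<lambda>x g. x \<in> carrier R \<and> (\<exists>s\<in>A - m. x \<otimes> h s = h g)) xs gs"
  shows "regular_sequence R xs \<and> set xs \<subseteq> ext m \<longleftrightarrow> set gs \<subseteq> m \<and> regseq G gs"
proof -
  have len: "length xs = length gs"
    and nth: "\<And>i. i < length gs \<Longrightarrow> xs ! i \<in> carrier R \<and> (\<exists>s\<in>A - m. xs ! i \<otimes> h s = h (gs ! i))"
    using rel by (auto simp: list_all2_conv_all_nth)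
  have xc: "set xs \<subseteq> carrier R" using len nth by (auto simp: in_set_conv_nth)
  have idm: "ideal (ext m) R" by (rule ideal_ext[OF saturated_m])
  have sub_iff: "set xs \<subseteq> ext m \<longleftrightarrow> set gs \<subseteq> m"
  proof -
    have "xs ! i \<in> ext m \<longleftrightarrow> gs ! i \<in> m" if i: "i < length gs" for i
    proof -
      obtain s where s: "s \<in> A - m" "xs ! i \<otimes> h s = h (gs ! i)" using nth i by blast
      have "gs ! i \<in> A" using gs i by auto
      then show ?thesis using mem_ideal_iff[OF idm _ _ s] nth i pre_ext[OF saturated_m G_sub] by auto
    qed
    then have "list_all (\<lambda>x. x \<in> ext m) xs \<longleftrightarrow> list_all (\<lambda>g. g \<in> m) gs"
      by (simp add: list_all_length len)
    then show ?thesis unfolding list_all_iff by blast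
  qed
  have step: "(\<forall>a\<in>carrier R. xs ! i \<otimes> a \<in> Idl (set (take i xs)) \<longrightarrow> a \<in> Idl (set (take i xs))) \<longleftrightarrow>
      reg (set (take i gs) \<union> G) (gs ! i)" if i: "i < length gs" for i
  proof -
    let ?I = "Idl (set (take i xs))"
    have tk: "set (take i gs) \<subseteq> A" using gs set_take_subset by fastforce
    have "list_all2 (\<lambda>x g. x \<in> carrier R \<and> (\<exists>s\<in>A - m. x \<otimes> h s = h g)) (take i xs) (take i gs)"
      using rel by (rule list_all2_takeI)
    note pre = pre_genideal[OF tk this]
    have id: "ideal ?I R" using R.genideal_ideal xc set_take_subset by (metis order_trans)
    obtain s where s: "s \<in> A - m" "xs ! i \<otimes> h s = h (gs ! i)" using nth i by blast
    have g: "gs ! i \<in> A" "xs ! i \<in> carrier R" using gs i nth by auto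
    have hs: "h s \<in> carrier R" using s h_closed by auto
    have equiv: "(xs ! i \<otimes> r \<in> ?I \<longleftrightarrow> gs ! i * a \<in> loc (set (take i gs) \<union> G)) \<and>
        (r \<in> ?I \<longleftrightarrow> a \<in> loc (set (take i gs) \<union> G))"
      if r: "r \<in> carrier R" "a \<in> A" "t \<in> A - m" "r \<otimes> h t = h a" for r a t
    proof -
      have ht: "h t \<in> carrier R" using r h_closed by auto
      have "(xs ! i \<otimes> r) \<otimes> (h s \<otimes> h t) = (xs ! i \<otimes> h s) \<otimes> (r \<otimes> h t)" using g(2) r(1) hs ht by algebra
      then have "(xs ! i \<otimes> r) \<otimes> h (s * t) = h (gs ! i * a)" using s r g by (simp add: h_mult)
      then show ?thesis
        using mem_ideal_iff[OF id _ _ compl_mult[OF s(1) r(3)], of "xs ! i \<otimes> r" "gs ! i * a"]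
          mem_ideal_iff[OF id r] g r mult_mem pre by auto
    qed
    show ?thesis
    proof
      assume L: "\<forall>a\<in>carrier R. xs ! i \<otimes> a \<in> ?I \<longrightarrow> a \<in> ?I"
      show "reg (set (take i gs) \<union> G) (gs ! i)"
        unfolding reg_def
      proof (intro ballI impI)
        fix a assume a: "a \<in> A" "gs ! i * a \<in> loc (set (take i gs) \<union> G)"
        have "h a \<otimes> h 1 = h a" using a h_closed h_one by simp
        from equiv[OF h_closed[OF a(1)] a(1) compl_one this] L a h_closed
        show "a \<in> loc (set (take i gs) \<union> G)" by blast
      qed
    next
      assume R: "reg (set (take i gs) \<union> G) (gs ! i)"
      show "\<forall>a\<in>carrier R. xs ! i \<otimes> a \<in> ?I \<longrightarrow> a \<in> ?I"
      proof (intro ballI impI)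
        fix r assume r: "r \<in> carrier R" "xs ! i \<otimes> r \<in> ?I"
        obtain a t where "a \<in> A" "t \<in> A - m" "r \<otimes> h t = h a" using h_surj[OF r(1)] by blast
        from equiv[OF r(1) this] this r R show "r \<in> ?I" unfolding reg_def by blast
      qed
    qed
  qed
  have proper: "Idl (set xs) \<noteq> carrier R" if "set xs \<subseteq> ext m"
  proof -
    have "Idl (set xs) \<subseteq> ext m" using that R.genideal_minimal[OF idm] by blast
    moreover have "\<one> \<notin> ext m"
      using one_mem_ideal[OF idm] pre_ext[OF saturated_m G_sub] prime_inD(2)[OF prime_m] by blast
    ultimately show ?thesis using R.one_closed by blast
  qed
  show ?thesis
    unfolding regular_sequence_def regseq_iff_nth using sub_iff step proper xc len by auto
qed

lemma depth_eq: "depth R (ext m) = local_depth G"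
proof -
  have "{enat (length xs) | xs. regular_sequence R xs \<and> set xs \<subseteq> ext m} =
      {enat (length gs) | gs. set gs \<subseteq> m \<and> regseq G gs}" (is "?L = ?R")
  proof (intro equalityI subsetI)
    fix k assume "k \<in> ?L"
    then obtain xs where xs: "k = enat (length xs)" "regular_sequence R xs" "set xs \<subseteq> ext m" by blast
    define g where "g = (\<lambda>x. SOME a. a \<in> A \<and> (\<exists>s\<in>A - m. x \<otimes> h s = h a))"
    have g: "g x \<in> A \<and> (\<exists>s\<in>A - m. x \<otimes> h s = h (g x))" if "x \<in> carrier R" for x
      unfolding g_def by (rule someI_ex) (use h_surj[OF that] in blast)
    have c: "set xs \<subseteq> carrier R" using xs(3) by (auto simp: ext_def)
    have "set (map g xs) \<subseteq> A" using c g by auto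
    moreover have "list_all2 (\<lambda>x g. x \<in> carrier R \<and> (\<exists>s\<in>A - m. x \<otimes> h s = h g)) xs (map g xs)"
      unfolding list_all2_conv_all_nth
    proof (intro conjI allI impI)
      fix i assume "i < length xs"
      then have "xs ! i \<in> carrier R" "map g xs ! i = g (xs ! i)" using c nth_mem by auto
      then show "xs ! i \<in> carrier R" "\<exists>s\<in>A - m. xs ! i \<otimes> h s = h (map g xs ! i)" using g by auto
    qed simp
    ultimately have "set (map g xs) \<subseteq> m \<and> regseq G (map g xs)"
      using regular_sequence_iff[of "map g xs" xs] xs by blast
    then show "k \<in> ?R" using xs(1) by (intro CollectI exI[of _ "map g xs"]) auto
  next
    fix k assume "k \<in> ?R"
    then obtain gs where gs: "k = enat (length gs)" "set gs \<subseteq> m" "regseq G gs" by blast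
    have gA: "set gs \<subseteq> A" using gs(2) m_sub by blast
    have "list_all2 (\<lambda>x g. x \<in> carrier R \<and> (\<exists>s\<in>A - m. x \<otimes> h s = h g)) (map h gs) gs"
      unfolding list_all2_conv_all_nth
    proof (intro conjI allI impI)
      fix i assume "i < length (map h gs)"
      then have gi: "gs ! i \<in> A" "map h gs ! i = h (gs ! i)" using gA by auto
      then show "map h gs ! i \<in> carrier R" using h_closed by simp
      have "map h gs ! i \<otimes> h 1 = h (gs ! i)" using gi h_closed h_one by simp
      then show "\<exists>s\<in>A - m. map h gs ! i \<otimes> h s = h (gs ! i)" using compl_one by blast
    qed simp
    then have "regular_sequence R (map h gs) \<and> set (map h gs) \<subseteq> ext m"
      using regular_sequence_iff[OF gA] gs by blast
    then show "k \<in> ?L" using gs(1) by (intro CollectI exI[of _ "map h gs"]) auto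
  qed
  then show ?thesis by (simp add: depth_def local_depth_def)
qed

lemma cohen_macaulay_local_iff:
  assumes "noetherian_in A"
  shows "cohen_macaulay_local_ring R \<longleftrightarrow> local_depth G = local_dim A m G"
proof -
  have "noetherian_ring R"
  proof (rule R.noetherian_ring_of_surjection[OF subring1_axioms assms h_closed h_add h_mult h_0])
    fix r assume "r \<in> carrier R"
    then obtain a s where "a \<in> A" "s \<in> A - m" "r \<otimes> h s = h a" using h_surj by blast
    then show "\<exists>a\<in>A. \<exists>w\<in>Units R. r \<otimes> w = h a" using h_unit by blast
  qed
  then show ?thesis
    unfolding cohen_macaulay_local_ring_def maximalideals
    using depth_eq krull_dim_eq R.is_cring by auto
qed

end

subsection \<open>Quotients of the polynomial ring\<close>

lemma cring_poly_ring: "cring (poly_ring n :: ('k::field) polynomial ring)"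
proof (rule cringI)
  let ?S = "poly_ring n :: 'k polynomial ring"
  have c: "carrier ?S = polys {1..n}" by (rule carrier_poly_ring)
  have o: "x \<otimes>\<^bsub>?S\<^esub> y = x * y" "x \<oplus>\<^bsub>?S\<^esub> y = x + y" "\<one>\<^bsub>?S\<^esub> = 1" "\<zero>\<^bsub>?S\<^esub> = 0" for x y
    by (simp_all add: poly_ring_def)
  show "abelian_group ?S"
    by (rule abelian_groupI)
      (auto simp: c o polys.add_mem polys.zero_mem algebra_simps intro!: bexI[of _ "- _"] polys.uminus_mem)
  show "comm_monoid ?S"
    by (rule comm_monoidI) (auto simp: c o polys.mult_mem polys.one_mem algebra_simps)
  show "(x \<oplus>\<^bsub>?S\<^esub> y) \<otimes>\<^bsub>?S\<^esub> z = x \<otimes>\<^bsub>?S\<^esub> z \<oplus>\<^bsub>?S\<^esub> y \<otimes>\<^bsub>?S\<^esub> z" for x y z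
    by (simp add: o algebra_simps)
qed

lemma poly_ring_simps:
  "x \<otimes>\<^bsub>poly_ring n\<^esub> y = x * y" "x \<oplus>\<^bsub>poly_ring n\<^esub> y = x + y"
  "\<one>\<^bsub>poly_ring n\<^esub> = 1" "\<zero>\<^bsub>poly_ring n\<^esub> = 0"
  by (simp_all add: poly_ring_def)

lemma ideal_poly_ring_iff:
  "ideal J (poly_ring n) \<longleftrightarrow> ideal_in (polys {1..n} :: ('k::field) polynomial set) J"
proof
  let ?S = "poly_ring n :: 'k polynomial ring"
  interpret S: cring ?S by (rule cring_poly_ring)
  show "ideal J ?S" if J: "ideal_in (polys {1..n}) J"
  proof (rule idealI)
    note D = ideal_inD[OF J]
    show "ring ?S" by unfold_locales
    have inv: "\<ominus>\<^bsub>?S\<^esub> x = - x" if "x \<in> J" for x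
      by (rule S.minus_equality)
        (use that D(1) polys.uminus_mem in \<open>auto simp: poly_ring_simps carrier_poly_ring\<close>)
    show "subgroup J (add_monoid ?S)"
      using D polys.ideal_in_uminus[OF J]
      by (intro S.add.subgroupI)
        (auto simp: poly_ring_simps carrier_poly_ring a_inv_def[symmetric] inv)
  qed (use ideal_inD[OF J] in \<open>auto simp: poly_ring_simps carrier_poly_ring\<close>)
  show "ideal_in (polys {1..n}) J" if J: "ideal J ?S"
  proof -
    interpret J: ideal J ?S by fact
    show ?thesis
      unfolding ideal_in_def
      using J.Icarr J.zero_closed J.a_closed J.I_l_closed
      by (auto simp: poly_ring_simps carrier_poly_ring)
  qed
qed

lemma Idl_poly_ring: "Idl\<^bsub>poly_ring n\<^esub> G = ideal_gen (polys {1..n} :: ('k::field) polynomial set) G"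
  by (simp add: genideal_def ideal_gen_def ideal_poly_ring_iff)

locale quotient_setup =
  fixes n :: nat and G :: "('k::field) polynomial set"
  assumes G_polys: "G \<subseteq> polys {1..n}"
begin

abbreviation "S \<equiv> (poly_ring n :: 'k polynomial ring)"
abbreviation "A \<equiv> (polys {1..n} :: 'k polynomial set)"
abbreviation "I \<equiv> ideal_gen A G"
abbreviation "Q \<equiv> S Quot I"
abbreviation "\<rho> \<equiv> (\<lambda>a. I +>\<^bsub>S\<^esub> a)"

lemma ideal_I: "ideal I S"
  by (simp add: ideal_poly_ring_iff polys.ideal_gen_ideal[OF G_polys])

sublocale S: cring S by (rule cring_poly_ring)
sublocale I: ideal I S by (rule ideal_I)
sublocale Q: cring Q by (rule I.quotient_is_cring[OF cring_poly_ring])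

lemma \<rho>_simps:
  assumes "a \<in> A" "b \<in> A"
  shows "\<rho> a \<in> carrier Q" "\<rho> (a + b) = \<rho> a \<oplus>\<^bsub>Q\<^esub> \<rho> b" "\<rho> (a * b) = \<rho> a \<otimes>\<^bsub>Q\<^esub> \<rho> b"
  using ring_hom_closed[OF I.rcos_ring_hom, of a] ring_hom_add[OF I.rcos_ring_hom, of a b]
    ring_hom_mult[OF I.rcos_ring_hom, of a b] assms
  by (simp_all add: poly_ring_simps carrier_poly_ring)

lemma \<rho>_one: "\<rho> 1 = \<one>\<^bsub>Q\<^esub>"
  using ring_hom_one[OF I.rcos_ring_hom] by (simp add: poly_ring_simps)

lemma carrier_Q: "carrier Q = \<rho> ` A"
  by (auto simp: FactRing_def A_RCOSETS_def' carrier_poly_ring)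

lemma \<rho>_zero_iff: "a \<in> A \<Longrightarrow> \<rho> a = \<zero>\<^bsub>Q\<^esub> \<longleftrightarrow> a \<in> I"
  using I.rcos_const_imp_mem[of a] S.a_rcos_zero[OF ideal_I, of a]
  by (auto simp: FactRing_def carrier_poly_ring)

lemma ideal_in_preimage:
  assumes "ideal J Q" shows "ideal_in A {a \<in> A. \<rho> a \<in> J}"
proof -
  interpret J: ideal J Q by fact
  have "\<rho> 0 = \<zero>\<^bsub>Q\<^esub>"
    using \<rho>_zero_iff[OF polys.zero_mem] ideal_inD(2)[OF polys.ideal_gen_ideal[OF G_polys]] by blast
  then show ?thesis
    unfolding ideal_in_def
    using \<rho>_simps J.zero_closed J.a_closed J.I_l_closed polys.zero_mem
    by (auto simp: polys.add_mem polys.mult_mem)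
qed

lemma noetherian_Q: "noetherian_ring Q"
proof (rule Q.noetherian_ring_of_surjection[of A \<rho>])
  show "subring1 A" by unfold_locales
  show "noetherian_in A" by (rule noetherian_polys) simp
  show "\<rho> 0 = \<zero>\<^bsub>Q\<^esub>"
    using \<rho>_zero_iff[OF polys.zero_mem] ideal_inD(2)[OF polys.ideal_gen_ideal[OF G_polys]] by blast
  fix r assume r: "r \<in> carrier Q"
  then obtain a where "a \<in> A" "r = \<rho> a" by (auto simp: carrier_Q)
  moreover have "r \<otimes>\<^bsub>Q\<^esub> \<one>\<^bsub>Q\<^esub> = r" using r by simp
  ultimately show "\<exists>a\<in>A. \<exists>w\<in>Units Q. r \<otimes>\<^bsub>Q\<^esub> w = \<rho> a" using Q.Units_one_closed by metis
qed (use \<rho>_simps in auto)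

text \<open>Localizing the quotient at \<open>m'\<close> agrees with localizing \<open>A\<close> at
  the preimage \<open>m\<close> and dividing by \<open>G\<close>: numerators and denominators are
  represented in \<open>A\<close>, the latter outside \<open>m\<close>.\<close>

lemma local_quotient_localization:
  fixes m'
  assumes m': "primeideal m' Q"
  defines "m \<equiv> {a \<in> A. \<rho> a \<in> m'}" and "T \<equiv> carrier Q - m'"
  shows "local_quotient A m (localization Q T) (\<lambda>a. fraction Q T (\<rho> a) \<one>\<^bsub>Q\<^esub>) G"
proof -
  interpret m': primeideal m' Q by fact
  have one: "\<one>\<^bsub>Q\<^esub> \<notin> m'" using m'.I_notcarr m'.one_imp_carrier by blast
  interpret L: mult_subset Q T
    by unfold_locales (use one m'.I_prime in \<open>auto simp: T_def\<close>)
  let ?L = "localization Q T"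
  let ?h = "\<lambda>a. fraction Q T (\<rho> a) \<one>\<^bsub>Q\<^esub>"
  have pm: "prime_in A m"
    unfolding prime_in_def
  proof (intro conjI ballI impI)
    show "ideal_in A m" unfolding m_def by (rule ideal_in_preimage[OF m'.is_ideal])
    show "1 \<notin> m" using one \<rho>_one by (simp add: m_def)
    fix a b assume "a \<in> A" "b \<in> A" "a * b \<in> m"
    then show "a \<in> m \<or> b \<in> m" using m'.I_prime[of "\<rho> a" "\<rho> b"] \<rho>_simps by (auto simp: m_def)
  qed
  interpret local_subring A m by unfold_locales (rule pm)
  interpret L': cring ?L by (rule L.cring_localization)
  have \<rho>T: "\<rho> s \<in> T" if "s \<in> A - m" for s
    using that \<rho>_simps(1)[of s s] by (auto simp: m_def T_def)
  have T\<rho>: "\<exists>s\<in>A - m. t = \<rho> s" if "t \<in> T" for t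
    using that unfolding T_def carrier_Q m_def by blast
  have closed: "?h a \<in> carrier ?L" if "a \<in> A" for a
    using L.fraction_in_carrier L.T_one \<rho>_simps(1)[of a a] that by simp
  have mult: "?h (a * b) = ?h a \<otimes>\<^bsub>?L\<^esub> ?h b" if "a \<in> A" "b \<in> A" for a b
    using L.mult_fraction[of "\<rho> a" "\<one>\<^bsub>Q\<^esub>" "\<rho> b" "\<one>\<^bsub>Q\<^esub>"] \<rho>_simps[of a b] \<rho>_simps[of b a] that L.T_one by simp
  have add: "?h (a + b) = ?h a \<oplus>\<^bsub>?L\<^esub> ?h b" if "a \<in> A" "b \<in> A" for a b
    using L.add_fraction[of "\<rho> a" "\<one>\<^bsub>Q\<^esub>" "\<rho> b" "\<one>\<^bsub>Q\<^esub>"] \<rho>_simps[of a b] \<rho>_simps[of b a] that L.T_one by simp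
  have unit: "?h s \<in> Units ?L" if s: "s \<in> A - m" for s
  proof -
    let ?x = "fraction Q T \<one>\<^bsub>Q\<^esub> (\<rho> s)"
    have sQ: "\<rho> s \<in> carrier Q" using \<rho>_simps(1)[of s s] s by auto
    have x: "?x \<in> carrier ?L" by (rule L.fraction_in_carrier) (use \<rho>T[OF s] in auto)
    have "?h s \<otimes>\<^bsub>?L\<^esub> ?x = fraction Q T (\<rho> s \<otimes>\<^bsub>Q\<^esub> \<one>\<^bsub>Q\<^esub>) (\<one>\<^bsub>Q\<^esub> \<otimes>\<^bsub>Q\<^esub> \<rho> s)"
      by (rule L.mult_fraction) (use sQ \<rho>T[OF s] L.T_one in auto)
    also have "\<dots> = \<one>\<^bsub>?L\<^esub>"
      unfolding L.one_localization
      by (rule L.fraction_eqI) (use sQ \<rho>T[OF s] L.T_one in auto)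
    finally have "?h s \<otimes>\<^bsub>?L\<^esub> ?x = \<one>\<^bsub>?L\<^esub>" .
    moreover have "?x \<otimes>\<^bsub>?L\<^esub> ?h s = \<one>\<^bsub>?L\<^esub>"
      using calculation L'.m_comm[OF x closed] s by auto
    ultimately show ?thesis using x closed s unfolding Units_def by blast
  qed
  have surj: "\<exists>a\<in>A. \<exists>s\<in>A - m. r \<otimes>\<^bsub>?L\<^esub> ?h s = ?h a" if r: "r \<in> carrier ?L" for r
  proof -
    obtain q t where q: "q \<in> carrier Q" "t \<in> T" "r = fraction Q T q t" using L.localization_cases[OF r] .
    obtain a where a: "a \<in> A" "q = \<rho> a" using q(1) by (auto simp: carrier_Q)
    obtain s where s: "s \<in> A - m" "t = \<rho> s" using T\<rho>[OF q(2)] by blast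
    have tQ: "t \<in> carrier Q" by (rule L.T_closed[OF q(2)])
    have "r \<otimes>\<^bsub>?L\<^esub> ?h s = fraction Q T (q \<otimes>\<^bsub>Q\<^esub> t) (t \<otimes>\<^bsub>Q\<^esub> \<one>\<^bsub>Q\<^esub>)"
      unfolding q(3) s(2)[symmetric] by (rule L.mult_fraction) (use q tQ L.T_one in auto)
    also have "\<dots> = fraction Q T q \<one>\<^bsub>Q\<^esub>"
      by (rule L.fraction_eqI) (use q tQ L.T_one in auto)
    finally show ?thesis using a s by blast
  qed
  have zero: "?h a = \<zero>\<^bsub>?L\<^esub> \<longleftrightarrow> a \<in> loc G" if a: "a \<in> A" for a
  proof -
    have aQ: "\<rho> a \<in> carrier Q" using \<rho>_simps(1)[of a a] a by auto
    have "?h a = \<zero>\<^bsub>?L\<^esub> \<longleftrightarrow> (\<exists>w\<in>T. w \<otimes>\<^bsub>Q\<^esub> (\<rho> a \<otimes>\<^bsub>Q\<^esub> \<one>\<^bsub>Q\<^esub> \<ominus>\<^bsub>Q\<^esub> \<zero>\<^bsub>Q\<^esub> \<otimes>\<^bsub>Q\<^esub> \<one>\<^bsub>Q\<^esub>) = \<zero>\<^bsub>Q\<^esub>)"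
      unfolding L.zero_localization by (rule L.fraction_eq_iff) (use aQ L.T_one in auto)
    also have "\<dots> \<longleftrightarrow> (\<exists>w\<in>T. w \<otimes>\<^bsub>Q\<^esub> \<rho> a = \<zero>\<^bsub>Q\<^esub>)" using aQ by (simp add: Q.minus_eq)
    also have "\<dots> \<longleftrightarrow> (\<exists>s\<in>A - m. \<rho> s \<otimes>\<^bsub>Q\<^esub> \<rho> a = \<zero>\<^bsub>Q\<^esub>)" using \<rho>T T\<rho> by metis
    also have "\<dots> \<longleftrightarrow> (\<exists>s\<in>A - m. s * a \<in> I)"
      using \<rho>_simps(3)[OF _ a] \<rho>_zero_iff[OF polys.mult_mem[OF _ a]] by auto
    finally show ?thesis using a by (simp add: loc_def)
  qed
  have GI: "G \<subseteq> m"
  proof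
    fix g assume g: "g \<in> G"
    then have gA: "g \<in> A" and "g \<in> I" using G_polys polys.ideal_gen_incl by blast+
    then have "\<rho> g = \<zero>\<^bsub>Q\<^esub>" using \<rho>_zero_iff by blast
    then show "g \<in> m" using gA m'.zero_closed by (simp add: m_def)
  qed
  show ?thesis
    by unfold_locales
      (use GI closed add mult unit surj zero \<rho>_one in \<open>auto simp: L.one_localization\<close>)
qed

text \<open>The preimage of a maximal ideal of the quotient is a prime containing \<open>G\<close>,
  and its localization is compared there.\<close>

lemma cohen_macaulay_idealI:
  assumes "\<And>m. prime_in A m \<Longrightarrow> G \<subseteq> m \<Longrightarrow> local_subring.local_depth A m G = local_dim A m G"
  shows "cohen_macaulay_ideal S I"
  unfolding cohen_macaulay_ideal_def cohen_macaulay_ring_def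
proof (intro conjI allI impI Q.is_cring noetherian_Q)
  fix m' assume "maximalideal m' Q"
  then have "primeideal m' Q" by (rule Q.maximalideal_prime)
  then interpret L: local_quotient A "{a \<in> A. \<rho> a \<in> m'}" "localization Q (carrier Q - m')"
      "\<lambda>a. fraction Q (carrier Q - m') (\<rho> a) \<one>\<^bsub>Q\<^esub>" G
    by (rule local_quotient_localization)
  show "cohen_macaulay_local_ring (localization Q (carrier Q - m'))"
    using L.cohen_macaulay_local_iff noetherian_polys[of "{1..n}"] assms[OF L.prime_m L.G_sub] by simp
qed

text \<open>An element outside the ideal of all variables has a nonzero constant term, and
  subtracting its remaining terms leaves a unit in \<open>J\<close>.\<close>

lemma maximal_origin:
  assumes J: "ideal_in A J" and sub: "var_ideal {1..n} {1..n} \<subset> J"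
  shows "J = A"
proof -
  note D = ideal_inD[OF J]
  let ?r = "mfilter (\<lambda>m. pkeys m \<inter> {1..n} = {})"
  obtain f where f: "f \<in> J" "f \<notin> var_ideal {1..n} {1..n}" using sub by blast
  have fA: "f \<in> A" using f D by blast
  have "?r f \<in> polys ({1..n} - {1..n})" by (rule mfilter_in_polys[OF fA])
  then obtain c where c: "?r f = psingle 0 c" by (auto simp: polys_empty)
  have "c \<noteq> 0" using f(2) fA c by (auto simp: var_ideal_def)
  have "f - ?r f \<in> J" using diff_mfilter_in_var_ideal[OF fA] sub by blast
  then have "f - (f - ?r f) \<in> J" using polys.ideal_in_diff[OF J] f by blast
  then have "psingle 0 (inverse c) * psingle 0 c \<in> J" using c D(4) by (auto intro!: D(4) single_in_polys)
  then have "1 \<in> J" unfolding const_inverse[OF \<open>c \<noteq> 0\<close>] .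
  then show ?thesis using D(1) D(4)[of _ 1] by auto
qed

text \<open>The origin contains \<open>I\<close>, so its image in the quotient is a maximal ideal
  whose preimage is again the origin.\<close>

lemma cohen_macaulay_ideal_origin:
  assumes cm: "cohen_macaulay_ideal S I" and G0: "G \<subseteq> var_ideal {1..n} {1..n}"
  shows "local_subring.local_depth A (var_ideal {1..n} {1..n}) G =
    local_dim A (var_ideal {1..n} {1..n}) G"
proof -
  let ?m = "var_ideal {1..n} {1..n} :: 'k polynomial set"
  have pm: "prime_in A ?m" by (rule prime_var_ideal)
  note mid = prime_inD(1)[OF pm]
  note mD = ideal_inD[OF mid]
  have Im: "I \<subseteq> ?m" using polys.ideal_gen_least[OF mid G0] .
  define m' where "m' = \<rho> ` ?m"
  have pre: "{a \<in> A. \<rho> a \<in> m'} = ?m"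
  proof (intro equalityI subsetI)
    fix a assume "a \<in> {a \<in> A. \<rho> a \<in> m'}"
    then obtain b where ab: "a \<in> A" "b \<in> ?m" "\<rho> a = \<rho> b" by (auto simp: m'_def)
    have bA: "b \<in> A" using ab mD(1) by blast
    have nb: "- b \<in> A" using bA polys.uminus_mem by blast
    have "\<rho> (a + - b) = \<rho> (b + - b)"
      using \<rho>_simps(2)[OF ab(1) nb] \<rho>_simps(2)[OF bA nb] ab(3) by simp
    also have "\<rho> (b + - b) = \<zero>\<^bsub>Q\<^esub>"
      using \<rho>_zero_iff[OF polys.zero_mem] ideal_inD(2)[OF polys.ideal_gen_ideal[OF G_polys]] by simp
    finally have "a + - b \<in> I" using \<rho>_zero_iff polys.add_mem[OF ab(1) nb] by blast
    then have "a + - b + b \<in> ?m" using Im ab mD(3) by blast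
    then show "a \<in> ?m" by simp
  qed (use mD(1) in \<open>auto simp: m'_def\<close>)
  have idm': "ideal m' Q"
    unfolding m'_def
    by (rule S.ring_ideal_imp_quot_ideal[OF ideal_I]) (use mid in \<open>simp add: ideal_poly_ring_iff\<close>)
  have max: "maximalideal m' Q"
  proof (rule maximalidealI[OF idm'])
    have "1 \<notin> ?m" using prime_inD(2)[OF pm] .
    then have "\<one>\<^bsub>Q\<^esub> \<notin> m'" using pre \<rho>_one polys.one_mem by (metis (no_types, lifting) mem_Collect_eq)
    then show "carrier Q \<noteq> m'" using Q.one_closed by blast
    fix J assume J: "ideal J Q" "m' \<subseteq> J" "J \<subseteq> carrier Q"
    have "?m \<subseteq> {a \<in> A. \<rho> a \<in> J}" using J(2) pre by blast
    then consider "?m = {a \<in> A. \<rho> a \<in> J}" | "{a \<in> A. \<rho> a \<in> J} = A"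
      using maximal_origin[OF ideal_in_preimage[OF J(1)]] by blast
    then show "J = m' \<or> J = carrier Q"
    proof cases
      case 1
      then show ?thesis using J carrier_Q by (auto simp: m'_def)
    next
      case 2
      then show ?thesis using J carrier_Q by auto
    qed
  qed
  have "primeideal m' Q" by (rule Q.maximalideal_prime[OF max])
  then interpret L: local_quotient A ?m "localization Q (carrier Q - m')"
      "\<lambda>a. fraction Q (carrier Q - m') (\<rho> a) \<one>\<^bsub>Q\<^esub>" G
    using local_quotient_localization[of m'] unfolding pre by blast
  show ?thesis
    using cm max L.cohen_macaulay_local_iff noetherian_polys[of "{1..n}"]
    unfolding cohen_macaulay_ideal_def cohen_macaulay_ring_def by simp
qed

end

section \<open>Depth and dimension of squarefree monomial ideals\<close>

lemma prod_var: "finite X \<Longrightarrow> prod var X = (mon (\<Sum>i\<in>X. psingle i 1) :: ('k::field) polynomial)"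
  by (induction X rule: finite_induct) (auto simp: mult_single)

lemma lookup_sum_single: "finite X \<Longrightarrow> plookup (\<Sum>i\<in>X. psingle i (1::nat)) v = (if v \<in> X then 1 else 0)"
  by (simp add: lookup_sum lookup_single when_def)

text \<open>The squarefree monomials \<open>W\<close> in the variables \<open>V\<close> are the edges of a hypergraph.\<close>

definition minimal_cover :: "nat set \<Rightarrow> monomial set \<Rightarrow> nat set \<Rightarrow> bool" where
  "minimal_cover V W C \<longleftrightarrow> (\<forall>w\<in>W. pkeys w \<subseteq> V \<and> (\<forall>v. plookup w v \<le> 1)) \<and> C \<subseteq> V \<and>
     (\<forall>w\<in>W. pkeys w \<inter> C \<noteq> {}) \<and> (\<forall>c\<in>C. \<exists>w\<in>W. pkeys w \<inter> C = {c})"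

lemma minimal_coverD:
  assumes "minimal_cover V W C"
  shows "\<And>w. w \<in> W \<Longrightarrow> pkeys w \<subseteq> V" "\<And>w v. w \<in> W \<Longrightarrow> plookup w v \<le> 1" "C \<subseteq> V"
    "\<And>w. w \<in> W \<Longrightarrow> pkeys w \<inter> C \<noteq> {}" "\<And>c. c \<in> C \<Longrightarrow> \<exists>w\<in>W. pkeys w \<inter> C = {c}"
  using assms by (auto simp: minimal_cover_def)

lemma mons_sub_var_ideal:
  assumes "\<And>w. w \<in> W \<Longrightarrow> pkeys w \<subseteq> V" "\<And>w. w \<in> W \<Longrightarrow> pkeys w \<inter> C \<noteq> {}"
  shows "mon ` W \<subseteq> var_ideal V C"
  using assms by (auto simp: mon_in_var_ideal_iff)

lemma prime_contains_var:
  fixes P :: "('k::field) polynomial set"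
  assumes P: "prime_in (polys V) P" and X: "finite X" "prod var X \<in> P" "X \<subseteq> V"
  shows "\<exists>a\<in>X. var a \<in> P"
  using X
proof (induction X rule: finite_induct)
  case empty
  then show ?case using prime_inD(2)[OF P] by simp
next
  case (insert x X)
  have "var x * prod var X \<in> P" using insert by simp
  moreover have "prod var X \<in> (polys V :: 'k polynomial set)" "var x \<in> (polys V :: 'k polynomial set)"
    using insert.prems by (auto intro!: polys.prod_mem var_in_polys)
  ultimately have "var x \<in> P \<or> prod var X \<in> P" using prime_inD(3)[OF P] by blast
  then show ?case using insert by auto
qed

section \<open>Depth bounds from covers, and regular sequences modulo two coprime products\<close>

context poly_local
begin

text \<open>The witness is the product of the variables outside \<open>C\<close>.\<close>

lemma minimal_cover_associated:
  assumes V: "finite V" and cover: "minimal_cover V W C" and m: "var_ideal V C \<subseteq> m"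
  shows "\<exists>a\<in>polys V. {b \<in> polys V. a * b \<in> loc (mon ` W)} = var_ideal V C"
proof -
  note W = minimal_coverD(1,2)[OF cover] and C = minimal_coverD(3,4)[OF cover]
    and min = minimal_coverD(5)[OF cover]
  define \<alpha> :: monomial where "\<alpha> = (\<Sum>i\<in>V - C. psingle i 1)"
  have lookup_\<alpha>: "plookup \<alpha> v = (if v \<in> V - C then 1 else 0)" for v
    unfolding \<alpha>_def lookup_sum lookup_single when_def using V by simp
  have keys_\<alpha>: "pkeys \<alpha> = V - C" by (auto simp: in_keys_iff lookup_\<alpha> split: if_splits)
  have \<alpha>A: "mon \<alpha> \<in> polys V" by (rule single_in_polys) (auto simp: keys_\<alpha>)
  have GA: "mon ` W \<subseteq> polys V" using W(1) single_in_polys by blast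
  note pr = prime_var_ideal[of V C, where ?'k = 'k]
  have "{b \<in> polys V. mon \<alpha> * b \<in> loc (mon ` W)} = var_ideal V C"
  proof
    have "mon \<alpha> * var c \<in> loc (mon ` W)" if c: "c \<in> C" for c
    proof -
      obtain w where w: "w \<in> W" "pkeys w \<inter> C = {c}" using min[OF c] by blast
      \<comment> \<open>The edge \<open>w\<close> is squarefree and meets \<open>C\<close> only in
        \<open>c\<close>, so it divides the product of \<open>x_c\<close> and the variables outside
        \<open>C\<close>.\<close>
      have "plookup w v \<le> plookup (\<alpha> + psingle c 1) v" for v
      proof (cases "v \<in> pkeys w")
        case True
        then have "v \<in> V - C \<or> v = c" using w W(1) by blast
        then show ?thesis using W(2)[OF w(1), of v] by (auto simp: lookup_add lookup_\<alpha> lookup_single)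
      qed (simp add: in_keys_iff)
      then have "\<alpha> + psingle c 1 = (\<alpha> + psingle c 1 - w) + w"
        by (intro poly_mapping_eqI) (simp add: lookup_add lookup_minus)
      then have eq: "mon \<alpha> * var c = (mon (\<alpha> + psingle c 1 - w) * mon w :: 'k polynomial)"
        by (simp add: mult_single)
      have "pkeys (\<alpha> + psingle c 1 - w) \<subseteq> pkeys (\<alpha> + psingle c 1)"
        by (auto simp: in_keys_iff lookup_minus)
      also have "\<dots> \<subseteq> V" using c C(1) by (auto simp: keys_add_nat keys_\<alpha>)
      finally have "mon (\<alpha> + psingle c 1 - w) \<in> polys V" by (rule single_in_polys)
      moreover have "mon w \<in> loc (mon ` W)" using loc_incl[OF GA] w by blast
      ultimately show ?thesis unfolding eq by (rule ideal_inD(4)[OF loc_ideal[OF GA]])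
    qed
    then show "var_ideal V C \<subseteq> {b \<in> polys V. mon \<alpha> * b \<in> loc (mon ` W)}"
      using C(1) var_in_polys
      by (intro var_ideal_least polys.ideal_in_colon loc_ideal[OF GA] \<alpha>A) auto
    show "{b \<in> polys V. mon \<alpha> * b \<in> loc (mon ` W)} \<subseteq> var_ideal V C"
    proof
      fix b assume "b \<in> {b \<in> polys V. mon \<alpha> * b \<in> loc (mon ` W)}"
      then obtain s where s: "b \<in> polys V" "s \<in> polys V - m" "s * (mon \<alpha> * b) \<in> ideal_gen (polys V) (mon ` W)"
        by (auto simp: loc_def)
      have "ideal_gen (polys V) (mon ` W) \<subseteq> var_ideal V C"
        by (rule polys.ideal_gen_least[OF prime_inD(1)[OF prime_var_ideal] mons_sub_var_ideal[OF W(1) C(2)]])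
      then have "s * (mon \<alpha> * b) \<in> var_ideal V C" using s by blast
      moreover have "s \<notin> var_ideal V C" using s m by blast
      moreover have "mon \<alpha> \<notin> (var_ideal V C :: 'k polynomial set)"
        using mon_in_var_ideal_iff[of \<alpha> V C] keys_\<alpha> by auto
      ultimately show "b \<in> var_ideal V C"
        using prime_inD(3)[OF pr] s \<alpha>A polys.mult_mem by blast
    qed
  qed
  then show ?thesis using \<alpha>A by blast
qed

lemma minimal_cover_chain:
  assumes V: "finite V" and cover: "minimal_cover V W C" and m: "var_ideal V C \<subseteq> m"
    and gs: "set gs \<subseteq> m" "regseq (mon ` W) gs"
  shows "\<exists>P. P 0 = var_ideal V C \<and> (\<forall>i\<le>length gs. prime_in (polys V) (P i) \<and> P i \<subseteq> m \<and> mon ` W \<subseteq> P i) \<and>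
    (\<forall>i<length gs. P i \<subset> P (Suc i))"
proof -
  obtain a where a: "a \<in> polys V" "{b \<in> polys V. a * b \<in> loc (mon ` W)} = var_ideal V C"
    using minimal_cover_associated[OF V cover m] by blast
  have "mon ` W \<subseteq> var_ideal V C" by (rule mons_sub_var_ideal[OF minimal_coverD(1,4)[OF cover]])
  then have "mon ` W \<subseteq> m" using m by blast
  then show ?thesis
    using associated_prime_chain[OF noetherian_polys[OF V] _ a(1) _ gs] prime_var_ideal
    unfolding a(2) by blast
qed

text \<open>A regular sequence yields a chain of primes of the same length that starts at
  \<open>var_ideal V C\<close> and stays inside \<open>m\<close>. So \<open>C\<close> is available
  at its bottom and \<open>Y\<close> at its top, as \<open>prime_chain_bound\<close>
  requires.\<close>

lemma minimal_cover_depth_bound: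
  assumes V: "finite V" and cover: "minimal_cover V W C" and m: "var_ideal V C \<subseteq> m"
    and gs: "set gs \<subseteq> m" "regseq (mon ` W) gs" and Y: "Y \<subseteq> V" "m \<inter> polys Y \<subseteq> {0}"
  shows "length gs + card Y + card C \<le> card V"
proof -
  note C = minimal_coverD(3)[OF cover]
  from minimal_cover_chain[OF V cover m gs] obtain P where P: "P 0 = var_ideal V C"
      "\<forall>i\<le>length gs. prime_in (polys V) (P i) \<and> P i \<subseteq> m \<and> mon ` W \<subseteq> P i"
      "\<forall>i<length gs. P i \<subset> P (Suc i)"
    by (elim exE conjE)
  have "P (length gs) \<inter> polys Y \<subseteq> {0}" using P(2) Y(2) by blast
  moreover have "var c \<in> P 0" if "c \<in> C" for c
    unfolding P(1) using that C by (subst var_in_var_ideal_iff) auto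
  moreover have "\<And>i. i \<le> length gs \<Longrightarrow> prime_in (polys V) (P i)" using P(2) by blast
  ultimately show ?thesis using P(3) V C Y(1) by (intro prime_chain_bound) auto
qed

text \<open>Each difference is monic and linear in its own variable \<open>a\<close>, which occurs
  neither in \<open>H\<close> nor in the differences before it.\<close>

lemma regseq_differences:
  assumes "distinct as" "set as \<subseteq> V" "a0 \<in> V" "a0 \<notin> set as" "H \<subseteq> polys (V - set as)"
  shows "regseq H (map (\<lambda>a. var a - var a0) as)"
  using assms
proof (induction as arbitrary: H)
  case (Cons a as)
  have "reg H (var a - var a0)"
    by (rule reg_leading_coeff[of a _ _ 1])
      (use Cons.prems prime_inD(2)[OF prime_m] polys_mono[of "V - set (a # as)" "V - {a}"] in
        \<open>auto simp: xcoeff_diff xcoeff_single lookup_single when_def var_in_polys intro!: polys.diff_mem\<close>)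
  moreover have "regseq (insert (var a - var a0) H) (map (\<lambda>a. var a - var a0) as)"
    by (rule Cons.IH)
      (use Cons.prems polys_mono[of "V - set (a # as)" "V - set as"] in
        \<open>auto intro!: polys.diff_mem var_in_polys\<close>)
  ultimately show ?case by simp
qed simp

text \<open>Modulo the differences all variables in \<open>U'\<close> become \<open>var a0\<close>,
  and those in \<open>U - U'\<close> are units, so the product acts like a power of
  \<open>var a0\<close> up to a unit. That \<open>var a0\<close> is regular after the differences is
  seen by placing it first, where leading coefficients apply, and then moving it to the end.\<close>

lemma regseq_product:
  assumes V: "finite V" and U: "U \<subseteq> V" and U': "U' = {a \<in> U. var a \<in> m}" "U' \<noteq> {}"
    and H: "H \<subseteq> polys (V - U')"
  shows "\<exists>ys. length ys = card U' - 1 \<and> set ys \<subseteq> m \<and> set ys \<subseteq> polys U' \<and> regseq H (ys @ [prod var U])"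
proof -
  obtain a0 where a0: "a0 \<in> U'" using U'(2) by blast
  have fin: "finite U'" by (rule finite_subset[OF _ V]) (use U U'(1) in auto)
  obtain as where as: "set as = U' - {a0}" "distinct as" using fin finite_distinct_list[of "U' - {a0}"] by auto
  define ys :: "'k polynomial list" where "ys = map (\<lambda>a. var a - var a0) as"
  have U'V: "U' \<subseteq> V" using U U' by auto
  have a0V: "a0 \<in> V" using a0 U'V by blast
  have len: "length ys = card U' - 1"
    using as a0 fin distinct_card[OF as(2)] by (simp add: ys_def)
  have ysm: "set ys \<subseteq> m"
    using as a0 U'(1) polys.ideal_in_diff[OF ideal_m] by (auto simp: ys_def)
  have ysU: "set ys \<subseteq> polys U'" using as a0 by (auto simp: ys_def intro!: polys.diff_mem var_in_polys)
  have HA: "H \<subseteq> polys V" using H polys_mono[of "V - U'" V] by blast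
  have a0m: "var a0 \<in> m" using a0 U'(1) by simp
  have "reg H (var a0)"
    by (rule reg_leading_coeff[of a0 _ _ 1])
      (use a0 a0V H prime_inD(2)[OF prime_m] polys_mono[of "V - U'" "V - {a0}"] in
        \<open>auto simp: xcoeff_single lookup_single var_in_polys\<close>)
  moreover have "regseq (insert (var a0) H) ys"
    unfolding ys_def
    by (rule regseq_differences)
      (use as a0V U'V H polys_mono[of "V - U'" "V - set as"] in \<open>auto intro!: var_in_polys\<close>)
  ultimately have "regseq H (var a0 # ys)" by simp
  then have "regseq H (ys @ [var a0])"
    using ysm m_sub by (intro regseq_front_to_last noetherian_polys V a0m HA) auto
  then have 1: "regseq H ys" "reg (set ys \<union> H) (var a0)" by (simp_all add: regseq_append)
  have YH: "set ys \<union> H \<subseteq> polys V" using ysm m_sub HA by auto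
  note ideal_YH = loc_ideal[OF YH]
  have "reg (set ys \<union> H) (var a)" if a: "a \<in> U" for a
  proof (cases "a \<in> U'")
    case True
    have "var a0 - var a \<in> loc (set ys \<union> H)"
    proof (cases "a = a0")
      case False
      then have "var a - var a0 \<in> set ys" using True as by (auto simp: ys_def)
      then have "- (var a - var a0) \<in> loc (set ys \<union> H)"
        using loc_incl[OF YH] by (intro polys.ideal_in_uminus[OF ideal_YH]) auto
      then show ?thesis by simp
    qed (use ideal_inD(2)[OF ideal_YH] in simp)
    then show ?thesis
      using reg_congruent[OF YH] 1(2) var_in_polys a0V a U by blast
  next
    case False
    then show ?thesis using reg_unit[OF YH] var_in_polys a U U'(1) by blast
  qed
  then have "reg (set ys \<union> H) (prod var U)"
    using U var_in_polys by (intro reg_prod[OF YH]) auto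
  then show ?thesis using 1 len ysm ysU by (intro exI[of _ ys]) (simp add: regseq_append)
qed

text \<open>The leading coefficient of \<open>f w\<close> with respect to \<open>w\<close> is a
  nonzero polynomial in \<open>Y\<close> alone and thus lies outside \<open>m\<close>. Since
  \<open>w\<close> is absent from everything before, \<open>reg_leading_coeff\<close> applies at
  each stage.\<close>

lemma regseq_transcendence:
  assumes "Y \<subseteq> V" "m \<inter> polys Y \<subseteq> {0}" "distinct ws" "set ws \<subseteq> V - Y" "H \<subseteq> polys (V - set ws)"
    and "\<And>w. w \<in> set ws \<Longrightarrow> f w \<in> m \<inter> polys (insert w Y) - {0}"
  shows "regseq H (map f ws)"
  using assms
proof (induction ws arbitrary: H)
  case (Cons w ws)
  have f: "f w \<in> m" "f w \<in> polys (insert w Y)" "f w \<noteq> 0" using Cons.prems(6)[of w] by auto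
  have wV: "w \<in> V" "w \<notin> Y" using Cons.prems(4) by auto
  obtain D where D: "\<forall>p\<ge>D. xcoeff w p (f w) = 0" using xcoeff_bound by blast
  let ?E = "{p. xcoeff w p (f w) \<noteq> 0}"
  have fin: "finite ?E" using D by (intro finite_subset[of ?E "{..<D}"]) (auto simp: not_le[symmetric])
  have ne: "?E \<noteq> {}" using xcoeff_expand[of 0 w "f w"] f(3) by auto
  define e where "e = Max ?E"
  have e: "xcoeff w e (f w) \<noteq> 0" "\<And>p. p > e \<Longrightarrow> xcoeff w p (f w) = 0"
    using Max_in[OF fin ne] Max_ge[OF fin] by (auto simp: e_def not_le[symmetric])
  have "insert w Y - {w} = Y" using wV by auto
  then have "xcoeff w e (f w) \<in> polys Y" using xcoeff_polys[OF f(2), of w e] by simp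
  then have "xcoeff w e (f w) \<notin> m" using e(1) Cons.prems(2) by blast
  then have "reg H (f w)"
    using e(2) f(1) m_sub wV Cons.prems(5) polys_mono[of "V - set (w # ws)" "V - {w}"]
    by (intro reg_leading_coeff[of w _ _ e]) auto
  moreover have "regseq (insert (f w) H) (map f ws)"
  proof (rule Cons.IH[OF Cons.prems(1,2)])
    have "insert w Y \<subseteq> V - set ws" using Cons.prems(1,3,4) by auto
    then have "f w \<in> polys (V - set ws)" using f(2) polys_mono by blast
    moreover have "H \<subseteq> polys (V - set ws)"
      using Cons.prems(5) polys_mono[of "V - set (w # ws)" "V - set ws"] by auto
    ultimately show "insert (f w) H \<subseteq> polys (V - set ws)" by simp
  qed (use Cons.prems in auto)
  ultimately show ?case by simp
qed simp

text \<open>The regular sequence on \<open>A\<^sub>m/(u, v)\<close>: a relation for each variable that is algebraic modulo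
  \<open>m\<close> over the remaining ones, and the differences of the variables of \<open>u\<close>, resp. \<open>v\<close>, lying in
  \<open>m\<close>. It is built with \<open>u\<close>, \<open>v\<close> at the end and then permuted.\<close>

lemma complete_intersection_regseq:
  assumes V: "finite V" and U: "U1 \<subseteq> V" "U2 \<subseteq> V" "U1 \<inter> U2 = {}"
    and m: "prod var U1 \<in> m" "prod var U2 \<in> m"
  shows "\<exists>Y gs. Y \<subseteq> V \<and> m \<inter> polys Y \<subseteq> {0} \<and> set gs \<subseteq> m \<and>
    regseq {prod var U1, prod var U2} gs \<and> length gs + card Y + 2 = card V"
proof -
  let ?u = "prod var U1 :: 'k polynomial" and ?v = "prod var U2 :: 'k polynomial"
  define V1 where "V1 = {a \<in> U1. var a \<in> m}"
  define V2 where "V2 = {a \<in> U2. var a \<in> m}"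
  have finU: "finite U1" "finite U2" using finite_subset[OF U(1) V] finite_subset[OF U(2) V] by auto
  have ne: "V1 \<noteq> {}" "V2 \<noteq> {}"
    using prime_contains_var[OF prime_m finU(1) m(1) U(1)] prime_contains_var[OF prime_m finU(2) m(2) U(2)]
    by (auto simp: V1_def V2_def)
  have fin: "finite V1" "finite V2" using finU by (auto simp: V1_def V2_def)
  have sub: "V1 \<subseteq> U1" "V2 \<subseteq> U2" by (auto simp: V1_def V2_def)
  \<comment> \<open>Variables of the two products that are units at \<open>m\<close> stay in
    \<open>W\<close>, so they may occur in \<open>Y\<close> or in the relations
    \<open>f w\<close>.\<close>
  define W where "W = V - V1 - V2"
  have "\<exists>Y. Y \<subseteq> W \<and> m \<inter> polys Y \<subseteq> {0} \<and> (\<forall>Z. Z \<subseteq> W \<and> m \<inter> polys Z \<subseteq> {0} \<longrightarrow> card Z \<le> card Y)"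
  proof -
    have "m \<inter> polys {} \<subseteq> {0}"
    proof
      fix p assume p: "p \<in> m \<inter> polys {}"
      then obtain c where c: "p = psingle 0 c" by (auto simp: polys_empty)
      show "p \<in> {0}"
      proof (rule ccontr)
        assume "p \<notin> {0}"
        then have "c \<noteq> 0" using c by auto
        have "psingle 0 (inverse c) * psingle 0 c \<in> m"
          using p c by (intro ideal_inD(4)[OF ideal_m] single_in_polys) auto
        then show False using prime_inD(2)[OF prime_m] unfolding const_inverse[OF \<open>c \<noteq> 0\<close>] by simp
      qed
    qed
    moreover have "\<forall>Z. Z \<subseteq> W \<and> m \<inter> polys Z \<subseteq> {0} \<longrightarrow> card Z < Suc (card V)"
      using V by (auto simp: W_def less_Suc_eq_le intro!: card_mono)
    ultimately show ?thesis
      using ex_has_greatest_nat[of "\<lambda>Z. Z \<subseteq> W \<and> m \<inter> polys Z \<subseteq> {0}" "{}" card "Suc (card V)"] by auto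
  qed
  then obtain Y where Y: "Y \<subseteq> W" "m \<inter> polys Y \<subseteq> {0}"
    and max: "\<forall>Z. Z \<subseteq> W \<and> m \<inter> polys Z \<subseteq> {0} \<longrightarrow> card Z \<le> card Y" by (elim exE conjE)
  have finW: "finite W" using V by (simp add: W_def)
  have finY: "finite Y" by (rule finite_subset[OF Y(1) finW])
  \<comment> \<open>By maximality of \<open>Y\<close>, each further variable of \<open>W\<close>
    satisfies a nonzero relation over \<open>Y\<close> modulo \<open>m\<close>.\<close>
  have "\<exists>f. f \<in> m \<inter> polys (insert w Y) - {0}" if w: "w \<in> W - Y" for w
  proof (rule ccontr)
    assume "\<not> ?thesis"
    then have "m \<inter> polys (insert w Y) \<subseteq> {0}" "insert w Y \<subseteq> W" using w Y(1) by auto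
    then have "card (insert w Y) \<le> card Y" using max by blast
    then show False using w finY by simp
  qed
  then obtain f where f: "\<And>w. w \<in> W - Y \<Longrightarrow> f w \<in> m \<inter> polys (insert w Y) - {0}" by metis
  obtain ws where ws: "set ws = W - Y" "distinct ws" using finW finite_distinct_list[of "W - Y"] by auto
  define F where "F = map f ws"
  have Fm: "set F \<subseteq> m" using f ws by (auto simp: F_def)
  have FW: "set F \<subseteq> polys W"
  proof
    fix p assume "p \<in> set F"
    then obtain w where w: "w \<in> W - Y" "p = f w" using ws by (auto simp: F_def)
    then show "p \<in> polys W" using f[OF w(1)] polys_mono[of "insert w Y" W] Y(1) by blast
  qed
  have rF: "regseq {} F"
    unfolding F_def
    by (rule regseq_transcendence[OF _ Y(2) ws(2)]) (use Y(1) ws(1) f in \<open>auto simp: W_def\<close>)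
  have "set F \<subseteq> polys (V - V1)"
    using FW polys_mono[of W "V - V1"] by (auto simp: W_def)
  then obtain ys where ys: "length ys = card V1 - 1" "set ys \<subseteq> m" "set ys \<subseteq> polys V1"
      "regseq (set F) (ys @ [?u])"
    using regseq_product[OF V U(1) V1_def ne(1)] by blast
  have uA: "?u \<in> polys U1" "?v \<in> polys V"
    using U by (auto intro!: polys.prod_mem var_in_polys)
  \<comment> \<open>The second product can be appended because nothing so far involves
    \<open>V2\<close>: the first product and \<open>ys\<close> use variables of \<open>U1\<close>,
    which is disjoint from \<open>U2\<close>, and \<open>W\<close> excludes
    \<open>V2\<close>.\<close>
  let ?H = "{?u} \<union> set ys \<union> set F"
  have "?H \<subseteq> polys (V - V2)"
  proof -
    have "U1 \<subseteq> V - V2" "V1 \<subseteq> V - V2" "W \<subseteq> V - V2" using U sub by (auto simp: W_def)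
    then show ?thesis using uA(1) ys(3) FW polys_mono by blast
  qed
  then obtain zs where zs: "length zs = card V2 - 1" "set zs \<subseteq> m" "regseq ?H (zs @ [?v])"
    using regseq_product[OF V U(2) V2_def ne(2)] by blast
  have "regseq {} ((F @ ys @ ?u # zs) @ [?v])"
    using rF ys(4) zs(3) by (simp add: regseq_append Un_commute Un_assoc insert_commute)
  then have "regseq {} (?v # (F @ ys @ ?u # zs))"
    using Fm ys(2) zs(2) m(1) uA(2)
    by (intro regseq_last_to_front noetherian_polys V) auto
  then have "regseq {?v} (((F @ ys) @ [?u]) @ zs)" by simp
  note a = iffD1[OF regseq_append this, THEN conjunct1] iffD1[OF regseq_append this, THEN conjunct2]
  have "regseq {?v} (?u # (F @ ys))"
    using a(1) Fm ys(2) m(1) m_sub uA(2)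
    by (intro regseq_last_to_front noetherian_polys V) auto
  then have "regseq {?u, ?v} (F @ ys)" by simp
  moreover have "set ((F @ ys) @ [?u]) \<union> {?v} = set (F @ ys) \<union> {?u, ?v}" by auto
  then have "regseq (set (F @ ys) \<union> {?u, ?v}) zs" using a(2) by (simp only:)
  ultimately have "regseq {?u, ?v} ((F @ ys) @ zs)" by (simp only: regseq_append simp_thms)
  moreover have "length ((F @ ys) @ zs) + card Y + 2 = card V"
  \<comment> \<open>The three blocks contribute \<open>card W - card Y\<close>,
    \<open>card V1 - 1\<close> and \<open>card V2 - 1\<close> elements.\<close>
  proof -
    have "length ws = card (W - Y)" using ws distinct_card by metis
    also have "\<dots> = card W - card Y" using finY Y(1) by (simp add: card_Diff_subset)
    finally have 1: "length F = card W - card Y" by (simp add: F_def)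
    have "card Y \<le> card W" using card_mono[OF finW Y(1)] .
    moreover have "card V1 \<ge> 1" "card V2 \<ge> 1" using ne fin by (auto simp: Suc_le_eq card_gt_0_iff One_nat_def)
    moreover have "card V = card W + card V1 + card V2"
    proof -
      have "V = W \<union> (V1 \<union> V2)" using sub U by (auto simp: W_def)
      moreover have "card (W \<union> (V1 \<union> V2)) = card W + card (V1 \<union> V2)"
        by (rule card_Un_disjoint) (use finW fin in \<open>auto simp: W_def\<close>)
      moreover have "card (V1 \<union> V2) = card V1 + card V2"
        by (rule card_Un_disjoint) (use fin sub U in auto)
      ultimately show ?thesis by simp
    qed
    ultimately show ?thesis using 1 ys(1) zs(1) by simp
  qed
  moreover have "set ((F @ ys) @ zs) \<subseteq> m" using Fm ys(2) zs(2) by auto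
  moreover have "Y \<subseteq> V" using Y(1) by (auto simp: W_def)
  ultimately show ?thesis using Y(2) by blast
qed

text \<open>Depth and dimension both equal the length of the sequence \<open>gs\<close> just
  constructed. The depth is bounded above through an associated prime generated by two variables,
  one from each product; the dimension is bounded above because every prime over both products
  contains such a pair. The lower bound for the dimension is the chain of primes that
  \<open>gs\<close> itself generates.\<close>

lemma complete_intersection_depth_dim:
  assumes V: "finite V" and U: "U1 \<subseteq> V" "U2 \<subseteq> V" "U1 \<inter> U2 = {}"
    and m: "prod var U1 \<in> m" "prod var U2 \<in> m"
  shows "local_depth {prod var U1, prod var U2} = local_dim (polys V) m {prod var U1, prod var U2}"
proof -
  let ?G = "{prod var U1, prod var U2} :: 'k polynomial set"
  obtain Y gs where Y: "Y \<subseteq> V" "m \<inter> polys Y \<subseteq> {0}" and gs: "set gs \<subseteq> m" "regseq ?G gs"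
      and len: "length gs + card Y + 2 = card V"
    using complete_intersection_regseq[OF assms] by blast
  define mU where "mU = (\<lambda>X. \<Sum>i\<in>X. psingle i 1 :: monomial)"
  define W where "W = {mU U1, mU U2}"
  have fin: "finite U1" "finite U2" using finite_subset[OF U(1) V] finite_subset[OF U(2) V] by auto
  have G: "?G = mon ` W" using fin by (simp add: W_def mU_def prod_var)
  have keys: "pkeys (mU U1) = U1" "pkeys (mU U2) = U2"
    using fin by (auto simp: mU_def in_keys_iff lookup_sum_single split: if_splits)
  have sqfree: "plookup w v \<le> 1" if "w \<in> W" for w v
    using that fin by (auto simp: W_def mU_def lookup_sum_single)

  obtain a b where ab: "a \<in> U1" "b \<in> U2" "var a \<in> m" "var b \<in> m"
    using prime_contains_var[OF prime_m fin(1) m(1) U(1)] prime_contains_var[OF prime_m fin(2) m(2) U(2)]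
    by blast
  have cover: "minimal_cover V W {a, b}"
    unfolding minimal_cover_def using U ab keys sqfree by (auto simp: W_def)
  have sub: "var_ideal V {a, b} \<subseteq> m" using ab by (intro var_ideal_least ideal_m) auto
  have "a \<noteq> b" using ab U(3) by auto
  then have cab: "card {a, b} = 2" unfolding card_2_iff by blast
  have "local_depth ?G = enat (length gs)"
    unfolding local_depth_def
  proof (rule antisym)
    show "Sup {enat (length gs) | gs. set gs \<subseteq> m \<and> regseq ?G gs} \<le> enat (length gs)"
    proof (rule Sup_least)
      fix x assume "x \<in> {enat (length gs) | gs. set gs \<subseteq> m \<and> regseq ?G gs}"
      then obtain hs where hs: "x = enat (length hs)" "set hs \<subseteq> m" "regseq (mon ` W) hs"
        unfolding G by blast
      have "length hs + card Y + card {a, b} \<le> card V"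
        by (rule minimal_cover_depth_bound[OF V cover sub hs(2,3) Y])
      then show "x \<le> enat (length gs)" using hs(1) len cab by simp
    qed
    show "enat (length gs) \<le> Sup {enat (length gs) | gs. set gs \<subseteq> m \<and> regseq ?G gs}"
      using gs by (intro Sup_upper) blast
  qed
  moreover have "local_dim (polys V) m ?G = enat (length gs)"
    unfolding local_dim_def
  proof (rule antisym)
    let ?D = "{enat k | k. \<exists>P :: nat \<Rightarrow> 'k polynomial set.
      (\<forall>i\<le>k. prime_in (polys V) (P i) \<and> ?G \<subseteq> P i \<and> P i \<subseteq> m) \<and> (\<forall>i<k. P i \<subset> P (Suc i))}"
    show "Sup ?D \<le> enat (length gs)"
    proof (rule Sup_least)
      fix x assume "x \<in> ?D"
      then obtain k and P :: "nat \<Rightarrow> 'k polynomial set" where x: "x = enat k"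
        and P: "\<forall>i\<le>k. prime_in (polys V) (P i) \<and> ?G \<subseteq> P i \<and> P i \<subseteq> m" "\<forall>i<k. P i \<subset> P (Suc i)"
        by (elim CollectE exE conjE)
      have kP: "prime_in (polys V) (P i)" if "i \<le> k" for i using P(1) that by blast
      have P0: "prod var U1 \<in> P 0" "prod var U2 \<in> P 0" using P(1) by auto
      have Pk: "P k \<inter> polys Y \<subseteq> {0}" using P(1) Y(2) by blast
      \<comment> \<open>The pair is chosen anew, since it has to lie in the bottom prime
        \<open>P 0\<close> of the given chain and not only in \<open>m\<close>.\<close>
      obtain a b where ab: "a \<in> U1" "b \<in> U2" "var a \<in> P 0" "var b \<in> P 0"
        using prime_contains_var[OF kP fin(1) P0(1) U(1)] prime_contains_var[OF kP fin(2) P0(2) U(2)]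
        by blast
      have "k + card Y + card {a, b} \<le> card V"
        using P(2) Pk Y(1) ab U by (intro prime_chain_bound[OF V kP]) auto
      moreover have "a \<noteq> b" using ab U(3) by auto
      then have "card {a, b} = 2" unfolding card_2_iff by blast
      ultimately show "x \<le> enat (length gs)" using x len by simp
    qed
    obtain P where "\<forall>i\<le>length gs. prime_in (polys V) (P i) \<and> P i \<subseteq> m \<and> ?G \<subseteq> P i"
        "\<forall>i<length gs. P i \<subset> P (Suc i)"
      using minimal_cover_chain[OF V cover sub gs[unfolded G]] unfolding G by (elim exE conjE)
    then show "enat (length gs) \<le> Sup ?D" by (intro Sup_upper) blast
  qed
  ultimately show ?thesis by simp
qed

end

section \<open>Sufficient and necessary conditions for Cohen-Macaulayness\<close>

theorem complete_intersection_cohen_macaulay: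
  assumes U: "U1 \<subseteq> {1..n}" "U2 \<subseteq> {1..n}" "U1 \<inter> U2 = {}"
  shows "cohen_macaulay_ideal (poly_ring n :: ('k::field) polynomial ring)
    (ideal_gen (polys {1..n}) {prod var U1, prod var U2})"
proof -
  let ?G = "{prod var U1, prod var U2} :: 'k polynomial set"
  interpret quotient_setup n ?G
    by unfold_locales (use U in \<open>auto intro!: polys.prod_mem var_in_polys\<close>)
  show ?thesis
  proof (rule cohen_macaulay_idealI)
    fix m :: "'k polynomial set" assume m: "prime_in (polys {1..n}) m" "?G \<subseteq> m"
    interpret poly_local "{1..n}" m by unfold_locales (rule m(1))
    show "local_depth ?G = local_dim (polys {1..n}) m ?G"
      by (rule complete_intersection_depth_dim) (use U m(2) in auto)
  qed
qed

theorem cohen_macaulay_minimal_cover: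
  fixes W :: "monomial set"
  assumes n: "n \<ge> 2" and W12: "\<And>w. w \<in> W \<Longrightarrow> pkeys w \<inter> {1, 2} \<noteq> {}"
    and cover: "minimal_cover {1..n} W C"
    and cm: "cohen_macaulay_ideal (poly_ring n :: ('k::field) polynomial ring)
      (ideal_gen (polys {1..n}) (mon ` W))"
  shows "card C \<le> 2"
proof -
  let ?V = "{1..n}" and ?G = "mon ` W :: 'k polynomial set"
  let ?m = "var_ideal ?V ?V :: 'k polynomial set"
  note W = minimal_coverD(1)[OF cover] and C = minimal_coverD(3,4)[OF cover]
  interpret quotient_setup n ?G
    by unfold_locales (use W in \<open>auto intro!: single_in_polys\<close>)
  interpret poly_local ?V ?m by unfold_locales (rule prime_var_ideal)
  have in_ideal: "?G \<subseteq> var_ideal ?V X" if "\<And>w. w \<in> W \<Longrightarrow> pkeys w \<inter> X \<noteq> {}" for X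
    using that by (intro mons_sub_var_ideal W)
  have mono: "var_ideal ?V X \<subseteq> (var_ideal ?V Z :: 'k polynomial set)" if "X \<subseteq> Z" "Z \<subseteq> ?V" for X Z
    using that
    by (intro var_ideal_least prime_inD(1)[OF prime_var_ideal]) (subst var_in_var_ideal_iff, auto)
  have "?G \<subseteq> ?m" using in_ideal[OF C(2)] mono[OF C(1)] by blast
  then have eq: "local_depth ?G = local_dim (polys ?V) ?m ?G"
    using cohen_macaulay_ideal_origin[OF cm] by blast
  have "local_depth ?G \<le> enat (n - card C)"
    unfolding local_depth_def
  proof (rule Sup_least)
    fix x assume "x \<in> {enat (length gs) | gs. set gs \<subseteq> ?m \<and> regseq ?G gs}"
    then obtain gs where gs: "x = enat (length gs)" "set gs \<subseteq> ?m" "regseq ?G gs" by blast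
    \<comment> \<open>The origin contains every variable, so no nonempty set of variables is
      independent modulo it.\<close>
    have empty: "?m \<inter> polys {} \<subseteq> {0}"
      by (auto simp: polys_empty var_ideal_def mfilter_single)
    have "length gs + card ({} :: nat set) + card C \<le> card ?V"
      by (rule minimal_cover_depth_bound[OF _ cover mono[OF C(1) order_refl] gs(2,3) _ empty]) auto
    then show "x \<le> enat (n - card C)" using gs(1) by simp
  qed
  moreover have "enat (n - 2) \<le> local_dim (polys ?V) ?m ?G"
    unfolding local_dim_def
  proof (rule Sup_upper, intro CollectI exI conjI)
    \<comment> \<open>The chain runs from \<open>(x_1, x_2)\<close>, which contains all generators,
      to the origin; the offset 2 makes it \<open>n - 2\<close> steps long.\<close>
    let ?P = "\<lambda>i. var_ideal ?V {1..i + 2} :: 'k polynomial set"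
    show "enat (n - 2) = enat (n - 2)" ..
    show "\<forall>i\<le>n - 2. prime_in (polys ?V) (?P i) \<and> ?G \<subseteq> ?P i \<and> ?P i \<subseteq> ?m"
    proof (intro allI impI conjI)
      fix i assume i: "i \<le> n - 2"
      show "?G \<subseteq> ?P i"
      proof (rule in_ideal)
        fix w assume "w \<in> W"
        moreover have "{1, 2} \<subseteq> {1..i + 2}" by auto
        ultimately show "pkeys w \<inter> {1..i + 2} \<noteq> {}" using W12 by blast
      qed
      show "?P i \<subseteq> ?m" using i n by (intro mono) auto
    qed (rule prime_var_ideal)
    show "\<forall>i<n - 2. ?P i \<subset> ?P (Suc i)"
    proof (intro allI impI)
      fix i assume i: "i < n - 2"
      have "?P i \<subseteq> ?P (Suc i)" using i by (intro mono) auto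
      moreover have "var (i + 3) \<in> ?P (Suc i)" "var (i + 3) \<notin> ?P i"
        using i by (subst var_in_var_ideal_iff; auto)+
      ultimately show "?P i \<subset> ?P (Suc i)" by blast
    qed
  qed
  ultimately have "enat (n - 2) \<le> enat (n - card C)" unfolding eq by (rule order_trans[rotated])
  then have "n - 2 \<le> n - card C" by simp
  moreover have "card C \<le> n" using card_mono[OF _ C(1)] by simp
  ultimately show ?thesis using n by simp
qed

section \<open>Lexsegments of \<open>t\<close>-spread monomials\<close>

lemma var_prod_eq_sum:
  "strict_mono_on {1..d} i \<Longrightarrow> var_prod d i = (\<Sum>x\<in>i ` {1..d}. psingle x 1)"
  unfolding var_prod_def by (subst sum.reindex) (auto dest: strict_mono_on_imp_inj_on)

lemma lookup_var_prod:
  "strict_mono_on {1..d} i \<Longrightarrow> plookup (var_prod d i) x = (if x \<in> i ` {1..d} then 1 else 0)"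
  by (simp add: var_prod_eq_sum lookup_sum_single)

lemma keys_var_prod: "strict_mono_on {1..d} i \<Longrightarrow> pkeys (var_prod d i) = i ` {1..d}"
  by (auto simp: in_keys_iff lookup_var_prod split: if_splits)

lemma var_prod_cong: "(\<And>r. r \<in> {1..d} \<Longrightarrow> i r = j r) \<Longrightarrow> var_prod d i = var_prod d j"
  unfolding var_prod_def by (intro sum.cong) auto

text \<open>The support, listed increasingly, recovers the index sequence. The degree has to be
  recovered as well, because \<open>slex_gt\<close> quantifies over its own
  \<open>d\<close>.\<close>

lemma var_prod_unique:
  assumes i: "strict_mono_on {1..d} i" and j: "strict_mono_on {1..e} j" and eq: "var_prod d i = var_prod e j"
  shows "d = e" "\<And>r. r \<in> {1..d} \<Longrightarrow> i r = j r"
proof -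
  have im: "i ` {1..d} = j ` {1..e}" using keys_var_prod[OF i] keys_var_prod[OF j] eq by simp
  then show de: "d = e"
    using card_image[OF strict_mono_on_imp_inj_on[OF i]] card_image[OF strict_mono_on_imp_inj_on[OF j]] by simp
  have sd: "sorted (map k [1..<Suc d])" "distinct (map k [1..<Suc d])"
    if k: "strict_mono_on {1..d} k" for k :: "nat \<Rightarrow> nat"
    using strict_mono_on_leD[OF k] strict_mono_on_imp_inj_on[OF k]
    by (auto simp: sorted_iff_nth_mono distinct_map atLeastLessThanSuc_atLeastAtMost simp del: upt_Suc)
  have "map i [1..<Suc d] = map j [1..<Suc d]"
    using sd[OF i] sd[OF j[folded de]] im de
    by (intro sorted_distinct_set_unique)
      (auto simp: atLeastLessThanSuc_atLeastAtMost simp del: upt_Suc)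
  then show "\<And>r. r \<in> {1..d} \<Longrightarrow> i r = j r"
    by (auto simp: map_eq_conv simp del: upt_Suc)
qed

text \<open>The order on index sequences, in the orientation opposite to monomials: the smaller
  sequence is the larger monomial, so \<open>lexle d i k\<close> corresponds to
  \<open>slex_ge (var_prod d i) (var_prod d k)\<close>.\<close>

definition lexle :: "nat \<Rightarrow> (nat \<Rightarrow> nat) \<Rightarrow> (nat \<Rightarrow> nat) \<Rightarrow> bool" where
  "lexle d i k \<longleftrightarrow> (\<forall>r\<in>{1..d}. i r = k r) \<or> (\<exists>s\<in>{1..d}. (\<forall>r\<in>{1..<s}. i r = k r) \<and> i s < k s)"

lemma slex_ge_iff:
  assumes i: "strict_mono_on {1..d} i" and k: "strict_mono_on {1..d} k"
  shows "slex_ge (var_prod d i) (var_prod d k) \<longleftrightarrow> lexle d i k"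
proof -
  have "var_prod d i = var_prod d k \<longleftrightarrow> (\<forall>r\<in>{1..d}. i r = k r)"
    using var_prod_unique(2)[OF i k] var_prod_cong[of d i k] by blast
  moreover have "slex_gt (var_prod d i) (var_prod d k) \<longleftrightarrow>
      (\<exists>s\<in>{1..d}. (\<forall>r\<in>{1..<s}. i r = k r) \<and> i s < k s)"
  proof
    assume "slex_gt (var_prod d i) (var_prod d k)"
    then obtain e i' k' s where e: "var_prod d i = var_prod e i'" "var_prod d k = var_prod e k'"
      "strict_mono_on {1..e} i'" "strict_mono_on {1..e} k'" "s \<in> {1..e}" "\<forall>r\<in>{1..<s}. i' r = k' r" "i' s < k' s"
      unfolding slex_gt_def by blast
    have de: "d = e" by (rule var_prod_unique(1)[OF i e(3,1)])
    have eqs: "i r = i' r" "k r = k' r" if "r \<in> {1..d}" for r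
      using var_prod_unique(2)[OF i e(3,1) that] var_prod_unique(2)[OF k e(4,2) that] by auto
    have "\<forall>r\<in>{1..<s}. i r = k r" using e(5,6) eqs de by auto
    moreover have "i s < k s" using e(5,7) eqs de by auto
    ultimately show "\<exists>s\<in>{1..d}. (\<forall>r\<in>{1..<s}. i r = k r) \<and> i s < k s" using e(5) de by blast
  qed (use i k in \<open>auto simp: slex_gt_def\<close>)
  ultimately show ?thesis by (simp add: slex_ge_def lexle_def)
qed

lemma lexle_pointwise:
  assumes "\<And>r. r \<in> {1..d} \<Longrightarrow> i r \<le> k r" shows "lexle d i k"
proof (cases "\<forall>r\<in>{1..d}. i r = k r")
  case False
  define s where "s = (LEAST s. s \<in> {1..d} \<and> i s \<noteq> k s)"
  have ex: "\<exists>s. s \<in> {1..d} \<and> i s \<noteq> k s" using False by blast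
  have s: "s \<in> {1..d}" "i s \<noteq> k s" using LeastI_ex[OF ex] by (auto simp: s_def)
  have "i r = k r" if "r \<in> {1..<s}" for r
    using not_less_Least[of r "\<lambda>s. s \<in> {1..d} \<and> i s \<noteq> k s"] that s(1) by (auto simp: s_def)
  moreover have "i s < k s" using s assms[of s] by simp
  ultimately show ?thesis using s(1) unfolding lexle_def by blast
qed (simp add: lexle_def)

lemma lexle_first: "1 \<le> d \<Longrightarrow> i 1 < k 1 \<Longrightarrow> lexle d i k"
  unfolding lexle_def by (intro disjI2 bexI[of _ 1]) auto

lemma lexle_first_le:
  assumes "lexle d i k" "1 \<le> d" shows "i 1 \<le> k 1"
proof -
  consider "\<forall>r\<in>{1..d}. i r = k r" |
    s where "s \<in> {1..d}" "\<forall>r\<in>{1..<s}. i r = k r" "i s < k s"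
    using assms(1) unfolding lexle_def by blast
  then show ?thesis
  proof cases
    case (2 s)
    then show ?thesis by (cases "s = 1") auto
  qed (use assms(2) in auto)
qed

lemma lexle_antisym_pointwise:
  assumes "lexle d i k" "\<And>r. r \<in> {1..d} \<Longrightarrow> k r \<le> i r" "r \<in> {1..d}" shows "i r = k r"
  using assms unfolding lexle_def by (meson not_less)

definition tseq :: "nat \<Rightarrow> nat \<Rightarrow> nat \<Rightarrow> (nat \<Rightarrow> nat) \<Rightarrow> bool" where
  "tseq n d t i \<longleftrightarrow> (\<forall>r\<in>{1..d}. i r \<in> {1..n}) \<and> (\<forall>r\<in>{1..<d}. i r + t \<le> i (Suc r))"

lemma tseq_spread:
  assumes "tseq n d t i" "1 \<le> r" "r \<le> q" "q \<le> d"
  shows "i r + (q - r) * t \<le> i q"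
  using assms(3,4)
proof (induction q rule: dec_induct)
  case (step q)
  have "i q + t \<le> i (Suc q)" using assms(1,2) step by (auto simp: tseq_def)
  moreover have "(Suc q - r) * t = (q - r) * t + t" using step by (simp add: Suc_diff_le)
  ultimately show ?case using step by simp
qed simp

lemma tseq_strict_mono:
  assumes "tseq n d t i" "t \<ge> 1" shows "strict_mono_on {1..d} i"
proof (rule strict_mono_onI)
  fix r q assume rq: "r \<in> {1..d}" "q \<in> {1..d}" "r < q"
  have "i r + (q - r) * t \<le> i q" using tseq_spread[OF assms(1)] rq by auto
  moreover have "(q - r) * t \<ge> 1" using rq assms(2) by (simp add: Suc_le_eq One_nat_def)
  ultimately show "i r < i q" by linarith
qed

lemma t_spread_monomials_iff:
  assumes "t \<ge> 1" shows "w \<in> t_spread_monomials n d t \<longleftrightarrow> (\<exists>k. w = var_prod d k \<and> tseq n d t k)"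
proof -
  have "mono_on {1..d} k" if "tseq n d t k" for k
    using strict_mono_on_imp_mono_on[OF tseq_strict_mono[OF that assms]] .
  then show ?thesis unfolding t_spread_monomials_def tseq_def by blast
qed

lemma minimal_cover_exists:
  assumes fin: "finite C0" and W: "\<forall>w\<in>W. pkeys w \<subseteq> V \<and> (\<forall>v. plookup w v \<le> 1)"
    and C0: "C0 \<subseteq> V" "\<forall>w\<in>W. pkeys w \<inter> C0 \<noteq> {}"
  shows "\<exists>C\<subseteq>C0. minimal_cover V W C"
  using fin C0
proof (induction C0 rule: finite_psubset_induct)
  case (psubset C)
  show ?case
  proof (cases "\<forall>c\<in>C. \<exists>w\<in>W. pkeys w \<inter> C = {c}")
    case True
    then show ?thesis using psubset.prems W by (auto simp: minimal_cover_def)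
  next
    case False
    then obtain c where c: "c \<in> C" "\<And>w. w \<in> W \<Longrightarrow> pkeys w \<inter> C \<noteq> {c}" by blast
    have "\<forall>w\<in>W. pkeys w \<inter> (C - {c}) \<noteq> {}" using c psubset.prems(2) by blast
    moreover have "C - {c} \<subset> C" using c by blast
    ultimately obtain C' where "C' \<subseteq> C - {c}" "minimal_cover V W C'"
      using psubset.IH[of "C - {c}"] psubset.prems(1) by blast
    then show ?thesis by blast
  qed
qed

text \<open>Two edges meeting \<open>C0\<close> in one point each force these points into every cover inside \<open>C0\<close>,
  and an edge avoiding both points forces a third one.\<close>

lemma minimal_cover_card_ge_3:
  assumes C: "minimal_cover V W C" "C \<subseteq> C0" "finite C0"
    and w: "w1 \<in> W" "pkeys w1 \<inter> C0 \<subseteq> {p}" "w2 \<in> W" "pkeys w2 \<inter> C0 \<subseteq> {q}" "p \<noteq> q"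
    and w3: "w3 \<in> W" "p \<notin> pkeys w3" "q \<notin> pkeys w3"
  shows "card C \<ge> 3"
proof -
  note cov = minimal_coverD(4)[OF C(1)]
  have "p \<in> C" "q \<in> C" using cov[OF w(1)] cov[OF w(3)] C(2) w(2,4) by blast+
  moreover obtain r where "r \<in> pkeys w3" "r \<in> C" using cov[OF w3(1)] by blast
  ultimately have "{p, q, r} \<subseteq> C" "p \<noteq> r" "q \<noteq> r" using w3 by auto
  moreover have "card {p, q, r} = 3" using w(5) calculation unfolding card_3_iff by blast
  ultimately show ?thesis using card_mono[OF finite_subset[OF C(2,3)], of "{p, q, r}"] by simp
qed

section \<open>The lexsegment between \<open>u\<close> and \<open>v\<close> and its vertex
  covers\<close>

locale lexsegment_setup =
  fixes n d t :: nat and i j :: "nat \<Rightarrow> nat"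
  assumes t: "t \<ge> 1" and d: "d \<ge> 2"
    and i: "tseq n d t i" "i 1 = 1" and j: "tseq n d t j" "j 1 = 2"
    and n: "n \<ge> 4 + (2 * d - 3) * t"
begin

abbreviation "W \<equiv> lexsegment n d t (var_prod d i) (var_prod d j)"

text \<open>The index sequences of \<open>u\<^sub>0\<close> and \<open>v\<^sub>0\<close>: one is
  pushed to the right end after the index 1, the other packed to the left from 2. Both are extremal
  even pointwise, by \<open>le_umin\<close> and \<open>ge_vmax\<close>.\<close>

definition umin :: "nat \<Rightarrow> nat" where "umin = (\<lambda>r. if r = 1 then 1 else n - (d - r) * t)"
definition vmax :: "nat \<Rightarrow> nat" where "vmax = (\<lambda>r. 2 + (r - 1) * t)"

text \<open>The use of the bound on \<open>n\<close>: the second index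
  \<open>n - (d - 2) * t\<close> of \<open>umin\<close> exceeds the last index
  \<open>2 + (d - 1) * t\<close> of \<open>vmax\<close> by at least 2. This separates the two
  supports and leaves room for one shifted index between them.\<close>

lemma n_bound: "n \<ge> 4 + (d - 1) * t + (d - 2) * t"
proof -
  have "2 * d - 3 = (d - 1) + (d - 2)" using d by simp
  then have "(2 * d - 3) * t = (d - 1) * t + (d - 2) * t" by (metis distrib_right)
  then show ?thesis using n by simp
qed

lemma W_iff: "w \<in> W \<longleftrightarrow> (\<exists>k. w = var_prod d k \<and> tseq n d t k \<and> lexle d i k \<and> lexle d k j)"
  using slex_ge_iff tseq_strict_mono[OF _ t] i(1) j(1)
  unfolding lexsegment_def t_spread_monomials_iff[OF t] by blast

lemma W_I: "tseq n d t k \<Longrightarrow> lexle d i k \<Longrightarrow> lexle d k j \<Longrightarrow> var_prod d k \<in> W"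
  using W_iff by blast

lemma keys_tseq: "tseq n d t k \<Longrightarrow> pkeys (var_prod d k) = k ` {1..d}"
  using keys_var_prod tseq_strict_mono t by blast

lemma W_first: "tseq n d t k \<Longrightarrow> lexle d i k \<Longrightarrow> lexle d k j \<Longrightarrow> k 1 = 1 \<or> k 1 = 2"
  using lexle_first_le[of d i k] lexle_first_le[of d k j] i(2) j(2) d by auto

lemma W_squarefree: "\<forall>w\<in>W. pkeys w \<subseteq> {1..n} \<and> (\<forall>v. plookup w v \<le> 1)"
proof
  fix w assume "w \<in> W"
  then obtain k where k: "w = var_prod d k" "tseq n d t k" using W_iff by blast
  have "pkeys w \<subseteq> {1..n}" using keys_tseq[OF k(2)] k by (auto simp: tseq_def)
  moreover have "plookup w v \<le> 1" for v
    using lookup_var_prod[OF tseq_strict_mono[OF k(2) t]] k(1) by simp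
  ultimately show "pkeys w \<subseteq> {1..n} \<and> (\<forall>v. plookup w v \<le> 1)" by blast
qed

lemma le_max:
  assumes "tseq n d t k" "r \<in> {1..d}" shows "k r \<le> n - (d - r) * t"
proof -
  have "k r + (d - r) * t \<le> k d" using tseq_spread[OF assms(1), of r d] assms(2) by auto
  moreover have "k d \<le> n" using assms(1) d by (auto simp: tseq_def)
  ultimately show ?thesis by linarith
qed

lemma le_umin: "tseq n d t k \<Longrightarrow> k 1 = 1 \<Longrightarrow> r \<in> {1..d} \<Longrightarrow> k r \<le> umin r"
  using le_max[of k r] by (auto simp: umin_def)

lemma ge_vmax: "tseq n d t k \<Longrightarrow> k 1 = 2 \<Longrightarrow> r \<in> {1..d} \<Longrightarrow> vmax r \<le> k r"
  using tseq_spread[of n d t k 1 r] by (auto simp: vmax_def)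

lemma mult_bounds:
  assumes "r \<in> {2..d}" shows "(d - r) * t \<le> (d - 2) * t"
  using assms by (intro mult_right_mono) auto

lemma tseq_umin: "tseq n d t umin"
  unfolding tseq_def
proof (intro conjI ballI)
  fix r assume r: "r \<in> {1..d}"
  then show "umin r \<in> {1..n}"
  proof (cases "r = 1")
    case False
    then have "r \<in> {2..d}" using r by auto
    then have "(d - r) * t + 1 \<le> n" using mult_bounds[of r] n_bound by linarith
    then show ?thesis using False by (simp only: umin_def if_False atLeastAtMost_iff) linarith
  qed (use n_bound in \<open>simp add: umin_def\<close>)
next
  fix r assume r: "r \<in> {1..<d}"
  show "umin r + t \<le> umin (Suc r)"
  proof (cases "r = 1")
    case True
    have "(d - 1) * t \<ge> t" using d by (cases d) auto
    moreover have "umin r = 1" "umin (Suc r) = n - (d - 2) * t"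
      using True by (simp_all add: umin_def numeral_2_eq_2 One_nat_def)
    ultimately show ?thesis using n_bound by linarith
  next
    case False
    have "d - r = Suc (d - Suc r)" using r by auto
    then have "(d - r) * t = (d - Suc r) * t + t" by simp
    moreover have "(d - r) * t \<le> (d - 2) * t" using False r by (intro mult_bounds) auto
    moreover have "Suc r \<noteq> 1" using r by auto
    ultimately show ?thesis
      unfolding umin_def using False n_bound by (simp only: if_False) linarith
  qed
qed

lemma tseq_vmax: "tseq n d t vmax"
  unfolding tseq_def
proof (intro conjI ballI)
  fix r assume r: "r \<in> {1..d}"
  then have "(r - 1) * t \<le> (d - 1) * t" by (intro mult_right_mono) auto
  then have "vmax r \<le> n" "1 \<le> vmax r" unfolding vmax_def using n_bound by linarith+
  then show "vmax r \<in> {1..n}" by simp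
next
  fix r assume r: "r \<in> {1..<d}"
  then obtain q where "r = Suc q" by (cases r) auto
  then show "vmax r + t \<le> vmax (Suc r)" by (simp add: vmax_def)
qed

lemma umin_in_W: "var_prod d umin \<in> W"
  using d i j by (intro W_I tseq_umin lexle_pointwise le_umin lexle_first) (auto simp: umin_def)

lemma vmax_in_W: "var_prod d vmax \<in> W"
  using d i j by (intro W_I tseq_vmax lexle_pointwise ge_vmax lexle_first) (auto simp: vmax_def)

lemma umin_values:
  assumes "r \<in> {2..d}" shows "umin r \<ge> n - (d - 2) * t"
  using assms diff_le_mono2[OF mult_bounds[OF assms]] by (simp add: umin_def del: diff_le_mono2)

lemma vmax_values:
  assumes "r \<in> {1..d}" shows "2 \<le> vmax r" "vmax r \<le> 2 + (d - 1) * t"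
  using assms by (auto simp: vmax_def intro!: mult_right_mono)

text \<open>A member starting with 1 is pointwise at most \<open>umin\<close> and lexicographically
  at least \<open>i = umin\<close>, so it equals \<open>umin\<close>; members starting with 2 are
  treated dually.\<close>

lemma W_eq:
  assumes u: "\<And>r. r \<in> {1..d} \<Longrightarrow> i r = umin r" and v: "\<And>r. r \<in> {1..d} \<Longrightarrow> j r = vmax r"
  shows "W = {var_prod d umin, var_prod d vmax}"
proof (intro equalityI subsetI)
  fix w assume "w \<in> W"
  then obtain k where k: "w = var_prod d k" "tseq n d t k" "lexle d i k" "lexle d k j" using W_iff by blast
  show "w \<in> {var_prod d umin, var_prod d vmax}"
    using W_first[OF k(2-4)]
  proof
    assume "k 1 = 1"
    then have "i r = k r" if "r \<in> {1..d}" for r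
      using lexle_antisym_pointwise[OF k(3)] le_umin[OF k(2)] u that by simp
    then have "var_prod d umin = w" unfolding k(1) using u by (intro var_prod_cong) simp
    then show ?thesis by simp
  next
    assume "k 1 = 2"
    then have "k r = j r" if "r \<in> {1..d}" for r
      using lexle_antisym_pointwise[OF k(4)] ge_vmax[OF k(2)] v that by simp
    then have "w = var_prod d vmax" unfolding k(1) using v by (intro var_prod_cong) simp
    then show ?thesis by simp
  qed
qed (use umin_in_W vmax_in_W in blast)

text \<open>With \<open>p\<close> the last index of \<open>vmax\<close>, the set \<open>?C0\<close>
  is a cover: a member starts with 1, or it starts with 2 and ends at \<open>p\<close> or later. The
  edges \<open>vmax\<close> and \<open>k\<close>, which is \<open>vmax\<close> with last index
  \<open>p + 1\<close>, meet \<open>?C0\<close> only in \<open>p\<close> and \<open>p + 1\<close>;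
  the indices of \<open>umin\<close> are 1 or at least \<open>p + 2\<close>.\<close>

lemma large_cover_of_v:
  assumes v: "r \<in> {1..d}" "j r \<noteq> vmax r"
  shows "\<exists>C. minimal_cover {1..n} W C \<and> card C \<ge> 3"
proof -
  define p where "p = 2 + (d - 1) * t"
  let ?C0 = "insert 1 {p..n}"
  define k where "k = (\<lambda>r. if r = d then p + 1 else vmax r)"
  have n1: "n - (d - 2) * t \<ge> p + 2" using n_bound by (simp add: p_def)
  have small: "vmax r + t \<le> p" if "r \<in> {1..<d}" for r
  proof -
    have "(r - 1) * t + t = (Suc (r - 1)) * t" by simp
    also have "\<dots> \<le> (d - 1) * t" using that by (intro mult_right_mono) auto
    finally show ?thesis by (simp add: vmax_def p_def)
  qed
  have tk: "tseq n d t k"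
    unfolding tseq_def
  proof (intro conjI ballI)
    fix r assume r: "r \<in> {1..d}"
    then show "k r \<in> {1..n}" using tseq_vmax n1 by (auto simp: k_def tseq_def)
  next
    fix r assume r: "r \<in> {1..<d}"
    then show "k r + t \<le> k (Suc r)" using tseq_vmax small[OF r] by (auto simp: k_def tseq_def)
  qed
  \<comment> \<open>An excess of \<open>j\<close> over \<open>vmax\<close> at any place is carried
    by the gaps to the last index.\<close>
  have jd: "p + 1 \<le> j d"
  proof -
    have "j r + (d - r) * t \<le> j d" using tseq_spread[OF j(1)] v(1) by auto
    moreover have "vmax r + 1 \<le> j r" using ge_vmax[OF j v(1)] v(2) by simp
    moreover have "(r - 1) * t + (d - r) * t = (d - 1) * t"
      using v(1) by (simp add: distrib_right[symmetric])
    ultimately show ?thesis by (simp add: p_def vmax_def)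
  qed
  have kW: "var_prod d k \<in> W"
  proof (rule W_I[OF tk])
    show "lexle d i k" using d i by (intro lexle_first) (auto simp: k_def vmax_def)
    show "lexle d k j" using jd ge_vmax[OF j] by (intro lexle_pointwise) (auto simp: k_def)
  qed
  have "\<forall>w\<in>W. pkeys w \<inter> ?C0 \<noteq> {}"
  proof
    fix w assume "w \<in> W"
    then obtain k where k: "w = var_prod d k" "tseq n d t k" "lexle d i k" "lexle d k j" using W_iff by blast
    have "k 1 \<in> ?C0 \<or> k d \<in> ?C0"
      using W_first[OF k(2-4)]
    proof
      assume "k 1 = 2"
      then have "p \<le> k d" using ge_vmax[OF k(2), of d] d by (simp add: p_def vmax_def)
      then show ?thesis using k(2) d by (auto simp: tseq_def)
    qed simp
    moreover have "k 1 \<in> pkeys w" "k d \<in> pkeys w" unfolding k(1) keys_tseq[OF k(2)] using d by auto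
    ultimately show "pkeys w \<inter> ?C0 \<noteq> {}" by blast
  qed
  moreover have C0n: "?C0 \<subseteq> {1..n}" using n_bound by (auto simp: p_def)
  ultimately obtain C where C: "C \<subseteq> ?C0" "minimal_cover {1..n} W C"
    using minimal_cover_exists[OF _ W_squarefree, of ?C0] by auto
  have "card C \<ge> 3"
  proof (rule minimal_cover_card_ge_3[OF C(2,1) _ vmax_in_W _ kW _ _ umin_in_W])
    show "pkeys (var_prod d vmax) \<inter> ?C0 \<subseteq> {p}"
      unfolding keys_tseq[OF tseq_vmax] using vmax_values by (fastforce simp: p_def)
    show "pkeys (var_prod d k) \<inter> ?C0 \<subseteq> {p + 1}"
    proof
      fix x assume "x \<in> pkeys (var_prod d k) \<inter> ?C0"
      then obtain r where r: "r \<in> {1..d}" "x = k r" "x \<in> ?C0" unfolding keys_tseq[OF tk] by blast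
      show "x \<in> {p + 1}"
      proof (cases "r = d")
        case False
        then have "k r + t \<le> p" "k r \<ge> 2" using r small[of r] vmax_values(1)[of r] by (auto simp: k_def)
        then show ?thesis using r t by auto
      qed (use r in \<open>simp add: k_def\<close>)
    qed
    have "umin r = 1 \<or> umin r \<ge> p + 2" if "r \<in> {1..d}" for r
      using that umin_values[of r] n1 by (cases "r = 1") (auto simp: umin_def)
    then show "p \<notin> pkeys (var_prod d umin)" "p + 1 \<notin> pkeys (var_prod d umin)"
      unfolding keys_tseq[OF tseq_umin] by (fastforce simp: p_def)+
  qed auto
  then show ?thesis using C(2) by blast
qed

text \<open>Dual to the case of \<open>v\<close>, with \<open>p + 1\<close> the second index of
  \<open>umin\<close>. The set \<open>?C0\<close> is a cover: a member starts with 2, or it starts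
  with 1 and has second index at most \<open>p + 1\<close>. The edges \<open>umin\<close> and
  \<open>k\<close>, which is \<open>umin\<close> with second index \<open>p\<close>, meet it only in
  \<open>p + 1\<close> and \<open>p\<close>; the indices of \<open>vmax\<close> stay below
  \<open>p\<close>.\<close>

lemma large_cover_of_u:
  assumes u: "r \<in> {1..d}" "i r \<noteq> umin r"
  shows "\<exists>C. minimal_cover {1..n} W C \<and> card C \<ge> 3"
proof -
  define p where "p = n - (d - 2) * t - 1"
  let ?C0 = "{2..p + 1}"
  define k where "k = (\<lambda>r. if r = 2 then p else umin r)"
  have p: "p + 1 = n - (d - 2) * t" "p \<ge> 3 + (d - 1) * t" "p + 1 \<le> n" using n_bound by (auto simp: p_def)
  have dt: "(d - 1) * t \<ge> t" using d by (cases d) auto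
  have tk: "tseq n d t k"
    unfolding tseq_def
  proof (intro conjI ballI)
    fix r assume r: "r \<in> {1..d}"
    then show "k r \<in> {1..n}" using tseq_umin p by (auto simp: k_def tseq_def)
  next
    fix r assume r: "r \<in> {1..<d}"
    show "k r + t \<le> k (Suc r)"
    proof (cases "r = 1")
      case True
      have "k r = 1" "k (Suc r) = p" using True by (simp_all add: k_def umin_def numeral_2_eq_2 One_nat_def)
      then show ?thesis using p(2) dt by linarith
    next
      case False
      have "umin 2 = p + 1" using p by (simp add: umin_def)
      then have "k r \<le> umin r" by (simp add: k_def)
      moreover have "umin r + t \<le> umin (Suc r)" using tseq_umin r by (simp add: tseq_def)
      moreover have "k (Suc r) = umin (Suc r)" using False by (simp add: k_def numeral_2_eq_2 One_nat_def)
      ultimately show ?thesis by linarith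
    qed
  qed
  \<comment> \<open>A deficit of \<open>i\<close> against \<open>umin\<close> at any place is
    carried by the gaps back to the second index.\<close>
  have i2: "i 2 \<le> p"
  proof -
    have r2: "r \<in> {2..d}" using u i(2) by (cases "r = 1") (auto simp: umin_def)
    have lt: "i r < n - (d - r) * t" using le_umin[OF i u(1)] u(2) r2 by (simp add: umin_def)
    have "i 2 + (r - 2) * t \<le> i r" using tseq_spread[OF i(1), of 2 r] r2 by auto
    moreover have "(r - 2) * t + (d - r) * t = (d - 2) * t"
      using r2 by (simp add: distrib_right[symmetric])
    ultimately show ?thesis using lt p by linarith
  qed
  have kW: "var_prod d k \<in> W"
  proof (rule W_I[OF tk])
    show "lexle d i k" using i2 le_umin[OF i] by (intro lexle_pointwise) (auto simp: k_def)
    show "lexle d k j" using d j by (intro lexle_first) (auto simp: k_def umin_def)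
  qed
  have "\<forall>w\<in>W. pkeys w \<inter> ?C0 \<noteq> {}"
  proof
    fix w assume "w \<in> W"
    then obtain k where k: "w = var_prod d k" "tseq n d t k" "lexle d i k" "lexle d k j" using W_iff by blast
    have "k 1 \<in> ?C0 \<or> k 2 \<in> ?C0"
      using W_first[OF k(2-4)]
    proof
      assume "k 1 = 1"
      then have "2 \<le> k 2" using tseq_spread[OF k(2), of 1 2] d t by simp
      moreover have "k 2 \<le> p + 1" using le_max[OF k(2), of 2] d p by simp
      ultimately show ?thesis by simp
    qed (use p in simp)
    moreover have "k 1 \<in> pkeys w" "k 2 \<in> pkeys w" unfolding k(1) keys_tseq[OF k(2)] using d by auto
    ultimately show "pkeys w \<inter> ?C0 \<noteq> {}" by blast
  qed
  moreover have C0n: "?C0 \<subseteq> {1..n}" using p by auto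
  ultimately obtain C where C: "C \<subseteq> ?C0" "minimal_cover {1..n} W C"
    using minimal_cover_exists[OF _ W_squarefree, of ?C0] by auto
  have large: "umin r \<ge> p + 1 + t" if "r \<in> {3..d}" for r
  proof -
    have "umin 2 + (r - 2) * t \<le> umin r" using tseq_spread[OF tseq_umin, of 2 r] that by auto
    moreover have "(r - 2) * t \<ge> t" using that by (cases "r - 2") auto
    moreover have "umin 2 = p + 1" using p by (simp add: umin_def)
    ultimately show ?thesis by linarith
  qed
  have "card C \<ge> 3"
  proof (rule minimal_cover_card_ge_3[OF C(2,1) _ umin_in_W _ kW _ _ vmax_in_W])
    show "pkeys (var_prod d umin) \<inter> ?C0 \<subseteq> {p + 1}"
    proof
      fix x assume "x \<in> pkeys (var_prod d umin) \<inter> ?C0"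
      then obtain r where r: "r \<in> {1..d}" "x = umin r" "x \<in> ?C0" unfolding keys_tseq[OF tseq_umin] by blast
      then consider "r = 1" | "r = 2" | "r \<in> {3..d}" by force
      then show "x \<in> {p + 1}"
      proof cases
        case 3
        then have "x \<ge> p + 1 + t" using large r(2) by simp
        moreover have "x \<le> p + 1" using r(3) by simp
        ultimately show ?thesis using t by linarith
      qed (use r p in \<open>auto simp: umin_def\<close>)
    qed
    show "pkeys (var_prod d k) \<inter> ?C0 \<subseteq> {p}"
    proof
      fix x assume "x \<in> pkeys (var_prod d k) \<inter> ?C0"
      then obtain r where r: "r \<in> {1..d}" "x = k r" "x \<in> ?C0" unfolding keys_tseq[OF tk] by blast
      then consider "r = 1" | "r = 2" | "r \<in> {3..d}" by force
      then show "x \<in> {p}"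
      proof cases
        case 3
        then have "x \<ge> p + 1 + t" using large[of r] r(2) by (simp add: k_def)
        moreover have "x \<le> p + 1" using r(3) by simp
        ultimately show ?thesis using t by linarith
      qed (use r p in \<open>auto simp: k_def umin_def\<close>)
    qed
    show "p + 1 \<notin> pkeys (var_prod d vmax)" "p \<notin> pkeys (var_prod d vmax)"
      unfolding keys_tseq[OF tseq_vmax] using vmax_values(2) p by fastforce+
  qed auto
  then show ?thesis using C(2) by blast
qed

lemma lexsegment_ideal_eq:
  "(lexsegment_ideal n d t (var_prod d i) (var_prod d j) :: ('k::field) polynomial set) =
     ideal_gen (polys {1..n}) (mon ` W)"
  by (simp add: lexsegment_ideal_def Idl_poly_ring)

lemma cohen_macaulay_imp:
  assumes "cohen_macaulay_ideal (poly_ring n :: ('k::field) polynomial ring)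
    (lexsegment_ideal n d t (var_prod d i) (var_prod d j))"
  shows "\<forall>r\<in>{1..d}. i r = umin r \<and> j r = vmax r"
proof (rule ccontr)
  assume "\<not> ?thesis"
  then obtain C where C: "minimal_cover {1..n} W C" "card C \<ge> 3"
    using large_cover_of_u large_cover_of_v by blast
  have "pkeys w \<inter> {1, 2} \<noteq> {}" if w: "w \<in> W" for w
  proof -
    obtain k where k: "w = var_prod d k" "tseq n d t k" "lexle d i k" "lexle d k j" using w W_iff by blast
    have "k 1 \<in> pkeys w" unfolding k(1) keys_tseq[OF k(2)] using d by auto
    then show ?thesis using W_first[OF k(2-4)] by auto
  qed
  then have "card C \<le> 2"
    using cohen_macaulay_minimal_cover[OF _ _ C(1)] assms n unfolding lexsegment_ideal_eq by auto
  then show False using C(2) by simp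
qed

lemma imp_cohen_macaulay:
  assumes "\<And>r. r \<in> {1..d} \<Longrightarrow> i r = umin r" "\<And>r. r \<in> {1..d} \<Longrightarrow> j r = vmax r"
  shows "cohen_macaulay_ideal (poly_ring n :: ('k::field) polynomial ring)
    (lexsegment_ideal n d t (var_prod d i) (var_prod d j))"
proof -
  let ?U = "umin ` {1..d}" and ?V = "vmax ` {1..d}"
  have mon: "mon (var_prod d k) = (prod var (k ` {1..d}) :: 'k polynomial)" if "tseq n d t k" for k
    using var_prod_eq_sum[OF tseq_strict_mono[OF that t]] by (simp add: prod_var)
  have gens: "mon ` W = {prod var ?U, prod var ?V :: 'k polynomial}"
    using W_eq[OF assms] mon[OF tseq_umin] mon[OF tseq_vmax] by simp
  have sub: "?U \<subseteq> {1..n}" "?V \<subseteq> {1..n}" using tseq_umin tseq_vmax by (auto simp: tseq_def)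
  have "umin r \<noteq> vmax q" if "r \<in> {1..d}" "q \<in> {1..d}" for r q
    using that vmax_values[of q] umin_values[of r] n_bound by (cases "r = 1") (auto simp: umin_def)
  then have "?U \<inter> ?V = {}" by blast
  then show ?thesis
    unfolding lexsegment_ideal_eq gens by (rule complete_intersection_cohen_macaulay[OF sub])
qed

end

theorem theorem3p3:
  fixes n d t :: nat and i j :: "nat \<Rightarrow> nat" and u v :: monomial
    and I :: "('k::field) polynomial set"
  assumes "n \<ge> 1" and "t \<ge> 1" and "d \<ge> 2"
    and "u \<in> t_spread_monomials n d t" and "v \<in> t_spread_monomials n d t"
    and "u = var_prod d i" and "strict_mono_on {1..d} i"
    and "v = var_prod d j" and "strict_mono_on {1..d} j"
    and "i 1 = 1" and "j 1 = 2"
    and "I = lexsegment_ideal n d t u v"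
    and "n \<ge> 4 + (2 * d - 3) * t"
  shows "cohen_macaulay_ideal (poly_ring n :: 'k polynomial ring) I \<longleftrightarrow>
     u = var_prod d (\<lambda>r. if r = 1 then 1 else n - (d - r) * t) \<and>
     v = var_prod d (\<lambda>r. 2 + (r - 1) * t)"
proof -
  \<comment> \<open>Membership provides some \<open>t\<close>-spread index sequence; strict
    monotonicity identifies it with the given one.\<close>
  have tseq: "tseq n d t k"
    if k: "var_prod d k \<in> t_spread_monomials n d t" "strict_mono_on {1..d} k" for k
  proof -
    obtain k' where k': "var_prod d k = var_prod d k'" "tseq n d t k'"
      using k(1) t_spread_monomials_iff[OF assms(2)] by blast
    have "k r = k' r" if "r \<in> {1..d}" for r
      using var_prod_unique(2)[OF k(2) tseq_strict_mono[OF k'(2) assms(2)] k'(1) that] .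
    then show ?thesis using k'(2) by (auto simp: tseq_def)
  qed
  interpret lexsegment_setup n d t i j
    by unfold_locales (use assms tseq in auto)
  have u: "u = var_prod d umin \<longleftrightarrow> (\<forall>r\<in>{1..d}. i r = umin r)"
    unfolding assms(6)
    using var_prod_unique(2)[OF assms(7) tseq_strict_mono[OF tseq_umin assms(2)]] var_prod_cong[of d i umin]
    by blast
  have v: "v = var_prod d vmax \<longleftrightarrow> (\<forall>r\<in>{1..d}. j r = vmax r)"
    unfolding assms(8)
    using var_prod_unique(2)[OF assms(9) tseq_strict_mono[OF tseq_vmax assms(2)]] var_prod_cong[of d j vmax]
    by blast
  have "cohen_macaulay_ideal (poly_ring n :: 'k polynomial ring) I \<longleftrightarrow>
      (\<forall>r\<in>{1..d}. i r = umin r) \<and> (\<forall>r\<in>{1..d}. j r = vmax r)"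
    unfolding assms(12,6,8) using cohen_macaulay_imp imp_cohen_macaulay by blast
  then show ?thesis unfolding u[symmetric] v[symmetric] unfolding umin_def vmax_def .
qed

end
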